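(* Let $T>0$, let $\{a_N\}_{N\ge1}$ be a positive sequence with $\lim_{N\to\infty} a_N/N=\lim_{N\to\infty}\sqrt N/a_N=0$, and let $\phi\in C(\mathbb{T})$ satisfy $0<\phi(u)<1$ for all $u\in\mathbb{T}$. For each $N\ge 1$ let $\{\eta_t^N\}_{t\ge0}$ be the simple exclusion process on $\mathbb{T}^N$ with generator $\mathcal{L}_N$ such that $\{\eta_0^N(x)\}_{x\in\mathbb{T}^N}$ are independent with $P(\eta_0^N(x)=1)=\phi(x/N)$ for all $x\in\mathbb{T}^N$. Let $\{\rho_t\}_{t\ge0}$ be the unique weak solution of the heat equation $\partial_t\rho=\partial_{uu}^2\rho$ on $\mathbb{T}$ with $\rho_0=\phi$. Then for any $\epsilon>0$ and any $G\in C^{1,0}([0,T]\times\mathbb{T})$, $$\limsup_{N\to+\infty}\frac{N}{a_N^2}\log P\left(\left|\int_0^T\frac1N\sum_{x\in\mathbb{T}^N}\eta_s^N(x)\eta_s^N(x+1)G_s\left(\frac xN\right)ds-\int_0^T\int_{\mathbb{T}}\rho_s^2(u)G_s(u)\,du\,ds\right|>\epsilon\right)=-\infty.$$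
   Context: Process: for $N\ge1$, $\mathbb{T}^N=\{0,1,\dots,N-1\}$ with arithmetic modulo $N$. The process $\{\eta^N_t\}_{t\ge0}$ is the continuous-time Markov process with state space $\{0,1\}^{\mathbb{T}^N}$ and generator $$\mathcal{L}_Nf(\eta)=N^2\sum_{x\in\mathbb{T}^N}\left[f(\eta^{x,x+1})-f(\eta)\right],$$ where $\eta^{x,x+1}$ is obtained from $\eta$ by exchanging the values $\eta(x)$ and $\eta(x+1)$. $\mathbb{T}=[0,1)$ is the one-dimensional torus (arithmetic modulo $1$). $C^{1,0}([0,T]\times\mathbb{T})$ denotes the functions $G(t,u)=G_t(u)$ that are continuously differentiable in $t$ and continuous in $u$ (in particular jointly continuous on $[0,T]\times\mathbb{T}$). The continuous version of $\rho$ is $\rho_t(u)=\mathbb{E}\,\phi(u+\sqrt2B_t)$ with $B$ a standard Brownian motion started at $0$. Convention: $\log0=-\infty$. *)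

theory Defs
  imports "HOL-Probability.Probability" "HOL-Library.Periodic_Fun"
begin

section \<open>Continuous-time Markov processes on a finite state space\<close>

definition markov_semigroup :: "'s set \<Rightarrow> (real \<Rightarrow> 's \<Rightarrow> 's pmf) \<Rightarrow> bool" where
  "markov_semigroup S K \<longleftrightarrow>
     (\<forall>x\<in>S. K 0 x = return_pmf x) \<and>
     (\<forall>t\<ge>0. \<forall>x\<in>S. set_pmf (K t x) \<subseteq> S) \<and>
     (\<forall>s\<ge>0. \<forall>t\<ge>0. \<forall>x\<in>S. K (s + t) x = bind_pmf (K s x) (K t))"

definition has_generator ::
  "'s set \<Rightarrow> (real \<Rightarrow> 's \<Rightarrow> 's pmf) \<Rightarrow> (('s \<Rightarrow> real) \<Rightarrow> 's \<Rightarrow> real) \<Rightarrow> bool" where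
  "has_generator S K L \<longleftrightarrow>
     (\<forall>f. \<forall>x\<in>S. ((\<lambda>t. (measure_pmf.expectation (K t x) f - f x) / t) \<longlongrightarrow> L f x) (at_right 0))"

text \<open>The state space is discrete, so every set \<open>A\<close> of states is admitted below.\<close>

definition natural_filtration :: "'w measure \<Rightarrow> (real \<Rightarrow> 'w \<Rightarrow> 's) \<Rightarrow> real \<Rightarrow> 'w measure" where
  "natural_filtration M X t = sigma (space M) {X s -` A \<inter> space M | s A. 0 \<le> s \<and> s \<le> t}"

text \<open>Right-continuity and existence of left limits with respect to the discrete topology.\<close>

definition cadlag_discrete :: "(real \<Rightarrow> 's) \<Rightarrow> bool" where
  "cadlag_discrete p \<longleftrightarrow>
     (\<forall>t\<ge>0. \<forall>\<^sub>F s in at_right t. p s = p t) \<and>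
     (\<forall>t>0. \<exists>y. \<forall>\<^sub>F s in at_left t. p s = y)"

text \<open>
  \<open>S\<close> is meant to be finite, so that every \<open>f :: 's \<Rightarrow> real\<close> is bounded on \<open>S\<close> and the
  conditional expectations are those of bounded random variables. No initial law is imposed.
\<close>

definition markov_process_with_generator ::
  "'w measure \<Rightarrow> 's set \<Rightarrow> (('s \<Rightarrow> real) \<Rightarrow> 's \<Rightarrow> real) \<Rightarrow> (real \<Rightarrow> 'w \<Rightarrow> 's) \<Rightarrow> bool" where
  "markov_process_with_generator M S L X \<longleftrightarrow>
     prob_space M \<and>
     (\<forall>t\<ge>0. X t \<in> measurable M (count_space S)) \<and>
     (\<forall>\<omega>\<in>space M. cadlag_discrete (\<lambda>t. X t \<omega>)) \<and>
     (\<exists>K. markov_semigroup S K \<and> has_generator S K L \<and>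
        (\<forall>s\<ge>0. \<forall>t\<ge>0. \<forall>f. AE \<omega> in M.
           real_cond_exp M (natural_filtration M X s) (\<lambda>\<omega>'. f (X (s + t) \<omega>')) \<omega> =
           measure_pmf.expectation (K t (X s \<omega>)) f))"

section \<open>The symmetric simple exclusion process on the discrete torus\<close>

text \<open>
  The discrete torus with \<open>N\<close> sites is \<open>{..<N}\<close>; the right neighbour of \<open>x\<close> is
  \<open>(x + 1) mod N\<close>. Configurations are extensional functions, so that each element of
  \<open>{0,1}\<close> to the power of the torus has exactly one representative.
\<close>

type_synonym config = "nat \<Rightarrow> nat"

definition configs :: "nat \<Rightarrow> config set" where
  "configs N = {..<N} \<rightarrow>\<^sub>E {0, 1}"

definition exchange :: "config \<Rightarrow> nat \<Rightarrow> nat \<Rightarrow> config" where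
  "exchange \<eta> x y = \<eta>(x := \<eta> y, y := \<eta> x)"

definition ssep_generator :: "nat \<Rightarrow> (config \<Rightarrow> real) \<Rightarrow> config \<Rightarrow> real" where
  "ssep_generator N f \<eta> = (real N)\<^sup>2 * (\<Sum>x<N. f (exchange \<eta> x ((x + 1) mod N)) - f \<eta>)"

definition ssep_from_product ::
  "nat \<Rightarrow> (real \<Rightarrow> real) \<Rightarrow> 'w measure \<Rightarrow> (real \<Rightarrow> 'w \<Rightarrow> config) \<Rightarrow> bool" where
  "ssep_from_product N \<phi> M \<eta> \<longleftrightarrow>
     markov_process_with_generator M (configs N) (ssep_generator N) \<eta> \<and>
     prob_space.indep_vars M (\<lambda>_. count_space UNIV) (\<lambda>x \<omega>. \<eta> 0 \<omega> x) {..<N} \<and>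
     (\<forall>x<N. \<P>(\<omega> in M. \<eta> 0 \<omega> x = 1) = \<phi> (real x / real N))"

section \<open>Functions on the continuous torus and the heat equation\<close>

text \<open>
  Functions on the continuous torus (the interval from 0 to 1 modulo 1) are represented by
  1-periodic functions on the real line (\<open>periodic_fun_simple'\<close>); continuity on the torus is
  then continuity on the real line, and integration over the torus is integration over
  \<open>{0..<1}\<close>.
\<close>

definition torus_continuous :: "(real \<Rightarrow> real) \<Rightarrow> bool" where
  "torus_continuous f \<longleftrightarrow> periodic_fun_simple' f \<and> continuous_on UNIV f"

text \<open>
  The class \<open>C\<^sup>1\<^sup>,\<^sup>0\<close>: jointly continuous, and continuously differentiable in time
  (one-sided at the end points) for every fixed point of the torus.
\<close>

definition C10_torus :: "real \<Rightarrow> (real \<Rightarrow> real \<Rightarrow> real) \<Rightarrow> bool" where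
  "C10_torus T G \<longleftrightarrow>
     (\<forall>t\<in>{0..T}. periodic_fun_simple' (G t)) \<and>
     continuous_on ({0..T} \<times> UNIV) (\<lambda>(t, u). G t u) \<and>
     (\<exists>G'. \<forall>u. (\<forall>t\<in>{0..T}. ((\<lambda>s. G s u) has_real_derivative G' t u) (at t within {0..T})) \<and>
               continuous_on {0..T} (\<lambda>t. G' t u))"

text \<open>
  Weak solution, on the torus and for all times \<open>t \<ge> 0\<close>, of the heat equation (time derivative
  equal to second space derivative) with initial value \<open>\<phi>\<close>: for every twice
  continuously differentiable test function \<open>f\<close> on the torus, with derivatives \<open>f'\<close>, \<open>f''\<close>,
  the integral of \<open>\<rho> t * f\<close> is that of \<open>\<phi> * f\<close> plus the integral of \<open>\<rho> s * f''\<close> over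
  times \<open>s\<close> in \<open>{0..t}\<close>. The initial condition is contained in the case \<open>t = 0\<close>. Such a
  solution is determined only up to null sets.
\<close>

definition heat_weak_solution :: "(real \<Rightarrow> real) \<Rightarrow> (real \<Rightarrow> real \<Rightarrow> real) \<Rightarrow> bool" where
  "heat_weak_solution \<phi> \<rho> \<longleftrightarrow>
     (\<forall>t\<ge>0. periodic_fun_simple' (\<rho> t)) \<and>
     (\<forall>t\<ge>0. set_integrable lborel {0..<1} (\<rho> t)) \<and>
     (\<forall>t\<ge>0. set_integrable lborel ({0..t} \<times> {0..<1}) (\<lambda>(s, u). \<rho> s u)) \<and>
     (\<forall>t\<ge>0. \<forall>f f' f''.
        periodic_fun_simple' f \<and>
        (\<forall>u. (f has_real_derivative f' u) (at u)) \<and>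
        (\<forall>u. (f' has_real_derivative f'' u) (at u)) \<and>
        continuous_on UNIV f'' \<longrightarrow>
        (LBINT u:{0..<1}. \<rho> t u * f u) =
          (LBINT u:{0..<1}. \<phi> u * f u) +
          (LBINT s:{0..t}. (LBINT u:{0..<1}. \<rho> s u * f'' u)))"

section \<open>Logarithm of a probability\<close>

text \<open>The real \<open>ln\<close> satisfies \<open>ln 0 = 0\<close>; here the logarithm of 0 is minus infinity.\<close>

definition log_prob :: "real \<Rightarrow> ereal" where
  "log_prob p = (if p = 0 then -\<infinity> else ereal (ln p))"

end

theory Submission
  imports Defs "HOL-Combinatorics.Transposition"
begin

text \<open>
  As \<open>a\<^sub>N\<^sup>2 / N\<close> is negligible with respect to \<open>N\<close>, an exponential bound \<open>exp (- c N)\<close> on the probability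
  suffices, and by convexity in time it follows from exponential moments of the pair field at a
  fixed time, hence from the one-time laws only. A product law is preserved by a partial exchange
  across one bond up to an exact error: the squared density difference across the bond times the
  second mixed difference of the observable, while the sum of the squared densities drops by twice
  the same amount. So the law at time \<open>t\<close> is compared with the product law of mean densities, at
  a cost controlled by the mixed differences of the exponential observable. These are of the
  order of the pair field itself for adjacent sites; evolving the pair field for a further time
  \<open>\<kappa> / N\<^sup>2\<close> before exponentiating makes them small uniformly, because two particles are then unlikely
  to be adjacent. A weak solution is identified with the limit of the mean densities through its
  Fourier coefficients, each of which solves a scalar linear Volterra equation.
\<close>

section \<open>Exchange operators and product measures\<close>

text \<open>The estimates are ordered by powers of the exponential parameter \<open>l\<close>. For
  the observable \<open>l * N\<close> times the pair field, one site changes the value by order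
  \<open>l\<close>, there are \<open>N\<close> sites, and the total exchange rate is
  \<open>N^3\<close>. Errors of order \<open>l^2\<close> per site are harmless, since
  \<open>l\<close> is chosen small at the end. The obstacle is an error of first order: the mixed
  difference of an adjacent pair is of order \<open>l\<close> and is charged against an energy drop
  that may be as large as \<open>N\<close>. Smearing for time \<open>\<kappa> / N^2\<close> brings
  that mixed difference down to order \<open>\<epsilon> * l\<close>, at a cost of order
  \<open>l^2 * \<kappa> * N\<close>, which is again of second order. The generator is given only as
  a derivative at time 0, so the semigroup is reached as a limit of explicit Markov operators. Two
  kinds are used: ordered products of partial exchanges, under which product laws transform by an
  exact formula, and Euler steps, under which bounds on mixed differences in terms of the gap of the
  pair obey a linear recursion. Smearing needs a past of positive length, so a short initial time
  interval is estimated by boundedness alone.\<close>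

declare One_nat_def [simp del]

text \<open>Exchanges act on configurations by composition with this involution of the sites, so
  that one map describes both the motion of particles and the motion of the sites at which an
  observable is differenced.\<close>

definition bond :: "nat \<Rightarrow> nat \<Rightarrow> nat \<Rightarrow> nat" where
  "bond N b = Transposition.transpose b ((b + 1) mod N)"

lemma bond_bond [simp]: "bond N b (bond N b x) = x"
  by (simp add: bond_def)

lemma bond_less_iff: "b < N \<Longrightarrow> bond N b x < N \<longleftrightarrow> x < N"
  by (auto simp: bond_def Transposition.transpose_def)

lemma bond_eq_iff [simp]: "bond N b x = bond N b y \<longleftrightarrow> x = y"
  by (metis bond_bond)

lemma exchange_eq_bond: "exchange \<eta> x ((x + 1) mod N) = \<eta> \<circ> bond N x"
  by (auto simp: exchange_def bond_def Transposition.transpose_def fun_eq_iff)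

lemma bond_upd: "\<eta>(u := i) \<circ> bond N b = (\<eta> \<circ> bond N b)(bond N b u := i)"
  by (auto simp: fun_eq_iff)

lemma configs_upd: "\<eta> \<in> configs N \<Longrightarrow> u < N \<Longrightarrow> i \<in> {0, 1} \<Longrightarrow> \<eta>(u := i) \<in> configs N"
  by (auto simp: configs_def PiE_iff extensional_def)

lemma configs_upd01 [simp]:
  "\<eta> \<in> configs N \<Longrightarrow> u < N \<Longrightarrow> \<eta>(u := 0) \<in> configs N"
  "\<eta> \<in> configs N \<Longrightarrow> u < N \<Longrightarrow> \<eta>(u := 1) \<in> configs N"
  "\<eta> \<in> configs N \<Longrightarrow> u < N \<Longrightarrow> \<eta>(u := Suc 0) \<in> configs N"
  using configs_upd[of \<eta> N u 0] configs_upd[of \<eta> N u 1] by (simp_all add: One_nat_def)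

lemma configs_bond: "\<eta> \<in> configs N \<Longrightarrow> b < N \<Longrightarrow> \<eta> \<circ> bond N b \<in> configs N"
  by (auto simp: configs_def PiE_iff extensional_def bond_less_iff)

lemma finite_configs [simp]: "finite (configs N)"
  by (auto simp: configs_def intro!: finite_PiE)

lemma configs_cases: "\<eta> \<in> configs N \<Longrightarrow> x < N \<Longrightarrow> \<eta> x = 0 \<or> \<eta> x = 1"
  by (auto simp: configs_def PiE_iff)

text \<open>The Markov operator of an exchange across bond \<open>b\<close> with probability
  \<open>p\<close>, acting on observables; \<open>density_step\<close> is the matching action on
  mean densities. With \<open>p = h * N^2\<close> it is one factor of the product approximation of
  the semigroup.\<close>

definition bond_step :: "nat \<Rightarrow> real \<Rightarrow> nat \<Rightarrow> (config \<Rightarrow> real) \<Rightarrow> config \<Rightarrow> real" where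
  "bond_step N p b f \<eta> = (1 - p) * f \<eta> + p * f (\<eta> \<circ> bond N b)"

definition density_step :: "nat \<Rightarrow> real \<Rightarrow> nat \<Rightarrow> (nat \<Rightarrow> real) \<Rightarrow> nat \<Rightarrow> real" where
  "density_step N p b \<rho> x = (1 - p) * \<rho> x + p * \<rho> (bond N b x)"

definition site_lipschitz :: "nat \<Rightarrow> real \<Rightarrow> (config \<Rightarrow> real) \<Rightarrow> bool" where
  "site_lipschitz N c f \<longleftrightarrow> (\<forall>\<eta>\<in>configs N. \<forall>u<N. \<forall>i\<in>{0, 1}. \<bar>f (\<eta>(u := i)) - f \<eta>\<bar> \<le> c)"

definition mixed_diff :: "nat \<Rightarrow> nat \<Rightarrow> (config \<Rightarrow> real) \<Rightarrow> config \<Rightarrow> real" where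
  "mixed_diff u v f \<eta> = f (\<eta>(u := 1, v := 1)) - f (\<eta>(u := 1, v := 0))
     - f (\<eta>(u := 0, v := 1)) + f (\<eta>(u := 0, v := 0))"

text \<open>Updating \<open>u\<close> before an exchange is the same as updating
  \<open>bond N b u\<close> after it. Hence the pair of differenced sites moves like two exclusion
  particles, which is the duality behind all bounds on mixed differences.\<close>

lemma mixed_diff_bond_step: "mixed_diff u v (bond_step N p b f) \<eta> =
    (1 - p) * mixed_diff u v f \<eta> + p * mixed_diff (bond N b u) (bond N b v) f (\<eta> \<circ> bond N b)"
  by (simp add: mixed_diff_def bond_step_def bond_upd algebra_simps)

lemma site_lipschitzD: "site_lipschitz N c f \<Longrightarrow> \<eta> \<in> configs N \<Longrightarrow> u < N \<Longrightarrow> i \<in> {0, 1} \<Longrightarrow> \<bar>f (\<eta>(u := i)) - f \<eta>\<bar> \<le> c"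
  unfolding site_lipschitz_def by blast

lemma convex_abs_le:
  fixes p :: real
  assumes "0 \<le> p" "p \<le> 1" "\<bar>x\<bar> \<le> c" "\<bar>y\<bar> \<le> d"
  shows "\<bar>(1 - p) * x + p * y\<bar> \<le> (1 - p) * c + p * d"
proof -
  have "\<bar>(1 - p) * x + p * y\<bar> \<le> \<bar>(1 - p) * x\<bar> + \<bar>p * y\<bar>" by (rule abs_triangle_ineq)
  also have "\<dots> = (1 - p) * \<bar>x\<bar> + p * \<bar>y\<bar>" using assms by (simp add: abs_mult)
  also have "\<dots> \<le> (1 - p) * c + p * d" using assms by (intro add_mono mult_left_mono) auto
  finally show ?thesis .
qed

lemma site_lipschitz_bond_step:
  assumes f: "site_lipschitz N c f" and p: "0 \<le> p" "p \<le> 1" and b: "b < N"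
  shows "site_lipschitz N c (bond_step N p b f)"
  unfolding site_lipschitz_def
proof (intro ballI allI impI)
  fix \<eta> u and i :: nat assume A: "\<eta> \<in> configs N" "u < N" "i \<in> {0, 1}"
  have "bond_step N p b f (\<eta>(u := i)) - bond_step N p b f \<eta> =
     (1 - p) * (f (\<eta>(u := i)) - f \<eta>) + p * (f ((\<eta> \<circ> bond N b)(bond N b u := i)) - f (\<eta> \<circ> bond N b))"
    by (simp only: bond_step_def bond_upd) (simp add: algebra_simps)
  moreover have "\<bar>f (\<eta>(u := i)) - f \<eta>\<bar> \<le> c" using site_lipschitzD[OF f A] .
  moreover have "\<bar>f ((\<eta> \<circ> bond N b)(bond N b u := i)) - f (\<eta> \<circ> bond N b)\<bar> \<le> c"
    using site_lipschitzD[OF f configs_bond[OF A(1) b] _ A(3)] A b by (simp add: bond_less_iff)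
  ultimately show "\<bar>bond_step N p b f (\<eta>(u := i)) - bond_step N p b f \<eta>\<bar> \<le> c"
    using convex_abs_le[OF p, of "f (\<eta>(u := i)) - f \<eta>" c
      "f ((\<eta> \<circ> bond N b)(bond N b u := i)) - f (\<eta> \<circ> bond N b)" c]
    by (simp add: left_diff_distrib)
qed

lemma exchange_upd: "(\<eta> :: config) \<circ> bond N b = \<eta>(b := \<eta> ((b + 1) mod N), (b + 1) mod N := \<eta> b)"
  unfolding exchange_eq_bond[symmetric] exchange_def by (rule refl)

text \<open>An exchange is two successive updates of single sites, which is where the factor 2 comes
  from.\<close>

lemma site_lipschitz_bond:
  assumes f: "site_lipschitz N c f" and b: "b < N" and \<eta>: "\<eta> \<in> configs N"
  shows "\<bar>f (\<eta> \<circ> bond N b) - f \<eta>\<bar> \<le> 2 * c"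
proof -
  let ?y = "(b + 1) mod N"
  have y: "?y < N" using b by simp
  have e: "\<eta> b \<in> {0, 1}" "\<eta> ?y \<in> {0, 1}" using configs_cases[OF \<eta> b] configs_cases[OF \<eta> y] by auto
  have "\<eta>(b := \<eta> ?y) \<in> configs N" using configs_upd[OF \<eta> b] e by simp
  from site_lipschitzD[OF f this y e(1)] site_lipschitzD[OF f \<eta> b e(2)] show ?thesis
    using exchange_upd[of \<eta> N b] b by (simp del: One_nat_def)
qed

text \<open>Expectation under the product Bernoulli law with densities \<open>\<rho>\<close>,
  integrated from the last site downwards; \<open>\<lambda>_. undefined\<close> is the only element
  of \<open>configs 0\<close>. Being polynomial in the densities, it satisfies its algebraic
  identities for arbitrary real \<open>\<rho>\<close>; bounds on \<open>\<rho>\<close> enter only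
  with positivity.\<close>

fun prodE :: "nat \<Rightarrow> (nat \<Rightarrow> real) \<Rightarrow> (config \<Rightarrow> real) \<Rightarrow> real" where
  "prodE 0 \<rho> f = f (\<lambda>_. undefined)"
| "prodE (Suc k) \<rho> f = prodE k \<rho> (\<lambda>\<eta>. \<rho> k * f (\<eta>(k := 1)) + (1 - \<rho> k) * f (\<eta>(k := 0)))"

definition site_avg :: "nat \<Rightarrow> real \<Rightarrow> (config \<Rightarrow> real) \<Rightarrow> config \<Rightarrow> real" where
  "site_avg x r f \<eta> = r * f (\<eta>(x := 1)) + (1 - r) * f (\<eta>(x := 0))"

lemma prodE_Suc: "prodE (Suc k) \<rho> f = prodE k \<rho> (site_avg k (\<rho> k) f)"
  by (simp add: site_avg_def[abs_def])

lemma prodE_lin: "prodE N \<rho> (\<lambda>\<eta>. a * f \<eta> + g \<eta>) = a * prodE N \<rho> f + prodE N \<rho> g"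
proof (induction N arbitrary: f g)
  case (Suc N)
  have "prodE (Suc N) \<rho> (\<lambda>\<eta>. a * f \<eta> + g \<eta>) =
    prodE N \<rho> (\<lambda>\<eta>. a * site_avg N (\<rho> N) f \<eta> + site_avg N (\<rho> N) g \<eta>)"
    unfolding prodE_Suc by (rule arg_cong[where f = "prodE N \<rho>"]) (auto simp: site_avg_def algebra_simps)
  then show ?case unfolding Suc.IH prodE_Suc .
qed simp

lemma prodE_0 [simp]: "prodE N \<rho> (\<lambda>_. 0) = 0"
  by (induction N) auto

lemma prodE_const [simp]: "prodE N \<rho> (\<lambda>_. c) = c"
  by (induction N arbitrary: c) (auto simp: algebra_simps)

lemma prodE_cmult: "prodE N \<rho> (\<lambda>\<eta>. a * f \<eta>) = a * prodE N \<rho> f"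
  using prodE_lin[of N \<rho> a f "\<lambda>_. 0"] by simp

lemma prodE_add: "prodE N \<rho> (\<lambda>\<eta>. f \<eta> + g \<eta>) = prodE N \<rho> f + prodE N \<rho> g"
  using prodE_lin[of N \<rho> 1 f g] by simp

lemma prodE_diff: "prodE N \<rho> (\<lambda>\<eta>. f \<eta> - g \<eta>) = prodE N \<rho> f - prodE N \<rho> g"
  using prodE_lin[of N \<rho> "-1" g f] by simp

lemma prodE_sum: "prodE N \<rho> (\<lambda>\<eta>. \<Sum>i\<in>I. f i \<eta>) = (\<Sum>i\<in>I. prodE N \<rho> (f i))"
  by (induction I rule: infinite_finite_induct) (simp_all add: prodE_add)

lemma configs_Suc_upd: "\<eta> \<in> configs k \<Longrightarrow> \<eta>(k := 0) \<in> configs (Suc k)" "\<eta> \<in> configs k \<Longrightarrow> \<eta>(k := 1) \<in> configs (Suc k)"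
  by (auto simp: configs_def PiE_iff extensional_def less_Suc_eq)

lemma prodE_nonneg:
  assumes "\<And>x. x < N \<Longrightarrow> 0 \<le> \<rho> x \<and> \<rho> x \<le> 1" "\<And>\<eta>. \<eta> \<in> configs N \<Longrightarrow> 0 \<le> f \<eta>"
  shows "0 \<le> prodE N \<rho> f"
  using assms
proof (induction N arbitrary: f)
  case 0 then show ?case by (simp add: configs_def)
next
  case (Suc N)
  show ?case unfolding prodE_Suc
  proof (rule Suc.IH)
    fix \<eta> assume "\<eta> \<in> configs N"
    then have "0 \<le> f (\<eta>(N := 1))" "0 \<le> f (\<eta>(N := 0))"
      using Suc.prems(2) configs_Suc_upd by blast+
    moreover have "0 \<le> \<rho> N" "\<rho> N \<le> 1" using Suc.prems(1)[of N] by auto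
    ultimately show "0 \<le> site_avg N (\<rho> N) f \<eta>" unfolding site_avg_def
      by (intro add_nonneg_nonneg mult_nonneg_nonneg) auto
  qed (use Suc.prems(1) in auto)
qed

lemma prodE_mono:
  assumes "\<And>x. x < N \<Longrightarrow> 0 \<le> \<rho> x \<and> \<rho> x \<le> 1" "\<And>\<eta>. \<eta> \<in> configs N \<Longrightarrow> f \<eta> \<le> g \<eta>"
  shows "prodE N \<rho> f \<le> prodE N \<rho> g"
  using prodE_nonneg[of N \<rho> "\<lambda>\<eta>. g \<eta> - f \<eta>"] assms by (simp add: prodE_diff)

lemma prodE_cong:
  assumes "\<And>\<eta>. \<eta> \<in> configs N \<Longrightarrow> f \<eta> = g \<eta>"
  shows "prodE N \<rho> f = prodE N \<rho> g"
  using assms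
proof (induction N arbitrary: f g)
  case 0 then show ?case by (simp add: configs_def)
next
  case (Suc N)
  show ?case unfolding prodE_Suc
  proof (rule Suc.IH)
    fix \<eta> assume "\<eta> \<in> configs N"
    then have "f (\<eta>(N := 1)) = g (\<eta>(N := 1))" "f (\<eta>(N := 0)) = g (\<eta>(N := 0))"
      using Suc.prems configs_Suc_upd by blast+
    then show "site_avg N (\<rho> N) f \<eta> = site_avg N (\<rho> N) g \<eta>" unfolding site_avg_def by (simp only:)
  qed
qed

lemma prodE_abs_le:
  assumes "\<And>x. x < N \<Longrightarrow> 0 \<le> \<rho> x \<and> \<rho> x \<le> 1" "\<And>\<eta>. \<eta> \<in> configs N \<Longrightarrow> \<bar>f \<eta>\<bar> \<le> c"
  shows "\<bar>prodE N \<rho> f\<bar> \<le> c"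
proof -
  have "f \<eta> \<le> c" "- c \<le> f \<eta>" if "\<eta> \<in> configs N" for \<eta> using assms(2)[OF that] by auto
  then show ?thesis
    using prodE_mono[of N \<rho> f "\<lambda>_. c"] prodE_mono[of N \<rho> "\<lambda>_. - c" f] assms(1) by auto
qed

lemma site_avg_commute: "x \<noteq> y \<Longrightarrow> site_avg x r (site_avg y s f) = site_avg y s (site_avg x r f)"
  by (auto simp: site_avg_def fun_eq_iff fun_upd_twist algebra_simps)

lemma site_avg_idem: "site_avg x r (site_avg x s f) = site_avg x s f"
  by (auto simp: site_avg_def fun_eq_iff algebra_simps)

text \<open>Site averages at different sites commute and repeated averages at one site collapse, so
  any chosen site can be integrated out first, although the recursion only offers the last
  one.\<close>

lemma prodE_site_avg: "x < N \<Longrightarrow> prodE N \<rho> (site_avg x (\<rho> x) f) = prodE N \<rho> f"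
proof (induction N arbitrary: f)
  case (Suc N)
  show ?case
  proof (cases "x = N")
    case True then show ?thesis by (simp only: prodE_Suc site_avg_idem)
  next
    case False
    then have "x < N" using Suc.prems by simp
    then show ?thesis unfolding prodE_Suc using Suc.IH[of "site_avg N (\<rho> N) f"] site_avg_commute[OF False] by metis
  qed
qed simp

text \<open>A density matters only if \<open>f\<close> depends on its site. The typical use is for
  functions in which the two sites of a bond have been averaged out, or for mixed differences, which
  ignore the values at their own two sites.\<close>

lemma prodE_density_irrelevant:
  assumes "\<And>x \<eta> i. x < N \<Longrightarrow> \<rho> x \<noteq> \<rho>' x \<Longrightarrow> f (\<eta>(x := i)) = f \<eta>"
  shows "prodE N \<rho> f = prodE N \<rho>' f"
  using assms
proof (induction N arbitrary: f)
  case (Suc N)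
  have e: "site_avg N (\<rho> N) f = site_avg N (\<rho>' N) f"
  proof (cases "\<rho> N = \<rho>' N")
    case False
    then have "f (\<eta>(N := i)) = f \<eta>" for \<eta> i using Suc.prems[of N] by (metis lessI)
    then show ?thesis unfolding site_avg_def[abs_def] by (simp add: algebra_simps)
  qed simp
  have "prodE N \<rho> (site_avg N (\<rho> N) f) = prodE N \<rho>' (site_avg N (\<rho> N) f)"
  proof (rule Suc.IH)
    fix x \<eta> and i :: nat assume x: "x < N" "\<rho> x \<noteq> \<rho>' x"
    then show "site_avg N (\<rho> N) f (\<eta>(x := i)) = site_avg N (\<rho> N) f \<eta>"
      by (simp only: site_avg_def fun_upd_twist[OF less_imp_neq[OF x(1)]] Suc.prems[OF less_SucI[OF x(1)] x(2)])
  qed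
  then show ?case unfolding prodE_Suc e .
qed simp

text \<open>Everything happens at the two sites of the bond. Mixing a product law with its exchanged
  copy leaves the mean of the product of the two occupations at \<open>\<rho> b * \<rho> y\<close>,
  whereas the product of the new means exceeds this by
  \<open>p * (1 - p) * (\<rho> b - \<rho> y)^2\<close>. The single-site means agree, so this
  covariance is the whole discrepancy, and it is multiplied by the part of \<open>f\<close> bilinear
  in the two sites, its mixed difference.\<close>

lemma prodE_bond_step:
  assumes b: "b < N" and N: "2 \<le> N"
  defines "y \<equiv> (b + 1) mod N"
  shows "prodE N \<rho> (bond_step N p b f) = prodE N (density_step N p b \<rho>) f
     - p * (1 - p) * (\<rho> b - \<rho> y)\<^sup>2 * prodE N \<rho> (mixed_diff b y f)"
proof -
  let ?\<rho>' = "density_step N p b \<rho>"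
  have y: "y < N" "b \<noteq> y" using b N by (auto simp: y_def mod_Suc One_nat_def)
  have bd: "bond N b = Transposition.transpose b y" by (simp add: bond_def y_def)
  have avg2: "prodE N \<sigma> f = prodE N \<sigma> (site_avg b (\<sigma> b) (site_avg y (\<sigma> y) f))" for \<sigma> f
    by (simp add: prodE_site_avg b y)
  have r': "?\<rho>' b = (1 - p) * \<rho> b + p * \<rho> y" "?\<rho>' y = (1 - p) * \<rho> y + p * \<rho> b"
    "\<And>x. x \<noteq> b \<Longrightarrow> x \<noteq> y \<Longrightarrow> ?\<rho>' x = \<rho> x"
    by (simp_all add: density_step_def bd) (simp add: algebra_simps)
  have "prodE N ?\<rho>' f = prodE N ?\<rho>' (site_avg b (?\<rho>' b) (site_avg y (?\<rho>' y) f))"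
    by (rule avg2)
  also have "\<dots> = prodE N \<rho> (site_avg b (?\<rho>' b) (site_avg y (?\<rho>' y) f))"
  proof (rule prodE_density_irrelevant)
    fix x \<eta> and i :: nat assume "x < N" "?\<rho>' x \<noteq> \<rho> x"
    then have "x = b \<or> x = y" using r' by blast
    then show "site_avg b (?\<rho>' b) (site_avg y (?\<rho>' y) f) (\<eta>(x := i)) = site_avg b (?\<rho>' b) (site_avg y (?\<rho>' y) f) \<eta>"
      by (elim disjE) (simp_all only: site_avg_def fun_upd_twist[OF y(2)] fun_upd_upd)
  qed
  also have "site_avg b (?\<rho>' b) (site_avg y (?\<rho>' y) f) =
     (\<lambda>\<eta>. (p * (1 - p) * (\<rho> b - \<rho> y)\<^sup>2) * mixed_diff b y f \<eta> + site_avg b (\<rho> b) (site_avg y (\<rho> y) (bond_step N p b f)) \<eta>)"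
  proof
    fix \<eta> :: config
    have sw: "\<eta>(b := i, y := j) \<circ> Transposition.transpose b y = \<eta>(b := j, y := i)" for i j
      using y by (auto simp: fun_eq_iff Transposition.transpose_def)
    show "site_avg b (?\<rho>' b) (site_avg y (?\<rho>' y) f) \<eta> =
     (p * (1 - p) * (\<rho> b - \<rho> y)\<^sup>2) * mixed_diff b y f \<eta> + site_avg b (\<rho> b) (site_avg y (\<rho> y) (bond_step N p b f)) \<eta>"
      unfolding site_avg_def bond_step_def mixed_diff_def bd sw r'
      by (simp add: algebra_simps power2_eq_square)
  qed
  also have "prodE N \<rho> \<dots> = (p * (1 - p) * (\<rho> b - \<rho> y)\<^sup>2) * prodE N \<rho> (mixed_diff b y f)
      + prodE N \<rho> (bond_step N p b f)"
    unfolding prodE_lin avg2[of _ "bond_step N p b f", symmetric] ..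
  finally show ?thesis by linarith
qed

section \<open>Bond updates of observables and densities\<close>

lemma exp_le_quadratic:
  fixes d :: real
  assumes "\<bar>d\<bar> \<le> 1"
  shows "exp d \<le> 1 + d + d\<^sup>2"
proof (cases "0 \<le> d")
  case True
  then show ?thesis using exp_bound[of d] assms by simp
next
  case False
  define x where "x = - d"
  have x: "0 \<le> x" "x \<le> 1" using False assms by (auto simp: x_def)
  have "exp d = 1 / exp x" by (simp add: x_def exp_minus inverse_eq_divide)
  also have "\<dots> \<le> 1 / (1 + x)" using x exp_ge_add_one_self[of x] by (intro divide_left_mono) auto
  also have "\<dots> \<le> 1 - x + x\<^sup>2"
  proof -
    have "(1 - x + x\<^sup>2) * (1 + x) = 1 + x ^ 3" by (simp add: algebra_simps power2_eq_square power3_eq_cube)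
    moreover have "0 \<le> x ^ 3" using x by simp
    ultimately show ?thesis using x by (simp add: pos_divide_le_eq)
  qed
  finally show ?thesis by (simp add: x_def)
qed

text \<open>Reverse Jensen inequality for a two-valued variable. The error must carry the factor
  \<open>p\<close>: it is added once per factor of the exchange product, and only the sum of all
  \<open>p\<close> stays bounded there.\<close>

lemma two_point_exp_le:
  fixes p a a' c :: real
  assumes p: "0 \<le> p" "p \<le> 1" and d: "\<bar>a' - a\<bar> \<le> c" and c: "c \<le> 1"
  shows "(1 - p) * exp a + p * exp a' \<le> exp ((1 - p) * a + p * a' + p * c\<^sup>2)"
proof -
  let ?d = "a' - a"
  have "(1 - p) * exp a + p * exp a' = exp a * (1 + p * (exp ?d - 1))"
    by (simp add: algebra_simps flip: exp_add)
  also have "\<dots> \<le> exp a * (1 + p * (?d + ?d\<^sup>2))"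
    using exp_le_quadratic[of ?d] p d c by (intro mult_left_mono add_left_mono) auto
  also have "\<dots> \<le> exp a * exp (p * (?d + ?d\<^sup>2))"
    by (intro mult_left_mono exp_ge_add_one_self) auto
  also have "\<dots> = exp ((1 - p) * a + p * a' + p * ?d\<^sup>2)"
    by (simp add: algebra_simps flip: exp_add)
  also have "\<dots> \<le> exp ((1 - p) * a + p * a' + p * c\<^sup>2)"
    using p d by (simp add: mult_left_mono abs_le_square_iff[symmetric])
  finally show ?thesis .
qed

definition mixed_diff_le :: "nat \<Rightarrow> real \<Rightarrow> (config \<Rightarrow> real) \<Rightarrow> bool" where
  "mixed_diff_le N \<kappa> f \<longleftrightarrow> (\<forall>\<eta>\<in>configs N. \<forall>u<N. \<forall>v<N. u \<noteq> v \<longrightarrow> \<bar>mixed_diff u v f \<eta>\<bar> \<le> \<kappa>)"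

text \<open>A bound relative to \<open>f\<close> itself, meant for exponential observables. Both
  sides are linear in \<open>f\<close> and are moved by the same exchange, so the constant survives
  any number of partial exchanges.\<close>

definition mixed_diff_dominated :: "nat \<Rightarrow> real \<Rightarrow> (config \<Rightarrow> real) \<Rightarrow> bool" where
  "mixed_diff_dominated N \<theta> f \<longleftrightarrow> (\<forall>\<eta>\<in>configs N. \<forall>u<N. \<forall>v<N. u \<noteq> v \<longrightarrow> \<bar>mixed_diff u v f \<eta>\<bar> \<le> \<theta> * f \<eta>)"

lemma mixed_diff_le_bond_step:
  assumes f: "mixed_diff_le N \<kappa> f" and p: "0 \<le> p" "p \<le> 1" and b: "b < N"
  shows "mixed_diff_le N \<kappa> (bond_step N p b f)"
  unfolding mixed_diff_le_def
proof (intro ballI allI impI)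
  fix \<eta> u v assume A: "\<eta> \<in> configs N" "u < N" "v < N" "u \<noteq> v"
  have "\<bar>mixed_diff u v f \<eta>\<bar> \<le> \<kappa>" "\<bar>mixed_diff (bond N b u) (bond N b v) f (\<eta> \<circ> bond N b)\<bar> \<le> \<kappa>"
    using f A configs_bond[OF A(1) b] b by (auto simp: mixed_diff_le_def bond_less_iff)
  from convex_abs_le[OF p this] show "\<bar>mixed_diff u v (bond_step N p b f) \<eta>\<bar> \<le> \<kappa>"
    unfolding mixed_diff_bond_step by (simp add: left_diff_distrib)
qed

lemma mixed_diff_dominated_bond_step:
  assumes f: "mixed_diff_dominated N \<theta> f" and p: "0 \<le> p" "p \<le> 1" and b: "b < N"
  shows "mixed_diff_dominated N \<theta> (bond_step N p b f)"
  unfolding mixed_diff_dominated_def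
proof (intro ballI allI impI)
  fix \<eta> u v assume A: "\<eta> \<in> configs N" "u < N" "v < N" "u \<noteq> v"
  have "\<bar>mixed_diff u v f \<eta>\<bar> \<le> \<theta> * f \<eta>"
    "\<bar>mixed_diff (bond N b u) (bond N b v) f (\<eta> \<circ> bond N b)\<bar> \<le> \<theta> * f (\<eta> \<circ> bond N b)"
    using f A configs_bond[OF A(1) b] b by (auto simp: mixed_diff_dominated_def bond_less_iff)
  from convex_abs_le[OF p this] show "\<bar>mixed_diff u v (bond_step N p b f) \<eta>\<bar> \<le> \<theta> * bond_step N p b f \<eta>"
    unfolding mixed_diff_bond_step by (simp add: bond_step_def algebra_simps)
qed

lemma bond_step_nonneg:
  "(\<And>\<eta>. \<eta> \<in> configs N \<Longrightarrow> 0 \<le> f \<eta>) \<Longrightarrow> 0 \<le> p \<Longrightarrow> p \<le> 1 \<Longrightarrow> b < N \<Longrightarrow> \<eta> \<in> configs N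
   \<Longrightarrow> 0 \<le> bond_step N p b f \<eta>"
  by (simp add: bond_step_def configs_bond)

lemma foldr_bond_step_Cons: "foldr (bond_step N p) (b # bs) f \<eta> =
    (1 - p) * foldr (bond_step N p) bs f \<eta> + p * foldr (bond_step N p) bs f (\<eta> \<circ> bond N b)"
  by (simp add: bond_step_def[of N p b "foldr (bond_step N p) bs f"])

context
  fixes N :: nat and p :: real
  assumes p: "0 \<le> p" "p \<le> 1"
begin

lemma foldr_bond_step_invariants:
  assumes "set bs \<subseteq> {..<N}"
  shows "site_lipschitz N c f \<Longrightarrow> site_lipschitz N c (foldr (bond_step N p) bs f)"
    "mixed_diff_le N \<kappa> f \<Longrightarrow> mixed_diff_le N \<kappa> (foldr (bond_step N p) bs f)"
    "mixed_diff_dominated N \<theta> f \<Longrightarrow> mixed_diff_dominated N \<theta> (foldr (bond_step N p) bs f)"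
    "(\<And>\<eta>. \<eta> \<in> configs N \<Longrightarrow> 0 \<le> f \<eta>) \<Longrightarrow> \<eta> \<in> configs N \<Longrightarrow> 0 \<le> foldr (bond_step N p) bs f \<eta>"
  using assms
  by (induction bs arbitrary: \<eta>) (auto intro!: site_lipschitz_bond_step mixed_diff_le_bond_step mixed_diff_dominated_bond_step bond_step_nonneg p)

text \<open>The two-point inequality is applied factor by factor. Partial exchanges preserve the
  site Lipschitz constant \<open>c\<close>, so an exchange never changes the current exponent by
  more than \<open>2 * c\<close>.\<close>

lemma foldr_bond_step_exp:
  assumes "set bs \<subseteq> {..<N}" and g: "site_lipschitz N c g" and c: "2 * c \<le> 1" and \<eta>: "\<eta> \<in> configs N"
  shows "foldr (bond_step N p) bs (\<lambda>\<eta>. exp (g \<eta>)) \<eta>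
    \<le> exp (foldr (bond_step N p) bs g \<eta> + p * real (length bs) * (2 * c)\<^sup>2)"
  using assms(1) \<eta>
proof (induction bs arbitrary: \<eta>)
  case (Cons b bs)
  let ?H = "foldr (bond_step N p) bs g" and ?C = "p * real (length bs) * (2 * c)\<^sup>2"
  have b: "b < N" and bs: "set bs \<subseteq> {..<N}" using Cons.prems by auto
  have \<eta>': "\<eta> \<circ> bond N b \<in> configs N" by (rule configs_bond[OF Cons.prems(2) b])
  have "foldr (bond_step N p) (b # bs) (\<lambda>\<eta>. exp (g \<eta>)) \<eta> \<le>
     (1 - p) * exp (?H \<eta> + ?C) + p * exp (?H (\<eta> \<circ> bond N b) + ?C)"
    unfolding foldr_bond_step_Cons
    by (rule add_mono[OF mult_left_mono[OF Cons.IH[OF bs Cons.prems(2)]] mult_left_mono[OF Cons.IH[OF bs \<eta>']]])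
      (use p in auto)
  also have "\<dots> \<le> exp ((1 - p) * (?H \<eta> + ?C) + p * (?H (\<eta> \<circ> bond N b) + ?C) + p * (2 * c)\<^sup>2)"
    using site_lipschitz_bond[OF foldr_bond_step_invariants(1)[OF bs g] b Cons.prems(2)] c
    by (intro two_point_exp_le p) auto
  also have "(1 - p) * (?H \<eta> + ?C) + p * (?H (\<eta> \<circ> bond N b) + ?C) + p * (2 * c)\<^sup>2 =
     foldr (bond_step N p) (b # bs) g \<eta> + p * real (length (b # bs)) * (2 * c)\<^sup>2"
    unfolding foldr_bond_step_Cons by (simp add: algebra_simps)
  finally show ?case .
qed simp

end

definition energy :: "nat \<Rightarrow> (nat \<Rightarrow> real) \<Rightarrow> real" where
  "energy N \<rho> = (\<Sum>x<N. (\<rho> x)\<^sup>2)"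

lemma energy_density_step:
  assumes b: "b < N" and N: "2 \<le> N"
  shows "energy N \<rho> - energy N (density_step N p b \<rho>) = 2 * p * (1 - p) * (\<rho> b - \<rho> ((b + 1) mod N))\<^sup>2"
proof -
  define y where "y = (b + 1) mod N"
  have y: "y < N" "b \<noteq> y" using b N by (auto simp: y_def mod_Suc One_nat_def)
  have bd: "bond N b = Transposition.transpose b y" by (simp add: bond_def y_def)
  have split: "energy N \<sigma> = (\<Sum>x\<in>{..<N} - {b, y}. (\<sigma> x)\<^sup>2) + (\<sigma> b)\<^sup>2 + (\<sigma> y)\<^sup>2" for \<sigma>
    using sum.subset_diff[of "{b, y}" "{..<N}" "\<lambda>x. (\<sigma> x)\<^sup>2"] b y by (simp add: energy_def)
  have "(\<Sum>x\<in>{..<N} - {b, y}. (density_step N p b \<rho> x)\<^sup>2) = (\<Sum>x\<in>{..<N} - {b, y}. (\<rho> x)\<^sup>2)"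
    by (rule sum.cong) (auto simp: density_step_def bd left_diff_distrib)
  then show ?thesis unfolding split y_def[symmetric]
    by (simp add: density_step_def bd power2_eq_square algebra_simps)
qed

definition unit_density :: "nat \<Rightarrow> (nat \<Rightarrow> real) \<Rightarrow> bool" where
  "unit_density N \<rho> \<longleftrightarrow> (\<forall>x<N. 0 \<le> \<rho> x \<and> \<rho> x \<le> 1)"

lemma unit_density_mean_densityity_step:
  assumes "unit_density N \<rho>" "0 \<le> p" "p \<le> 1" "b < N"
  shows "unit_density N (density_step N p b \<rho>)"
  unfolding unit_density_def
proof (intro allI impI)
  fix x assume x: "x < N"
  have r: "0 \<le> \<rho> x" "\<rho> x \<le> 1" "0 \<le> \<rho> (bond N b x)" "\<rho> (bond N b x) \<le> 1"
    using assms x by (auto simp: unit_density_def bond_less_iff)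
  have "(1 - p) * \<rho> x + p * \<rho> (bond N b x) \<le> (1 - p) * 1 + p * 1"
    using r assms by (intro add_mono mult_left_mono) auto
  then show "0 \<le> density_step N p b \<rho> x \<and> density_step N p b \<rho> x \<le> 1"
    using r assms by (auto simp: density_step_def)
qed

lemma unit_density_fold:
  "unit_density N \<rho> \<Longrightarrow> 0 \<le> p \<Longrightarrow> p \<le> 1 \<Longrightarrow> set bs \<subseteq> {..<N} \<Longrightarrow> unit_density N (fold (density_step N p) bs \<rho>)"
  by (induction bs arbitrary: \<rho>) (auto intro!: unit_density_mean_densityity_step)

text \<open>Each exchange costs a factor \<open>exp (\<theta> * e)\<close> where
  \<open>2 * e\<close> is the energy lost by the densities, so the exponents telescope. The head of
  the list acts last on observables (\<open>foldr\<close>) and first on densities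
  (\<open>fold\<close>).\<close>

lemma prodE_foldr_le:
  assumes N: "2 \<le> N" and p: "0 \<le> p" "p \<le> 1" and bs: "set bs \<subseteq> {..<N}" and \<rho>: "unit_density N \<rho>"
    and f: "mixed_diff_dominated N \<theta> f" "0 \<le> \<theta>" "\<And>\<eta>. \<eta> \<in> configs N \<Longrightarrow> 0 \<le> f \<eta>"
  shows "prodE N \<rho> (foldr (bond_step N p) bs f) \<le>
     exp (\<theta> / 2 * (energy N \<rho> - energy N (fold (density_step N p) bs \<rho>))) * prodE N (fold (density_step N p) bs \<rho>) f"
  using bs \<rho>
proof (induction bs arbitrary: \<rho>)
  case (Cons b bs)
  let ?F = "foldr (bond_step N p) bs f" and ?r = "density_step N p b \<rho>"
  let ?y = "(b + 1) mod N"
  have b: "b < N" and bs: "set bs \<subseteq> {..<N}" using Cons.prems by auto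
  have y: "?y < N" "b \<noteq> ?y" using b N by (auto simp: mod_Suc One_nat_def)
  have r: "unit_density N ?r" by (rule unit_density_mean_densityity_step[OF Cons.prems(2) p b])
  have F: "mixed_diff_dominated N \<theta> ?F" "\<And>\<eta>. \<eta> \<in> configs N \<Longrightarrow> 0 \<le> ?F \<eta>"
    using foldr_bond_step_invariants(3,4)[OF p bs] f by blast+
  define e where "e = p * (1 - p) * (\<rho> b - \<rho> ?y)\<^sup>2"
  have e: "0 \<le> e" using p by (simp add: e_def)
  have e': "energy N \<rho> - energy N ?r = 2 * e"
    unfolding energy_density_step[OF b N] e_def by simp
  \<comment> \<open>The mixed difference ignores its own two sites, the only ones where the
    densities change. Integrating it against the new densities makes domination produce a multiple
    of \<open>prodE N ?r ?F\<close>, the very quantity to which the error is added.\<close>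
  have "prodE N \<rho> (mixed_diff b ?y ?F) = prodE N ?r (mixed_diff b ?y ?F)"
  proof (rule prodE_density_irrelevant)
    fix x \<eta> and i :: nat assume "x < N" "\<rho> x \<noteq> ?r x"
    then have "x = b \<or> x = ?y"
      by (auto simp: density_step_def bond_def left_diff_distrib) (metis transpose_apply_other)
    then show "mixed_diff b ?y ?F (\<eta>(x := i)) = mixed_diff b ?y ?F \<eta>"
      using y by (elim disjE) (simp_all only: mixed_diff_def fun_upd_upd fun_upd_twist[OF y(2)])
  qed
  moreover have "\<bar>prodE N ?r (mixed_diff b ?y ?F)\<bar> \<le> \<theta> * prodE N ?r ?F"
  proof -
    have "\<And>\<eta>. \<eta> \<in> configs N \<Longrightarrow> \<bar>mixed_diff b ?y ?F \<eta>\<bar> \<le> \<theta> * ?F \<eta>"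
      using F(1) b y unfolding mixed_diff_dominated_def by blast
    then have "\<And>\<eta>. \<eta> \<in> configs N \<Longrightarrow> mixed_diff b ?y ?F \<eta> \<le> \<theta> * ?F \<eta>"
      "\<And>\<eta>. \<eta> \<in> configs N \<Longrightarrow> - mixed_diff b ?y ?F \<eta> \<le> \<theta> * ?F \<eta>"
      by (metis abs_le_D1, metis abs_le_D2)
    then have "prodE N ?r (mixed_diff b ?y ?F) \<le> prodE N ?r (\<lambda>\<eta>. \<theta> * ?F \<eta>)"
      "prodE N ?r (\<lambda>\<eta>. (-1) * mixed_diff b ?y ?F \<eta>) \<le> prodE N ?r (\<lambda>\<eta>. \<theta> * ?F \<eta>)"
      using r by (intro prodE_mono; simp add: unit_density_def)+
    then show ?thesis unfolding prodE_cmult by auto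
  qed
  ultimately have "- prodE N \<rho> (mixed_diff b ?y ?F) \<le> \<theta> * prodE N ?r ?F" by auto
  then have "e * - prodE N \<rho> (mixed_diff b ?y ?F) \<le> e * (\<theta> * prodE N ?r ?F)"
    by (rule mult_left_mono[OF _ e])
  then have "prodE N \<rho> (bond_step N p b ?F) \<le> (1 + \<theta> * e) * prodE N ?r ?F"
    unfolding prodE_bond_step[OF b N] e_def by (simp add: algebra_simps)
  also have "\<dots> \<le> exp (\<theta> * e) * prodE N ?r ?F"
    using r F(2) by (intro mult_right_mono exp_ge_add_one_self prodE_nonneg) (auto simp: unit_density_def)
  also have "\<dots> \<le> exp (\<theta> * e) * (exp (\<theta> / 2 * (energy N ?r - energy N (fold (density_step N p) bs ?r)))
      * prodE N (fold (density_step N p) bs ?r) f)"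
    using Cons.IH[OF bs r] by (intro mult_left_mono) auto
  also have "\<dots> = exp (\<theta> * e + \<theta> / 2 * (energy N ?r - energy N (fold (density_step N p) bs ?r)))
      * prodE N (fold (density_step N p) bs ?r) f" by (simp add: exp_add)
  also have "\<theta> * e + \<theta> / 2 * (energy N ?r - energy N (fold (density_step N p) bs ?r)) =
      \<theta> / 2 * (energy N \<rho> - energy N (fold (density_step N p) bs ?r))"
  proof -
    have "\<theta> / 2 * energy N \<rho> = \<theta> / 2 * energy N ?r + \<theta> * e"
      using e' by (simp add: algebra_simps flip: distrib_left)
    then show ?thesis by (simp add: right_diff_distrib)
  qed
  finally show ?case by simp
qed simp

text \<open>The same telescoping with an absolute bound on mixed differences, for observables of any
  sign. For \<open>\<kappa> = 0\<close> it becomes an identity; occupation variables are treated in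
  this way.\<close>

lemma prodE_foldr_additive:
  assumes N: "2 \<le> N" and p: "0 \<le> p" "p \<le> 1" and bs: "set bs \<subseteq> {..<N}" and \<rho>: "unit_density N \<rho>"
    and f: "mixed_diff_le N \<kappa> f"
  shows "\<bar>prodE N \<rho> (foldr (bond_step N p) bs f) - prodE N (fold (density_step N p) bs \<rho>) f\<bar> \<le>
     \<kappa> / 2 * (energy N \<rho> - energy N (fold (density_step N p) bs \<rho>))"
  using bs \<rho>
proof (induction bs arbitrary: \<rho>)
  case (Cons b bs)
  let ?F = "foldr (bond_step N p) bs f" and ?r = "density_step N p b \<rho>"
  let ?y = "(b + 1) mod N"
  have b: "b < N" and bs: "set bs \<subseteq> {..<N}" using Cons.prems by auto
  have y: "?y < N" "b \<noteq> ?y" using b N by (auto simp: mod_Suc One_nat_def)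
  have r: "unit_density N ?r" by (rule unit_density_mean_densityity_step[OF Cons.prems(2) p b])
  define e where "e = p * (1 - p) * (\<rho> b - \<rho> ?y)\<^sup>2"
  have e: "0 \<le> e" using p by (simp add: e_def)
  have e': "energy N \<rho> - energy N ?r = 2 * e"
    unfolding energy_density_step[OF b N] e_def by simp
  have "mixed_diff_le N \<kappa> ?F" by (rule foldr_bond_step_invariants(2)[OF p bs f])
  then have "\<bar>prodE N \<rho> (mixed_diff b ?y ?F)\<bar> \<le> \<kappa>"
    using Cons.prems(2) b y by (intro prodE_abs_le) (auto simp: unit_density_def mixed_diff_le_def)
  then have "e * \<bar>prodE N \<rho> (mixed_diff b ?y ?F)\<bar> \<le> e * \<kappa>" by (rule mult_left_mono[OF _ e])
  then have "\<bar>prodE N \<rho> (bond_step N p b ?F) - prodE N ?r ?F\<bar> \<le> \<kappa> * e"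
    unfolding prodE_bond_step[OF b N] e_def[symmetric] using e by (simp add: abs_mult mult.commute)
  moreover have "\<bar>prodE N ?r ?F - prodE N (fold (density_step N p) bs ?r) f\<bar> \<le>
      \<kappa> / 2 * (energy N ?r - energy N (fold (density_step N p) bs ?r))"
    by (rule Cons.IH[OF bs r])
  moreover have "\<kappa> / 2 * energy N \<rho> = \<kappa> / 2 * energy N ?r + \<kappa> * e"
    using e' by (simp add: algebra_simps flip: distrib_left)
  ultimately show ?case unfolding foldr.simps fold.simps o_apply right_diff_distrib by linarith
qed simp

text \<open>Concentration under a product law: integrating out one site costs at most
  \<open>c^2\<close> in the exponent by \<open>two_point_exp_le\<close>, and the averaged function
  keeps the Lipschitz constant at the remaining sites.\<close>

lemma prodE_exp_le:
  assumes "unit_density N \<rho>" "site_lipschitz N c f" "c \<le> 1"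
  shows "prodE N \<rho> (\<lambda>\<eta>. exp (f \<eta>)) \<le> exp (prodE N \<rho> f + real N * c\<^sup>2)"
proof -
  have "prodE k \<rho> (\<lambda>\<eta>. exp (f \<eta>)) \<le> exp (prodE k \<rho> f + real k * c\<^sup>2)"
    if "unit_density k \<rho>" "site_lipschitz k c f" for k
    using that
  proof (induction k arbitrary: f)
    case (Suc k)
    have r: "0 \<le> \<rho> k" "\<rho> k \<le> 1" "unit_density k \<rho>" using Suc.prems(1) by (auto simp: unit_density_def)
    have one: "site_avg k (\<rho> k) (\<lambda>\<eta>. exp (f \<eta>)) \<eta> \<le> exp (site_avg k (\<rho> k) f \<eta> + c\<^sup>2)"
      if \<eta>: "\<eta> \<in> configs k" for \<eta>
    proof -
      have "\<bar>f ((\<eta>(k := 0))(k := 1)) - f (\<eta>(k := 0))\<bar> \<le> c"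
        using configs_Suc_upd(1)[OF \<eta>] by (intro site_lipschitzD[OF Suc.prems(2)]) auto
      then have "\<bar>f (\<eta>(k := 1)) - f (\<eta>(k := 0))\<bar> \<le> c" by simp
      from two_point_exp_le[OF r(1,2) this \<open>c \<le> 1\<close>]
      have "site_avg k (\<rho> k) (\<lambda>\<eta>. exp (f \<eta>)) \<eta> \<le> exp (site_avg k (\<rho> k) f \<eta> + \<rho> k * c\<^sup>2)"
        by (simp add: site_avg_def add.commute)
      also have "\<dots> \<le> exp (site_avg k (\<rho> k) f \<eta> + c\<^sup>2)"
        using r mult_right_mono[of "\<rho> k" 1 "c\<^sup>2"] by simp
      finally show ?thesis .
    qed
    have l: "site_lipschitz k c (site_avg k (\<rho> k) f)"
      unfolding site_lipschitz_def
    proof (intro ballI allI impI)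
      fix \<eta> u and i :: nat assume A: "\<eta> \<in> configs k" "u < k" "i \<in> {0, 1}"
      have "k \<noteq> u" using A by simp
      note tw = fun_upd_twist[OF this]
      have "\<bar>f ((\<eta>(k := 1))(u := i)) - f (\<eta>(k := 1))\<bar> \<le> c" "\<bar>f ((\<eta>(k := 0))(u := i)) - f (\<eta>(k := 0))\<bar> \<le> c"
        using A configs_Suc_upd[OF A(1)] by (auto intro!: site_lipschitzD[OF Suc.prems(2)] simp del: fun_upd_apply)
      from convex_abs_le[OF r(1,2) this(2,1)]
      show "\<bar>site_avg k (\<rho> k) f (\<eta>(u := i)) - site_avg k (\<rho> k) f \<eta>\<bar> \<le> c"
        unfolding tw site_avg_def by (simp add: algebra_simps)
    qed
    have "prodE (Suc k) \<rho> (\<lambda>\<eta>. exp (f \<eta>)) \<le> prodE k \<rho> (\<lambda>\<eta>. exp (c\<^sup>2) * exp (site_avg k (\<rho> k) f \<eta>))"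
      unfolding prodE_Suc using r(3) one
      by (intro prodE_mono) (auto simp: unit_density_def exp_add mult.commute)
    also have "\<dots> \<le> exp (c\<^sup>2) * exp (prodE k \<rho> (site_avg k (\<rho> k) f) + real k * c\<^sup>2)"
      unfolding prodE_cmult using Suc.IH[OF r(3) l] by (intro mult_left_mono) auto
    also have "\<dots> = exp (prodE (Suc k) \<rho> f + real (Suc k) * c\<^sup>2)"
      unfolding prodE_Suc by (simp add: algebra_simps flip: exp_add)
    finally show ?case .
  qed simp
  then show ?thesis using assms by blast
qed

text \<open>With \<open>\<alpha>\<close>, \<open>\<beta>\<close> the single increments over the
  corner value \<open>q\<close> and \<open>\<delta>\<close> the mixed difference of
  \<open>f\<close>, the mixed difference of the exponential is \<open>exp q\<close> times
  \<open>(exp \<alpha> - 1) * (exp \<beta> - 1) + exp (\<alpha> + \<beta>) * (exp \<delta> -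
  1)\<close>. From \<open>\<bar>exp x - 1\<bar> \<le> 2 * b\<close> for
  \<open>\<bar>x\<bar> \<le> b \<le> 1\<close> and \<open>exp 1 \<le> 3\<close> the bracket is at
  most \<open>4 * c^2 + 6 * \<kappa>\<close>. Replacing \<open>exp q\<close> by
  \<open>exp (f \<eta>)\<close> costs another factor 3, since the two exponents differ by at most
  \<open>2 * c \<le> 1\<close>.\<close>

lemma mixed_diff_dominated_exp:
  assumes l: "site_lipschitz N c f" and d: "mixed_diff_le N \<kappa> f" and c: "0 \<le> c" "c \<le> 1 / 2" and \<kappa>: "0 \<le> \<kappa>" "\<kappa> \<le> 1"
  shows "mixed_diff_dominated N (12 * c\<^sup>2 + 18 * \<kappa>) (\<lambda>\<eta>. exp (f \<eta>))"
  unfolding mixed_diff_dominated_def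
proof (intro ballI allI impI)
  fix \<eta> u v assume A: "\<eta> \<in> configs N" "u < N" "v < N" "u \<noteq> v"
  define q where "q = f (\<eta>(u := 0, v := 0))"
  define \<alpha> where "\<alpha> = f (\<eta>(u := 1, v := 0)) - q"
  define \<beta> where "\<beta> = f (\<eta>(u := 0, v := 1)) - q"
  define \<delta> where "\<delta> = mixed_diff u v f \<eta>"
  have conf: "\<eta>(u := 0) \<in> configs N" "\<eta>(u := 0, v := 0) \<in> configs N" using A by auto
  have \<alpha>: "\<bar>\<alpha>\<bar> \<le> c"
    using site_lipschitzD[OF l conf(2) A(2), of 1] A(4) by (simp add: \<alpha>_def q_def fun_upd_twist[of u v])
  have \<beta>: "\<bar>\<beta>\<bar> \<le> c"
    using site_lipschitzD[OF l conf(2) A(3), of 1] by (simp add: \<beta>_def q_def)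
  have \<delta>: "\<bar>\<delta>\<bar> \<le> \<kappa>" using d A by (auto simp: mixed_diff_le_def \<delta>_def)
  have q: "\<bar>q - f \<eta>\<bar> \<le> 2 * c"
    using site_lipschitzD[OF l conf(1) A(3), of 0] site_lipschitzD[OF l A(1,2), of 0] by (simp add: q_def)
  have "f (\<eta>(u := 1, v := 1)) = q + \<alpha> + \<beta> + \<delta>"
    "f (\<eta>(u := 1, v := 0)) = q + \<alpha>" "f (\<eta>(u := 0, v := 1)) = q + \<beta>"
    by (simp_all add: \<alpha>_def \<beta>_def \<delta>_def mixed_diff_def q_def)
  then have eq: "mixed_diff u v (\<lambda>\<eta>. exp (f \<eta>)) \<eta> =
      exp q * ((exp \<alpha> - 1) * (exp \<beta> - 1) + exp (\<alpha> + \<beta>) * (exp \<delta> - 1))"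
    by (simp add: mixed_diff_def q_def[symmetric] exp_add algebra_simps)
  have small: "\<bar>exp x - 1\<bar> \<le> 2 * b" if "\<bar>x\<bar> \<le> b" "b \<le> 1" for x b :: real
  proof -
    have "x\<^sup>2 \<le> \<bar>x\<bar>" using that mult_left_mono[of "\<bar>x\<bar>" 1 "\<bar>x\<bar>"] by (simp add: power2_eq_square flip: abs_mult)
    then show ?thesis using exp_le_quadratic[of x] exp_ge_add_one_self[of x] that by linarith
  qed
  have e3: "exp x \<le> 3" if "x \<le> 1" for x :: real
    using that exp_le order_trans[of "exp x" "exp 1" 3] by simp
  have "\<bar>(exp \<alpha> - 1) * (exp \<beta> - 1) + exp (\<alpha> + \<beta>) * (exp \<delta> - 1)\<bar>
      \<le> \<bar>exp \<alpha> - 1\<bar> * \<bar>exp \<beta> - 1\<bar> + exp (\<alpha> + \<beta>) * \<bar>exp \<delta> - 1\<bar>"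
    using abs_triangle_ineq[of "(exp \<alpha> - 1) * (exp \<beta> - 1)" "exp (\<alpha> + \<beta>) * (exp \<delta> - 1)"]
    by (simp add: abs_mult)
  also have "\<dots> \<le> (2 * c) * (2 * c) + 3 * (2 * \<kappa>)"
    using small[OF \<alpha>] small[OF \<beta>] small[OF \<delta>] c \<kappa> \<alpha> \<beta>
    by (intro add_mono mult_mono e3) auto
  finally have "\<bar>mixed_diff u v (\<lambda>\<eta>. exp (f \<eta>)) \<eta>\<bar> \<le> exp q * (4 * c\<^sup>2 + 6 * \<kappa>)"
    unfolding eq abs_mult by (auto simp: power2_eq_square)
  also have "\<dots> \<le> (exp (f \<eta>) * 3) * (4 * c\<^sup>2 + 6 * \<kappa>)"
  proof (rule mult_right_mono)
    have "exp q = exp (f \<eta>) * exp (q - f \<eta>)" by (simp flip: exp_add)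
    also have "\<dots> \<le> exp (f \<eta>) * 3" using q c by (intro mult_left_mono e3) auto
    finally show "exp q \<le> exp (f \<eta>) * 3" .
  qed (use \<kappa> in auto)
  finally show "\<bar>mixed_diff u v (\<lambda>\<eta>. exp (f \<eta>)) \<eta>\<bar> \<le> (12 * c\<^sup>2 + 18 * \<kappa>) * exp (f \<eta>)"
    by (simp add: algebra_simps)
qed

section \<open>Approximation of Markov semigroups\<close>

text \<open>Only values at points of \<open>S\<close> are constrained, because a semigroup
  \<open>K\<close> is unspecified outside \<open>S\<close>.\<close>

definition markov_op :: "'s set \<Rightarrow> (('s \<Rightarrow> real) \<Rightarrow> 's \<Rightarrow> real) \<Rightarrow> bool" where
  "markov_op S A \<longleftrightarrow>
     (\<forall>f g a. \<forall>x\<in>S. A (\<lambda>x. a * f x + g x) x = a * A f x + A g x) \<and>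
     (\<forall>f. (\<forall>x\<in>S. 0 \<le> f x) \<longrightarrow> (\<forall>x\<in>S. 0 \<le> A f x)) \<and>
     (\<forall>x\<in>S. A (\<lambda>_. 1) x = 1)"

context
  fixes S :: "'s set" and A :: "('s \<Rightarrow> real) \<Rightarrow> 's \<Rightarrow> real"
  assumes A: "markov_op S A"
begin

lemma markov_op_lin: "x \<in> S \<Longrightarrow> A (\<lambda>x. a * f x + g x) x = a * A f x + A g x"
  and markov_op_nonneg: "(\<And>x. x \<in> S \<Longrightarrow> 0 \<le> f x) \<Longrightarrow> x \<in> S \<Longrightarrow> 0 \<le> A f x"
  and markov_op_one: "x \<in> S \<Longrightarrow> A (\<lambda>_. 1) x = 1"
  using A unfolding markov_op_def by blast+

lemma markov_op_zero: "x \<in> S \<Longrightarrow> A (\<lambda>_. 0) x = 0"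
  using markov_op_lin[of x "-1" "\<lambda>_. 1" "\<lambda>_. 1"] by simp

lemma markov_op_cmult: "x \<in> S \<Longrightarrow> A (\<lambda>x. a * f x) x = a * A f x"
  using markov_op_lin[of x a f "\<lambda>_. 0"] markov_op_zero by simp

lemma markov_op_diff: "x \<in> S \<Longrightarrow> A (\<lambda>x. f x - g x) x = A f x - A g x"
  using markov_op_lin[of x "-1" g f] by simp

lemma markov_op_sum: "x \<in> S \<Longrightarrow> A (\<lambda>x. \<Sum>i\<in>I. f i x) x = (\<Sum>i\<in>I. A (f i) x)"
proof (induction I rule: infinite_finite_induct)
  case (insert i I)
  then show ?case using markov_op_lin[of x 1 "f i" "\<lambda>x. \<Sum>i\<in>I. f i x"] by simp
qed (simp_all add: markov_op_zero)

lemma markov_op_mono: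
  assumes "\<And>x. x \<in> S \<Longrightarrow> f x \<le> g x" "x \<in> S"
  shows "A f x \<le> A g x"
  using markov_op_nonneg[of "\<lambda>x. g x - f x" x] assms by (simp add: markov_op_diff)

lemma markov_op_cong:
  assumes "\<And>x. x \<in> S \<Longrightarrow> f x = g x" "x \<in> S"
  shows "A f x = A g x"
  using markov_op_mono[of f g x] markov_op_mono[of g f x] assms by force

lemma markov_op_abs_le:
  assumes "\<And>x. x \<in> S \<Longrightarrow> \<bar>f x\<bar> \<le> c" "x \<in> S"
  shows "\<bar>A f x\<bar> \<le> c"
proof -
  have "A f x \<le> A (\<lambda>x. c * 1) x" "A (\<lambda>x. (- c) * 1) x \<le> A f x"
    using assms abs_le_D1 abs_le_D2 by (intro markov_op_mono; fastforce)+
  then show ?thesis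
    unfolding markov_op_cmult[OF assms(2)] markov_op_one[OF assms(2)] by auto
qed

lemma markov_op_expand:
  assumes "finite S" "x \<in> S"
  shows "A f x = (\<Sum>\<xi>\<in>S. f \<xi> * A (\<lambda>y. of_bool (y = \<xi>)) x)"
proof -
  have "A f x = A (\<lambda>y. \<Sum>\<xi>\<in>S. f \<xi> * of_bool (y = \<xi>)) x"
    by (rule markov_op_cong) (use assms in \<open>auto simp: of_bool_def if_distrib sum.delta' cong: if_cong\<close>)
  then show ?thesis unfolding markov_op_sum[OF assms(2)] markov_op_cmult[OF assms(2)] .
qed

end

lemma markov_op_id: "markov_op S (\<lambda>f. f)"
  by (simp add: markov_op_def)

lemma markov_op_compose:
  assumes A: "markov_op S A" and B: "markov_op S B"
  shows "markov_op S (\<lambda>f. A (B f))"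
  unfolding markov_op_def
proof (intro conjI allI ballI impI)
  fix f g :: "'a \<Rightarrow> real" and a x assume x: "x \<in> S"
  have "A (B (\<lambda>x. a * f x + g x)) x = A (\<lambda>x. a * B f x + B g x) x"
    by (rule markov_op_cong[OF A _ x]) (rule markov_op_lin[OF B])
  then show "A (B (\<lambda>x. a * f x + g x)) x = a * A (B f) x + A (B g) x"
    by (simp add: markov_op_lin[OF A x])
next
  fix f :: "'a \<Rightarrow> real" and x assume x: "x \<in> S" and "\<forall>x\<in>S. 0 \<le> f x"
  then show "0 \<le> A (B f) x"
    by (intro markov_op_nonneg[OF A _ x] markov_op_nonneg[OF B]) auto
next
  fix x assume x: "x \<in> S"
  have "A (B (\<lambda>_. 1)) x = A (\<lambda>_. 1) x"
    by (rule markov_op_cong[OF A _ x]) (rule markov_op_one[OF B])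
  then show "A (B (\<lambda>_. 1)) x = 1" by (simp add: markov_op_one[OF A x])
qed

lemma markov_op_funpow: "markov_op S A \<Longrightarrow> markov_op S (A ^^ n)"
proof (induction n)
  case 0 then show ?case using markov_op_id[of S] by (simp add: id_def)
next
  case (Suc n) then show ?case using markov_op_compose[of S A "A ^^ n"] by (simp add: comp_def)
qed

text \<open>Telescoping: the difference of the powers \<open>n + 1\<close> is \<open>A\<close>
  applied to the difference of the powers \<open>n\<close>, which does not grow because
  \<open>A\<close> is a contraction, plus \<open>A - B\<close> applied to \<open>(B ^^ n) f\<close>.
  The latter is expanded over the point indicators of the finite set \<open>S\<close>, where the
  one-step discrepancy is assumed to be at most \<open>e\<close>.\<close>

lemma markov_op_power_diff:
  assumes A: "markov_op S A" and B: "markov_op S B" and fin: "finite S"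
    and e: "\<And>\<xi> x. \<xi> \<in> S \<Longrightarrow> x \<in> S \<Longrightarrow> \<bar>A (\<lambda>y. of_bool (y = \<xi>)) x - B (\<lambda>y. of_bool (y = \<xi>)) x\<bar> \<le> e"
    and f: "\<And>x. x \<in> S \<Longrightarrow> \<bar>f x\<bar> \<le> c" and x: "x \<in> S"
  shows "\<bar>(A ^^ n) f x - (B ^^ n) f x\<bar> \<le> real n * (real (card S) * (c * e))"
  using x
proof (induction n arbitrary: x)
  case (Suc n)
  let ?h = "(B ^^ n) f"
  have h: "\<bar>?h x\<bar> \<le> c" if "x \<in> S" for x
    by (rule markov_op_abs_le[OF markov_op_funpow[OF B] f that])
  have "\<bar>A (\<lambda>x. (A ^^ n) f x - ?h x) x\<bar> \<le> real n * (real (card S) * (c * e))"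
    by (rule markov_op_abs_le[OF A Suc.IH Suc.prems])
  then have 1: "\<bar>A ((A ^^ n) f) x - A ?h x\<bar> \<le> real n * (real (card S) * (c * e))"
    by (simp add: markov_op_diff[OF A Suc.prems])
  have "\<bar>A ?h x - B ?h x\<bar> = \<bar>\<Sum>\<xi>\<in>S. ?h \<xi> * (A (\<lambda>y. of_bool (y = \<xi>)) x - B (\<lambda>y. of_bool (y = \<xi>)) x)\<bar>"
    unfolding markov_op_expand[OF A fin Suc.prems, of ?h] markov_op_expand[OF B fin Suc.prems, of ?h]
    by (simp add: sum_subtractf algebra_simps)
  also have "\<dots> \<le> (\<Sum>\<xi>\<in>S. \<bar>?h \<xi>\<bar> * \<bar>A (\<lambda>y. of_bool (y = \<xi>)) x - B (\<lambda>y. of_bool (y = \<xi>)) x\<bar>)"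
    unfolding abs_mult[symmetric] by (rule sum_abs)
  also have "\<dots> \<le> (\<Sum>\<xi>\<in>S. c * e)"
    using Suc.prems abs_ge_zero order_trans[OF abs_ge_zero h] by (intro sum_mono mult_mono h e) auto
  finally show ?case using 1 by (simp add: algebra_simps)
qed simp

section \<open>Transition kernels as Markov operators and the product formula on a finite state
  space\<close>

definition kernel_op :: "(real \<Rightarrow> 's \<Rightarrow> 's pmf) \<Rightarrow> real \<Rightarrow> ('s \<Rightarrow> real) \<Rightarrow> 's \<Rightarrow> real" where
  "kernel_op K t f x = measure_pmf.expectation (K t x) f"

context
  fixes S :: "'s set" and K :: "real \<Rightarrow> 's \<Rightarrow> 's pmf"
  assumes fin: "finite S" and K: "markov_semigroup S K"
begin

lemma kernel_op_sum:
  assumes "0 \<le> t" "x \<in> S"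
  shows "kernel_op K t f x = (\<Sum>y\<in>S. f y * pmf (K t x) y)"
  unfolding kernel_op_def
  by (rule integral_measure_pmf_real[OF fin]) (use K assms in \<open>auto simp: markov_semigroup_def\<close>)

lemma markov_op_kernel: "0 \<le> t \<Longrightarrow> markov_op S (kernel_op K t)"
  unfolding markov_op_def
proof (intro conjI allI ballI impI)
  fix f g :: "'s \<Rightarrow> real" and a x assume t: "0 \<le> t" and x: "x \<in> S"
  show "kernel_op K t (\<lambda>x. a * f x + g x) x = a * kernel_op K t f x + kernel_op K t g x"
    by (simp add: kernel_op_sum t x sum.distrib sum_distrib_left algebra_simps)
next
  fix f :: "'s \<Rightarrow> real" and x assume t: "0 \<le> t" and x: "x \<in> S" and f: "\<forall>x\<in>S. 0 \<le> f x"
  then show "0 \<le> kernel_op K t f x"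
    by (auto simp: kernel_op_sum intro!: sum_nonneg mult_nonneg_nonneg)
next
  fix x
  show "kernel_op K t (\<lambda>_. 1) x = 1" by (simp add: kernel_op_def)
qed

lemma kernel_op_add:
  assumes "0 \<le> s" "0 \<le> t" "x \<in> S"
  shows "kernel_op K (s + t) f x = kernel_op K s (kernel_op K t f) x"
proof -
  have sub: "set_pmf (K s x) \<subseteq> S" "\<And>y. y \<in> S \<Longrightarrow> set_pmf (K t y) \<subseteq> S"
    and b: "K (s + t) x = bind_pmf (K s x) (K t)"
    using K assms unfolding markov_semigroup_def by blast+
  have "kernel_op K (s + t) f x = (\<Sum>y\<in>S. pmf (K s x) y *\<^sub>R measure_pmf.expectation (K t y) f)"
    unfolding kernel_op_def b
    by (rule pmf_expectation_bind[OF fin _ sub(1)]) (use sub(2) fin in \<open>auto intro: finite_subset\<close>)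
  then show ?thesis
    unfolding kernel_op_sum[OF assms(1,3), of "kernel_op K t f"] kernel_op_def[of K t]
    by (simp add: mult.commute)
qed

lemma kernel_op_0: "x \<in> S \<Longrightarrow> kernel_op K 0 f x = f x"
  using K by (simp add: kernel_op_def markov_semigroup_def)

lemma kernel_op_funpow:
  assumes "0 \<le> h" "x \<in> S"
  shows "(kernel_op K h ^^ n) f x = kernel_op K (real n * h) f x"
  using assms(2)
proof (induction n arbitrary: x)
  case 0 then show ?case by (simp add: kernel_op_0)
next
  case (Suc n)
  have "(kernel_op K h ^^ Suc n) f x = kernel_op K h (kernel_op K (real n * h) f) x"
    using markov_op_cong[OF markov_op_kernel[OF assms(1)] Suc.IH Suc.prems] by simp
  also have "\<dots> = kernel_op K (h + real n * h) f x"
    using kernel_op_add[of h "real n * h" x] assms Suc.prems by simp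
  finally show ?case by (simp add: algebra_simps)
qed

text \<open>Chernoff's product formula. Two families with the same derivative at 0 differ by
  \<open>o(h)\<close> in one step; \<open>e\<close> sums this discrepancy over all starting and
  target states, so one scalar function controls every observable. Over \<open>n\<close> steps of
  length \<open>t / n\<close> the accumulated error is a constant times
  \<open>e (t / n) / (t / n)\<close>, which tends to 0.\<close>

lemma semigroup_approx:
  assumes gen: "has_generator S K L"
    and A: "\<forall>\<^sub>F h in at_right 0. markov_op S (A h)"
    and lim: "\<And>f x. x \<in> S \<Longrightarrow> ((\<lambda>h. (A h f x - f x) / h) \<longlongrightarrow> L f x) (at_right 0)"
    and t: "0 < t" and x: "x \<in> S"
  shows "(\<lambda>n. (A (t / real n) ^^ n) f x) \<longlonglongrightarrow> kernel_op K t f x"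
proof -
  let ?i = "\<lambda>\<xi> y. of_bool (y = \<xi>) :: real"
  define e where "e h = (\<Sum>\<xi>\<in>S. \<Sum>y\<in>S. \<bar>A h (?i \<xi>) y - kernel_op K h (?i \<xi>) y\<bar>)" for h
  have h0: "filterlim (\<lambda>n. t / real n) (at_right 0) sequentially"
    unfolding filterlim_at
  proof
    show "\<forall>\<^sub>F n in sequentially. t / real n \<in> {0<..} \<and> t / real n \<noteq> 0"
      using eventually_gt_at_top[of 0] by eventually_elim (use t in auto)
    show "(\<lambda>n. t / real n) \<longlonglongrightarrow> 0" by (rule lim_const_over_n)
  qed
  have gen': "((\<lambda>h. (kernel_op K h f y - f y) / h) \<longlongrightarrow> L f y) (at_right 0)" if "y \<in> S" for f y
    using gen that unfolding has_generator_def kernel_op_def by blast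
  have summand: "((\<lambda>h. \<bar>A h (?i \<xi>) y - kernel_op K h (?i \<xi>) y\<bar> / h) \<longlongrightarrow> 0) (at_right 0)" if "y \<in> S" for \<xi> y
  proof -
    have "((\<lambda>h. (A h (?i \<xi>) y - ?i \<xi> y) / h - (kernel_op K h (?i \<xi>) y - ?i \<xi> y) / h) \<longlongrightarrow> L (?i \<xi>) y - L (?i \<xi>) y) (at_right 0)"
      by (intro tendsto_diff lim gen' that)
    then have "((\<lambda>h. \<bar>(A h (?i \<xi>) y - kernel_op K h (?i \<xi>) y) / h\<bar>) \<longlongrightarrow> 0) (at_right 0)"
      by (intro tendsto_rabs_zero) (simp add: diff_divide_distrib)
    then show ?thesis
      by (rule Lim_transform_eventually) (auto simp: eventually_at_filter)
  qed
  have "((\<lambda>h. e h / h) \<longlongrightarrow> (\<Sum>\<xi>\<in>S. \<Sum>y\<in>S. 0)) (at_right 0)"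
    unfolding e_def sum_divide_distrib by (intro tendsto_sum summand)
  then have "(\<lambda>n. e (t / real n) / (t / real n)) \<longlonglongrightarrow> 0"
    using filterlim_compose[OF _ h0] by fastforce
  then have lim0: "(\<lambda>n. real (card S) * ((\<Sum>y\<in>S. \<bar>f y\<bar>) * t) * (e (t / real n) / (t / real n))) \<longlonglongrightarrow> 0"
    by (rule tendsto_mult_right_zero)
  have ev: "\<forall>\<^sub>F n in sequentially. markov_op S (A (t / real n))"
    using filterlim_iff[THEN iffD1, OF h0] A by blast
  have "\<forall>\<^sub>F n in sequentially. norm ((A (t / real n) ^^ n) f x - kernel_op K t f x)
      \<le> real (card S) * ((\<Sum>y\<in>S. \<bar>f y\<bar>) * t) * (e (t / real n) / (t / real n))"
    using ev eventually_gt_at_top[of 0]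
  proof eventually_elim
    case (elim n)
    have "\<bar>(A (t / real n) ^^ n) f x - (kernel_op K (t / real n) ^^ n) f x\<bar> \<le>
        real n * (real (card S) * ((\<Sum>y\<in>S. \<bar>f y\<bar>) * e (t / real n)))"
    proof (rule markov_op_power_diff[OF elim(1) markov_op_kernel fin])
      fix \<xi> y assume "\<xi> \<in> S" "y \<in> S"
      then have "\<bar>A (t / real n) (?i \<xi>) y - kernel_op K (t / real n) (?i \<xi>) y\<bar>
          \<le> (\<Sum>y\<in>S. \<bar>A (t / real n) (?i \<xi>) y - kernel_op K (t / real n) (?i \<xi>) y\<bar>)"
        using fin by (intro member_le_sum) auto
      also have "\<dots> \<le> e (t / real n)"
        unfolding e_def using fin \<open>\<xi> \<in> S\<close>
        by (intro member_le_sum[where f = "\<lambda>\<xi>. \<Sum>y\<in>S. \<bar>A (t / real n) (?i \<xi>) y - kernel_op K (t / real n) (?i \<xi>) y\<bar>"])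
          (auto intro: sum_nonneg)
      finally show "\<bar>A (t / real n) (?i \<xi>) y - kernel_op K (t / real n) (?i \<xi>) y\<bar> \<le> e (t / real n)" .
    next
      fix y assume "y \<in> S"
      then show "\<bar>f y\<bar> \<le> (\<Sum>y\<in>S. \<bar>f y\<bar>)" using fin by (intro member_le_sum) auto
    qed (use t x in auto)
    moreover have "(kernel_op K (t / real n) ^^ n) f x = kernel_op K t f x"
      using kernel_op_funpow[of "t / real n" x n f] t x elim by simp
    ultimately show ?case using t elim by (simp add: field_simps)
  qed
  then have "(\<lambda>n. (A (t / real n) ^^ n) f x - kernel_op K t f x) \<longlonglongrightarrow> 0"
    by (rule Lim_null_comparison[OF _ lim0])
  then show ?thesis by (simp add: LIM_zero_iff)
qed

end

section \<open>Exchange products and Euler steps as Markov operators\<close>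

lemma markov_op_bond_step:
  assumes "b < N" "0 \<le> p" "p \<le> 1"
  shows "markov_op (configs N) (bond_step N p b)"
  unfolding markov_op_def
proof (intro conjI allI ballI impI)
  fix f :: "config \<Rightarrow> real" and \<eta> assume "\<forall>x\<in>configs N. 0 \<le> f x" "\<eta> \<in> configs N"
  then show "0 \<le> bond_step N p b f \<eta>" using bond_step_nonneg[of N f p b \<eta>] assms by blast
qed (auto simp: bond_step_def algebra_simps)

lemma markov_op_foldr_bond_step:
  assumes "set bs \<subseteq> {..<N}" "0 \<le> p" "p \<le> 1"
  shows "markov_op (configs N) (foldr (bond_step N p) bs)"
  using assms(1)
proof (induction bs)
  case Nil then show ?case using markov_op_id by (simp add: id_def)
next
  case (Cons b bs)
  then show ?case using markov_op_compose[OF markov_op_bond_step[of b N p] Cons.IH] assms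
    by (simp add: comp_def)
qed

definition euler :: "nat \<Rightarrow> real \<Rightarrow> (config \<Rightarrow> real) \<Rightarrow> config \<Rightarrow> real" where
  "euler N h f \<eta> = f \<eta> + h * (real N)\<^sup>2 * (\<Sum>b<N. f (\<eta> \<circ> bond N b) - f \<eta>)"

lemma ssep_generator_bond: "ssep_generator N f \<eta> = (real N)\<^sup>2 * (\<Sum>b<N. f (\<eta> \<circ> bond N b) - f \<eta>)"
  by (simp only: ssep_generator_def exchange_eq_bond)

lemma euler_convex:
  "euler N h f \<eta> = (1 - h * real N ^ 3) * f \<eta> + h * (real N)\<^sup>2 * (\<Sum>b<N. f (\<eta> \<circ> bond N b))"
  by (simp add: euler_def sum_subtractf algebra_simps power2_eq_square power3_eq_cube)

lemma markov_op_euler: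
  assumes "0 \<le> h" "h * real N ^ 3 \<le> 1"
  shows "markov_op (configs N) (euler N h)"
  unfolding markov_op_def
proof (intro conjI allI ballI impI)
  fix f g :: "config \<Rightarrow> real" and a \<eta>
  show "euler N h (\<lambda>x. a * f x + g x) \<eta> = a * euler N h f \<eta> + euler N h g \<eta>"
    by (simp add: euler_convex sum.distrib sum_distrib_left algebra_simps)
next
  fix f :: "config \<Rightarrow> real" and \<eta> assume "\<forall>x\<in>configs N. 0 \<le> f x" "\<eta> \<in> configs N"
  then show "0 \<le> euler N h f \<eta>" unfolding euler_convex using assms
    by (intro add_nonneg_nonneg mult_nonneg_nonneg sum_nonneg) (auto simp: configs_bond)
qed (simp add: euler_def)

text \<open>To first order in \<open>h\<close> the product of non-commuting factors sees only the
  sum of their increments. The auxiliary limit \<open>F\<close> says that the remaining factors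
  converge to the identity, so the head bond acts in the limit on \<open>f\<close> itself.\<close>

lemma tendsto_foldr_bond_step:
  assumes "set bs \<subseteq> {..<N}"
  shows "((\<lambda>h. (foldr (bond_step N (h * (real N)\<^sup>2)) bs f \<eta> - f \<eta>) / h) \<longlongrightarrow>
     (real N)\<^sup>2 * (\<Sum>b\<leftarrow>bs. f (\<eta> \<circ> bond N b) - f \<eta>)) (at_right 0)"
  using assms
proof (induction bs arbitrary: \<eta>)
  case Nil then show ?case by simp
next
  case (Cons b bs)
  let ?F = "\<lambda>h. foldr (bond_step N (h * (real N)\<^sup>2)) bs f"
  have h: "((\<lambda>h. h) \<longlongrightarrow> 0) (at_right (0 :: real))" by (rule tendsto_ident_at)
  have F: "((\<lambda>h. ?F h \<eta>) \<longlongrightarrow> f \<eta>) (at_right 0)" for \<eta>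
  proof -
    have "((\<lambda>h. f \<eta> + h * ((?F h \<eta> - f \<eta>) / h)) \<longlongrightarrow> f \<eta> + 0 * ((real N)\<^sup>2 * (\<Sum>b\<leftarrow>bs. f (\<eta> \<circ> bond N b) - f \<eta>))) (at_right 0)"
      using Cons.prems by (intro tendsto_add tendsto_mult tendsto_const h Cons.IH) auto
    then have "((\<lambda>h. f \<eta> + h * ((?F h \<eta> - f \<eta>) / h)) \<longlongrightarrow> f \<eta>) (at_right 0)" by simp
    then show ?thesis by (rule Lim_transform_eventually) (auto simp: eventually_at_filter)
  qed
  have "((\<lambda>h. (?F h \<eta> - f \<eta>) / h + (real N)\<^sup>2 * (?F h (\<eta> \<circ> bond N b) - ?F h \<eta>)) \<longlongrightarrow>
     (real N)\<^sup>2 * (\<Sum>b\<leftarrow>bs. f (\<eta> \<circ> bond N b) - f \<eta>) + (real N)\<^sup>2 * (f (\<eta> \<circ> bond N b) - f \<eta>)) (at_right 0)"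
    using Cons.prems by (intro tendsto_add tendsto_mult tendsto_diff tendsto_const F Cons.IH) auto
  then have "((\<lambda>h. (?F h \<eta> - f \<eta>) / h + (real N)\<^sup>2 * (?F h (\<eta> \<circ> bond N b) - ?F h \<eta>)) \<longlongrightarrow>
     (real N)\<^sup>2 * (\<Sum>b\<leftarrow>b # bs. f (\<eta> \<circ> bond N b) - f \<eta>)) (at_right 0)"
    by (simp add: algebra_simps)
  then show ?case
    by (rule Lim_transform_eventually)
      (auto simp: eventually_at_filter foldr_bond_step_Cons field_simps simp del: foldr.simps)
qed

lemma tendsto_prodE:
  assumes "\<And>\<eta>. \<eta> \<in> configs N \<Longrightarrow> ((\<lambda>n. F n \<eta>) \<longlongrightarrow> G \<eta>) L"
    and "\<And>x. x < N \<Longrightarrow> ((\<lambda>n. \<rho> n x) \<longlongrightarrow> r x) L"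
  shows "((\<lambda>n. prodE N (\<rho> n) (F n)) \<longlongrightarrow> prodE N r G) L"
  using assms
proof (induction N arbitrary: F G)
  case 0 then show ?case by (simp add: configs_def)
next
  case (Suc N)
  show ?case unfolding prodE_Suc
  proof (rule Suc.IH)
    fix \<eta> assume \<eta>: "\<eta> \<in> configs N"
    show "((\<lambda>n. site_avg N (\<rho> n N) (F n) \<eta>) \<longlongrightarrow> site_avg N (r N) G \<eta>) L"
      unfolding site_avg_def
      by (intro tendsto_intros Suc.prems configs_Suc_upd \<eta>) auto
  qed (use Suc.prems in auto)
qed

lemma prodE_occupation: "x < N \<Longrightarrow> prodE N \<rho> (\<lambda>\<eta>. real (\<eta> x)) = \<rho> x"
  using prodE_site_avg[of x N \<rho> "\<lambda>\<eta>. real (\<eta> x)", symmetric]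
  by (simp add: site_avg_def[abs_def])

lemma mixed_diff_le_occupation: "mixed_diff_le N 0 (\<lambda>\<eta>. real (\<eta> x))"
  by (auto simp: mixed_diff_le_def mixed_diff_def)

section \<open>The semigroup of the exclusion process\<close>

text \<open>From \<open>N = 3\<close> on, distinct bonds join distinct pairs of sites; for
  \<open>N = 2\<close> both bonds would join the same pair.\<close>

locale ssep_kernel =
  fixes N :: nat and K :: "real \<Rightarrow> config \<Rightarrow> config pmf"
  assumes N: "3 \<le> N"
    and K: "markov_semigroup (configs N) K"
    and gen: "has_generator (configs N) K (ssep_generator N)"
begin

abbreviation "P \<equiv> kernel_op K"

definition word :: "nat \<Rightarrow> nat list" where
  "word n = concat (replicate n [0..<N])"

lemma word_subset: "set (word n) \<subseteq> {..<N}"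
  by (auto simp: word_def)

lemma length_word: "length (word n) = n * N"
  by (induction n) (auto simp: word_def)

lemma funpow_foldr: "(foldr (bond_step N p) [0..<N] ^^ n) f = foldr (bond_step N p) (word n) f"
  by (induction n) (simp_all add: word_def)

text \<open>Exchange probability per bond when time \<open>t\<close> is divided among the
  \<open>n\<close> sweeps of \<open>word n\<close>; every bond then rings at the rate
  \<open>N^2\<close> of the generator.\<close>

definition rate :: "real \<Rightarrow> nat \<Rightarrow> real" where
  "rate t n = t / real n * (real N)\<^sup>2"

lemma rate_ev: "0 < t \<Longrightarrow> \<forall>\<^sub>F n in sequentially. 0 \<le> rate t n \<and> rate t n \<le> 1"
proof -
  assume t: "0 < t"
  have "(\<lambda>n. t / real n * (real N)\<^sup>2) \<longlonglongrightarrow> 0"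
    by (rule tendsto_mult_left_zero[OF lim_const_over_n])
  then have "\<forall>\<^sub>F n in sequentially. t / real n * (real N)\<^sup>2 < 1"
    by (rule order_tendstoD) simp
  then show ?thesis by eventually_elim (use t in \<open>auto simp: rate_def\<close>)
qed

lemma word_tendsto:
  assumes t: "0 < t" and \<eta>: "\<eta> \<in> configs N"
  shows "(\<lambda>n. foldr (bond_step N (rate t n)) (word n) f \<eta>) \<longlonglongrightarrow> P t f \<eta>"
  unfolding rate_def funpow_foldr[symmetric]
proof (rule semigroup_approx[OF finite_configs K gen _ _ t \<eta>, where A = "\<lambda>h. foldr (bond_step N (h * (real N)\<^sup>2)) [0..<N]"])
  have "((\<lambda>h. h * (real N)\<^sup>2) \<longlongrightarrow> 0 * (real N)\<^sup>2) (at_right 0)"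
    by (intro tendsto_intros)
  then have "\<forall>\<^sub>F h in at_right 0. h * (real N)\<^sup>2 < 1"
    by (rule order_tendstoD) simp
  moreover have "\<forall>\<^sub>F h :: real in at_right 0. 0 < h" by (rule eventually_at_right_less)
  ultimately show "\<forall>\<^sub>F h in at_right 0. markov_op (configs N) (foldr (bond_step N (h * (real N)\<^sup>2)) [0..<N])"
    by eventually_elim (intro markov_op_foldr_bond_step; auto)
next
  fix f \<eta>
  show "((\<lambda>h. (foldr (bond_step N (h * (real N)\<^sup>2)) [0..<N] f \<eta> - f \<eta>) / h) \<longlongrightarrow> ssep_generator N f \<eta>) (at_right 0)"
    using tendsto_foldr_bond_step[of "[0..<N]" N f \<eta>]
    by (auto simp: ssep_generator_bond interv_sum_list_conv_sum_set_nat lessThan_atLeast0)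
qed

lemma euler_tendsto:
  assumes t: "0 < t" and \<eta>: "\<eta> \<in> configs N"
  shows "(\<lambda>n. (euler N (t / real n) ^^ n) f \<eta>) \<longlonglongrightarrow> P t f \<eta>"
proof (rule semigroup_approx[OF finite_configs K gen _ _ t \<eta>, where A = "euler N"])
  have "((\<lambda>h. h * (real N) ^ 3) \<longlongrightarrow> 0 * (real N) ^ 3) (at_right 0)"
    by (intro tendsto_intros)
  then have "\<forall>\<^sub>F h in at_right 0. h * (real N) ^ 3 < 1"
    by (rule order_tendstoD) simp
  moreover have "\<forall>\<^sub>F h :: real in at_right 0. 0 < h" by (rule eventually_at_right_less)
  ultimately show "\<forall>\<^sub>F h in at_right 0. markov_op (configs N) (euler N h)"
    by eventually_elim (intro markov_op_euler; auto)
next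
  fix f \<eta>
  have "\<forall>\<^sub>F h in at_right 0. ssep_generator N f \<eta> = (euler N h f \<eta> - f \<eta>) / h"
    by (auto simp: eventually_at_filter euler_def ssep_generator_bond)
  then show "((\<lambda>h. (euler N h f \<eta> - f \<eta>) / h) \<longlongrightarrow> ssep_generator N f \<eta>) (at_right 0)"
    by (rule Lim_transform_eventually[OF tendsto_const])
qed

lemma site_lipschitz_P:
  assumes f: "site_lipschitz N c f" and t: "0 < t"
  shows "site_lipschitz N c (P t f)"
  unfolding site_lipschitz_def
proof (intro ballI allI impI)
  fix \<eta> u and i :: nat assume A: "\<eta> \<in> configs N" "u < N" "i \<in> {0, 1}"
  have A': "\<eta>(u := i) \<in> configs N" using A by (intro configs_upd)
  have lim: "(\<lambda>n. \<bar>foldr (bond_step N (rate t n)) (word n) f (\<eta>(u := i)) - foldr (bond_step N (rate t n)) (word n) f \<eta>\<bar>)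
      \<longlonglongrightarrow> \<bar>P t f (\<eta>(u := i)) - P t f \<eta>\<bar>"
    by (intro tendsto_intros word_tendsto t A A')
  show "\<bar>P t f (\<eta>(u := i)) - P t f \<eta>\<bar> \<le> c"
  proof (rule tendsto_upperbound[OF lim])
    show "\<forall>\<^sub>F n in sequentially. \<bar>foldr (bond_step N (rate t n)) (word n) f (\<eta>(u := i)) - foldr (bond_step N (rate t n)) (word n) f \<eta>\<bar> \<le> c"
      using rate_ev[OF t] by eventually_elim
        (use foldr_bond_step_invariants(1)[OF _ _ word_subset f] A in \<open>auto simp: site_lipschitz_def\<close>)
  qed simp
qed

lemma mixed_diff_tendsto:
  assumes "\<And>\<eta>. \<eta> \<in> configs N \<Longrightarrow> (\<lambda>n. F n \<eta>) \<longlonglongrightarrow> f \<eta>" "\<eta> \<in> configs N" "u < N" "v < N"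
  shows "(\<lambda>n. mixed_diff u v (F n) \<eta>) \<longlonglongrightarrow> mixed_diff u v f \<eta>"
  unfolding mixed_diff_def using assms by (intro tendsto_intros assms) auto

lemma mixed_diff_le_P:
  assumes f: "mixed_diff_le N \<kappa> f" and t: "0 < t"
  shows "mixed_diff_le N \<kappa> (P t f)"
  unfolding mixed_diff_le_def
proof (intro ballI allI impI)
  fix \<eta> u v assume A: "\<eta> \<in> configs N" "u < N" "v < N" "u \<noteq> v"
  have lim: "(\<lambda>n. \<bar>mixed_diff u v (foldr (bond_step N (rate t n)) (word n) f) \<eta>\<bar>) \<longlonglongrightarrow> \<bar>mixed_diff u v (P t f) \<eta>\<bar>"
    using A by (intro tendsto_intros mixed_diff_tendsto word_tendsto t)
  show "\<bar>mixed_diff u v (P t f) \<eta>\<bar> \<le> \<kappa>"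
  proof (rule tendsto_upperbound[OF lim])
    show "\<forall>\<^sub>F n in sequentially. \<bar>mixed_diff u v (foldr (bond_step N (rate t n)) (word n) f) \<eta>\<bar> \<le> \<kappa>"
      using rate_ev[OF t] by eventually_elim
        (use foldr_bond_step_invariants(2)[OF _ _ word_subset f] A in \<open>auto simp: mixed_diff_le_def\<close>)
  qed simp
qed

text \<open>The constant \<open>t * N^3\<close> is the sum of the exchange probabilities over the
  word: \<open>n\<close> sweeps of \<open>N\<close> bonds with probability
  \<open>t * N^2 / n\<close> each, whatever \<open>n\<close> is.\<close>

lemma P_exp_le:
  assumes g: "site_lipschitz N c g" and c: "2 * c \<le> 1" and t: "0 < t" and \<eta>: "\<eta> \<in> configs N"
  shows "P t (\<lambda>\<eta>. exp (g \<eta>)) \<eta> \<le> exp (P t g \<eta> + t * real N ^ 3 * (2 * c)\<^sup>2)"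
proof (rule tendsto_le[OF sequentially_bot _ word_tendsto[OF t \<eta>]])
  show "(\<lambda>n. exp (foldr (bond_step N (rate t n)) (word n) g \<eta> + t * real N ^ 3 * (2 * c)\<^sup>2))
     \<longlonglongrightarrow> exp (P t g \<eta> + t * real N ^ 3 * (2 * c)\<^sup>2)"
    by (intro tendsto_intros word_tendsto t \<eta>)
  show "\<forall>\<^sub>F n in sequentially. foldr (bond_step N (rate t n)) (word n) (\<lambda>\<eta>. exp (g \<eta>)) \<eta> \<le>
      exp (foldr (bond_step N (rate t n)) (word n) g \<eta> + t * real N ^ 3 * (2 * c)\<^sup>2)"
    using rate_ev[OF t] eventually_gt_at_top[of 0]
  proof eventually_elim
    case (elim n)
    have "rate t n * real (length (word n)) = t * real N ^ 3"
      using elim by (simp add: rate_def length_word power2_eq_square power3_eq_cube)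
    then show ?case
      using foldr_bond_step_exp[OF _ _ word_subset g c \<eta>, of "rate t n" n] elim by simp
  qed
qed

text \<open>Defined from the semigroup, so that composition in time is available at once. Limits of
  the exchange products and of the lattice heat equation are two further descriptions, proved
  separately.\<close>

definition mean_density :: "real \<Rightarrow> (nat \<Rightarrow> real) \<Rightarrow> nat \<Rightarrow> real" where
  "mean_density t \<rho> x = prodE N \<rho> (P t (\<lambda>\<eta>. real (\<eta> x)))"

context
  fixes t :: real and \<rho> :: "nat \<Rightarrow> real"
  assumes t: "0 < t" and \<rho>: "unit_density N \<rho>"
begin

text \<open>Mixed differences of a single occupation variable vanish, so
  \<open>prodE_foldr_additive\<close> holds with error 0: expected occupations under the exchange
  product are exactly the updated densities.\<close>

lemma word_density_tendsto:
  assumes x: "x < N"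
  shows "(\<lambda>n. fold (density_step N (rate t n)) (word n) \<rho> x) \<longlonglongrightarrow> mean_density t \<rho> x"
proof (rule Lim_transform_eventually)
  show "(\<lambda>n. prodE N \<rho> (foldr (bond_step N (rate t n)) (word n) (\<lambda>\<eta>. real (\<eta> x)))) \<longlonglongrightarrow> mean_density t \<rho> x"
    unfolding mean_density_def by (intro tendsto_prodE word_tendsto t tendsto_const)
  show "\<forall>\<^sub>F n in sequentially. prodE N \<rho> (foldr (bond_step N (rate t n)) (word n) (\<lambda>\<eta>. real (\<eta> x)))
      = fold (density_step N (rate t n)) (word n) \<rho> x"
    using rate_ev[OF t]
  proof eventually_elim
    case (elim n)
    show ?case
      using prodE_foldr_additive[OF _ _ _ word_subset \<rho> mixed_diff_le_occupation, of "rate t n" n x] elim N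
        prodE_occupation[OF x] by simp
  qed
qed

lemma unit_density_mean_density: "unit_density N (mean_density t \<rho>)"
  unfolding unit_density_def
proof (intro allI impI conjI)
  fix x assume x: "x < N"
  have ev: "\<forall>\<^sub>F n in sequentially. unit_density N (fold (density_step N (rate t n)) (word n) \<rho>)"
    using rate_ev[OF t] by eventually_elim (intro unit_density_fold \<rho> word_subset; simp)
  show "0 \<le> mean_density t \<rho> x"
    by (rule tendsto_lowerbound[OF word_density_tendsto[OF x]])
      (use ev x in \<open>auto elim!: eventually_mono simp: unit_density_def\<close>)
  show "mean_density t \<rho> x \<le> 1"
    by (rule tendsto_upperbound[OF word_density_tendsto[OF x]])
      (use ev x in \<open>auto elim!: eventually_mono simp: unit_density_def\<close>)
qed

lemma energy_word_tendsto:
  "(\<lambda>n. energy N (fold (density_step N (rate t n)) (word n) \<rho>)) \<longlonglongrightarrow> energy N (mean_density t \<rho>)"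
  unfolding energy_def by (intro tendsto_intros word_density_tendsto) auto

lemma prodE_P_le:
  assumes f: "mixed_diff_dominated N \<theta> f" "0 \<le> \<theta>" "\<And>\<eta>. \<eta> \<in> configs N \<Longrightarrow> 0 \<le> f \<eta>"
  shows "prodE N \<rho> (P t f) \<le> exp (\<theta> / 2 * (energy N \<rho> - energy N (mean_density t \<rho>))) * prodE N (mean_density t \<rho>) f"
proof (rule tendsto_le[OF sequentially_bot])
  show "(\<lambda>n. prodE N \<rho> (foldr (bond_step N (rate t n)) (word n) f)) \<longlonglongrightarrow> prodE N \<rho> (P t f)"
    by (intro tendsto_prodE word_tendsto t tendsto_const)
  show "(\<lambda>n. exp (\<theta> / 2 * (energy N \<rho> - energy N (fold (density_step N (rate t n)) (word n) \<rho>)))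
      * prodE N (fold (density_step N (rate t n)) (word n) \<rho>) f)
    \<longlonglongrightarrow> exp (\<theta> / 2 * (energy N \<rho> - energy N (mean_density t \<rho>))) * prodE N (mean_density t \<rho>) f"
    by (intro tendsto_intros tendsto_prodE energy_word_tendsto word_density_tendsto)
  show "\<forall>\<^sub>F n in sequentially. prodE N \<rho> (foldr (bond_step N (rate t n)) (word n) f) \<le>
      exp (\<theta> / 2 * (energy N \<rho> - energy N (fold (density_step N (rate t n)) (word n) \<rho>)))
      * prodE N (fold (density_step N (rate t n)) (word n) \<rho>) f"
    using rate_ev[OF t] by eventually_elim (intro prodE_foldr_le word_subset \<rho> f; use N in simp)
qed

lemma prodE_P_additive:
  assumes f: "mixed_diff_le N \<kappa> f"
  shows "\<bar>prodE N \<rho> (P t f) - prodE N (mean_density t \<rho>) f\<bar> \<le> \<kappa> / 2 * (energy N \<rho> - energy N (mean_density t \<rho>))"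
proof (rule tendsto_le[OF sequentially_bot])
  show "(\<lambda>n. \<bar>prodE N \<rho> (foldr (bond_step N (rate t n)) (word n) f)
      - prodE N (fold (density_step N (rate t n)) (word n) \<rho>) f\<bar>) \<longlonglongrightarrow> \<bar>prodE N \<rho> (P t f) - prodE N (mean_density t \<rho>) f\<bar>"
    by (intro tendsto_intros tendsto_prodE word_tendsto word_density_tendsto t)
  show "(\<lambda>n. \<kappa> / 2 * (energy N \<rho> - energy N (fold (density_step N (rate t n)) (word n) \<rho>)))
    \<longlonglongrightarrow> \<kappa> / 2 * (energy N \<rho> - energy N (mean_density t \<rho>))"
    by (intro tendsto_intros energy_word_tendsto)
  show "\<forall>\<^sub>F n in sequentially. \<bar>prodE N \<rho> (foldr (bond_step N (rate t n)) (word n) f)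
      - prodE N (fold (density_step N (rate t n)) (word n) \<rho>) f\<bar> \<le>
      \<kappa> / 2 * (energy N \<rho> - energy N (fold (density_step N (rate t n)) (word n) \<rho>))"
    using rate_ev[OF t] by eventually_elim (intro prodE_foldr_additive word_subset \<rho> f; use N in simp)
qed

end

text \<open>The semigroup keeps mixed differences of an occupation variable equal to 0, so replacing
  the law at time \<open>s\<close> by the product law of its means is exact for this
  observable.\<close>

lemma mean_density_add:
  assumes s: "0 < s" and t: "0 < t" and \<rho>: "unit_density N \<rho>" and x: "x < N"
  shows "mean_density (s + t) \<rho> x = mean_density t (mean_density s \<rho>) x"
proof -
  have "mean_density (s + t) \<rho> x = prodE N \<rho> (P s (P t (\<lambda>\<eta>. real (\<eta> x))))"
    unfolding mean_density_def using s t by (intro prodE_cong kernel_op_add[OF finite_configs K]) auto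
  also have "\<dots> = prodE N (mean_density s \<rho>) (P t (\<lambda>\<eta>. real (\<eta> x)))"
    using prodE_P_additive[OF s \<rho> mixed_diff_le_P[OF mixed_diff_le_occupation t], of x] by simp
  finally show ?thesis unfolding mean_density_def .
qed

end

section \<open>Heat kernel bound for the reflected walk on a path\<close>

text \<open>The Neumann Laplacian of the path \<open>{0..<M}\<close>: an edge missing at an end
  contributes nothing, which is reflection.\<close>

definition path_lap :: "nat \<Rightarrow> (nat \<Rightarrow> real) \<Rightarrow> nat \<Rightarrow> real" where
  "path_lap M q i = (if Suc i < M then q (Suc i) - q i else 0) + (if 0 < i then q (i - 1) - q i else 0)"

definition path_step :: "nat \<Rightarrow> real \<Rightarrow> (nat \<Rightarrow> real) \<Rightarrow> nat \<Rightarrow> real" where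
  "path_step M a q i = q i + a * path_lap M q i"

definition dirichlet :: "nat \<Rightarrow> (nat \<Rightarrow> real) \<Rightarrow> real" where
  "dirichlet M q = (\<Sum>i<M - 1. (q (Suc i) - q i)\<^sup>2)"

lemma sum_path:
  fixes f :: "nat \<Rightarrow> real"
  shows "(\<Sum>i<Suc m. if Suc i < Suc m then f i else 0) = (\<Sum>i<m. f i)"
    "(\<Sum>i<Suc m. if 0 < i then f i else 0) = (\<Sum>i<m. f (Suc i))"
  by (simp, subst sum.lessThan_Suc_shift, simp)

lemma path_lap_by_parts:
  assumes "0 < M"
  shows "(\<Sum>i<M. path_lap M q i * w i) = - (\<Sum>i<M - 1. (q (Suc i) - q i) * (w (Suc i) - w i))"
proof -
  obtain m where M: "M = Suc m" using assms by (cases M) auto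
  have "(\<Sum>i<M. path_lap M q i * w i) =
     (\<Sum>i<Suc m. if Suc i < Suc m then (q (Suc i) - q i) * w i else 0)
     + (\<Sum>i<Suc m. if 0 < i then (q (i - 1) - q i) * w i else 0)"
    unfolding sum.distrib[symmetric] M by (intro sum.cong) (auto simp: path_lap_def algebra_simps)
  also have "\<dots> = (\<Sum>i<m. (q (Suc i) - q i) * w i + (q i - q (Suc i)) * w (Suc i))"
    unfolding sum_path by (simp add: sum.distrib)
  also have "\<dots> = (\<Sum>i<m. - ((q (Suc i) - q i) * (w (Suc i) - w i)))"
    by (intro sum.cong) (auto simp: algebra_simps)
  finally show ?thesis by (simp add: M sum_negf)
qed

lemma sum_path_lap_sq:
  assumes "0 < M"
  shows "(\<Sum>i<M. (path_lap M q i)\<^sup>2) \<le> 4 * dirichlet M q"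
proof -
  obtain m where M: "M = Suc m" using assms by (cases M) auto
  have "(\<Sum>i<M. (path_lap M q i)\<^sup>2) \<le> (\<Sum>i<Suc m. if Suc i < Suc m then 2 * (q (Suc i) - q i)\<^sup>2 else 0)
     + (\<Sum>i<Suc m. if 0 < i then 2 * (q (i - 1) - q i)\<^sup>2 else 0)"
    unfolding sum.distrib[symmetric] M
  proof (rule sum_mono)
    fix i
    have "(x + y)\<^sup>2 \<le> 2 * x\<^sup>2 + 2 * y\<^sup>2" for x y :: real
      using sum_squares_bound[of x y] by (simp add: power2_sum)
    then show "(path_lap (Suc m) q i)\<^sup>2 \<le> (if Suc i < Suc m then 2 * (q (Suc i) - q i)\<^sup>2 else 0)
        + (if 0 < i then 2 * (q (i - 1) - q i)\<^sup>2 else 0)"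
      unfolding path_lap_def by (rule order_trans) auto
  qed
  also have "\<dots> = (\<Sum>i<m. 2 * (q (Suc i) - q i)\<^sup>2 + 2 * (q i - q (Suc i))\<^sup>2)"
    unfolding sum_path by (simp add: sum.distrib)
  also have "\<dots> = 4 * dirichlet M q"
    by (simp add: M dirichlet_def sum_distrib_left power2_commute algebra_simps)
  finally show ?thesis .
qed

context
  fixes M :: nat and a :: real
  assumes M: "0 < M" and a: "0 \<le> a" "a \<le> 1 / 4"
begin

lemma sum_path_step: "(\<Sum>i<M. path_step M a q i) = (\<Sum>i<M. q i)"
  using path_lap_by_parts[OF M, of q "\<lambda>_. 1"]
  by (simp add: path_step_def sum.distrib flip: sum_distrib_left)

text \<open>Integration by parts gains \<open>2 * a\<close> times the Dirichlet form, and the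
  quadratic term gives back at most \<open>4 * a^2\<close> times it; \<open>a \<le> 1 / 4\<close>
  leaves at least half of the gain.\<close>

lemma sum_path_step_sq: "(\<Sum>i<M. (path_step M a q i)\<^sup>2) \<le> (\<Sum>i<M. (q i)\<^sup>2) - a * dirichlet M q"
proof -
  have "(\<Sum>i<M. (path_step M a q i)\<^sup>2) =
     (\<Sum>i<M. (q i)\<^sup>2) + 2 * a * (\<Sum>i<M. path_lap M q i * q i) + a\<^sup>2 * (\<Sum>i<M. (path_lap M q i)\<^sup>2)"
    by (simp add: path_step_def power2_sum sum.distrib sum_distrib_left power_mult_distrib algebra_simps)
  also have "(\<Sum>i<M. path_lap M q i * q i) = - dirichlet M q"
    unfolding path_lap_by_parts[OF M] dirichlet_def by (simp add: power2_eq_square)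
  also have "a\<^sup>2 * (\<Sum>i<M. (path_lap M q i)\<^sup>2) \<le> a\<^sup>2 * (4 * dirichlet M q)"
    by (intro mult_left_mono sum_path_lap_sq M) auto
  also have "\<dots> \<le> a * dirichlet M q"
  proof -
    have "0 \<le> dirichlet M q" by (simp add: dirichlet_def sum_nonneg)
    moreover have "a * (4 * a) \<le> a * 1" using a by (intro mult_left_mono) auto
    ultimately show ?thesis using mult_right_mono[of "a * (4 * a)" "a * 1" "dirichlet M q"]
      by (simp add: power2_eq_square algebra_simps)
  qed
  finally show ?thesis by simp
qed

lemma path_step_convex: "\<exists>\<alpha> \<beta>. 0 \<le> \<alpha> \<and> 0 \<le> \<beta> \<and> \<alpha> + \<beta> \<le> 1 \<and>
    path_step M a q i = (1 - \<alpha> - \<beta>) * q i + \<alpha> * q (if Suc i < M then Suc i else i) + \<beta> * q (i - 1)"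
  by (rule exI[of _ "if Suc i < M then a else 0"], rule exI[of _ "if 0 < i then a else 0"])
    (use a in \<open>auto simp: path_step_def path_lap_def algebra_simps\<close>)

lemma path_step_bounds:
  assumes q: "\<And>i. i < M \<Longrightarrow> l \<le> q i \<and> q i \<le> u" and i: "i < M"
  shows "l \<le> path_step M a q i \<and> path_step M a q i \<le> u"
proof -
  obtain \<alpha> \<beta> where ab: "0 \<le> \<alpha>" "0 \<le> \<beta>" "\<alpha> + \<beta> \<le> 1" and
    eq: "path_step M a q i = (1 - \<alpha> - \<beta>) * q i + \<alpha> * q (if Suc i < M then Suc i else i) + \<beta> * q (i - 1)"
    using path_step_convex by blast
  let ?j = "if Suc i < M then Suc i else i"
  have b: "l \<le> q i" "q i \<le> u" "l \<le> q ?j" "q ?j \<le> u" "l \<le> q (i - 1)" "q (i - 1) \<le> u"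
    using q[of i] q[of ?j] q[of "i - 1"] i by auto
  have "(1 - \<alpha> - \<beta>) * l + \<alpha> * l + \<beta> * l \<le> path_step M a q i"
    "path_step M a q i \<le> (1 - \<alpha> - \<beta>) * u + \<alpha> * u + \<beta> * u"
    unfolding eq using ab b by (intro add_mono mult_left_mono; simp)+
  then show ?thesis by (simp add: algebra_simps)
qed

text \<open>Among \<open>k\<close> consecutive sites around \<open>i\<close> the mass bound 2 forces
  a value of at most \<open>2 / k \<le> \<epsilon> / 2\<close>. So \<open>q\<close> varies by at
  least \<open>\<epsilon> / 2\<close> within the window, and the Cauchy-Schwarz inequality over
  fewer than \<open>k\<close> edges turns this into Dirichlet energy.\<close>

lemma dirichlet_lower:
  assumes q: "\<And>i. i < M \<Longrightarrow> 0 \<le> q i" "(\<Sum>i<M. q i) \<le> 2"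
    and k: "0 < k" "k \<le> M" "4 \<le> \<epsilon> * real k" and i: "i < M" "\<epsilon> < q i" and \<epsilon>: "0 < \<epsilon>"
  shows "\<epsilon>\<^sup>2 / (4 * real k) \<le> dirichlet M q"
proof -
  \<comment> \<open>The window starts at \<open>i\<close>, unless it has to be moved to the left to
    fit into the path.\<close>
  define s where "s = min i (M - k)"
  have W: "{s..<s + k} \<subseteq> {..<M}" "s \<le> i" "i < s + k" using k i by (auto simp: s_def)
  have "\<exists>l\<in>{s..<s + k}. q l \<le> 2 / real k"
  proof (rule ccontr)
    assume "\<not> ?thesis"
    then have "(\<Sum>l\<in>{s..<s + k}. 2 / real k) < (\<Sum>l\<in>{s..<s + k}. q l)"
      using k by (intro sum_strict_mono) (auto simp: not_le)
    also have "\<dots> \<le> (\<Sum>l<M. q l)" using W q by (intro sum_mono2) auto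
    finally show False using k q by simp
  qed
  then obtain l where l: "l \<in> {s..<s + k}" "q l \<le> 2 / real k" by blast
  have "2 / real k \<le> \<epsilon> / 2" using k by (simp add: field_simps)
  then have "\<epsilon> / 2 \<le> \<bar>q i - q l\<bar>" using l i by linarith
  also have "\<bar>q i - q l\<bar> = \<bar>q (max i l) - q (min i l)\<bar>" by (simp add: max_def min_def abs_minus_commute)
  also have "\<dots> = \<bar>\<Sum>x = min i l..<max i l. q (Suc x) - q x\<bar>"
    by (subst sum_Suc_diff') (auto simp: max_def min_def)
  also have "\<dots> \<le> (\<Sum>x = min i l..<max i l. \<bar>q (Suc x) - q x\<bar>)" by (rule sum_abs)
  also have "\<dots> \<le> (\<Sum>x = s..<s + k - 1. \<bar>q (Suc x) - q x\<bar>)"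
    using W l by (intro sum_mono2) auto
  finally have "(\<epsilon> / 2)\<^sup>2 \<le> (\<Sum>x = s..<s + k - 1. \<bar>q (Suc x) - q x\<bar>)\<^sup>2"
    using \<epsilon> by (intro power_mono) auto
  also have "\<dots> \<le> (\<Sum>x = s..<s + k - 1. \<bar>q (Suc x) - q x\<bar>\<^sup>2) * real (card {s..<s + k - 1})"
    by (rule sum_squared_le_sum_of_squares)
  also have "\<dots> \<le> dirichlet M q * real k"
  proof (rule mult_mono)
    show "(\<Sum>x = s..<s + k - 1. \<bar>q (Suc x) - q x\<bar>\<^sup>2) \<le> dirichlet M q"
      unfolding dirichlet_def power2_abs using W(1) k by (intro sum_mono2) (auto simp: s_def)
  qed (auto simp: dirichlet_def sum_nonneg)
  finally show ?thesis using k by (simp add: field_simps power2_eq_square)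
qed

text \<open>As long as the maximum exceeds \<open>\<epsilon>\<close>, the mass bound forces the Dirichlet form to be large, so the
  sum of squares would decrease below zero.\<close>

lemma path_step_nash:
  assumes q: "\<And>i. i < M \<Longrightarrow> 0 \<le> q i \<and> q i \<le> 1" "(\<Sum>i<M. q i) \<le> 2"
    and k: "0 < k" "k \<le> M" "4 \<le> \<epsilon> * real k" and \<epsilon>: "0 < \<epsilon>"
    and n: "8 * real k < real n * a * \<epsilon>\<^sup>2" and i: "i < M"
  shows "(path_step M a ^^ n) q i \<le> \<epsilon>"
proof (rule ccontr)
  assume big: "\<not> ?thesis"
  let ?q = "\<lambda>j. (path_step M a ^^ j) q"
  have bnd: "0 \<le> ?q j i \<and> ?q j i \<le> 1" if "i < M" for i j
    using that by (induction j arbitrary: i) (auto simp: q intro!: path_step_bounds)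
  have mass: "(\<Sum>i<M. ?q j i) \<le> 2" for j
    by (induction j) (simp_all add: q sum_path_step)
  \<comment> \<open>By the maximum principle a profile that is everywhere at most
    \<open>\<epsilon>\<close> remains so; an excess after \<open>n\<close> steps therefore means an
    excess at every earlier step.\<close>
  have persist: "\<exists>i<M. \<epsilon> < ?q j i" if "j \<le> n" for j
  proof (rule ccontr)
    assume *: "\<not> ?thesis"
    have **: "?q j i \<le> \<epsilon>" if "i < M" for i using * that by (meson not_less)
    have "?q (j + m) i \<le> \<epsilon>" if "i < M" for m i
      using that
    proof (induction m arbitrary: i)
      case 0 then show ?case using ** by simp
    next
      case (Suc m)
      then show ?case using path_step_bounds[of 0 "?q (j + m)" \<epsilon> i] bnd by simp
    qed
    from this[OF i, of "n - j"] show False using big \<open>j \<le> n\<close> by simp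
  qed
  \<comment> \<open>The initial sum of squares is at most the mass 2, because all values lie between
    0 and 1. The hypothesis on \<open>n\<close> makes the right-hand side negative for
    \<open>j = n\<close>.\<close>
  have energy: "(\<Sum>i<M. (?q j i)\<^sup>2) \<le> 2 - real j * (a * (\<epsilon>\<^sup>2 / (4 * real k)))" if "j \<le> n" for j
    using that
  proof (induction j)
    case 0
    have "(\<Sum>i<M. (q i)\<^sup>2) \<le> (\<Sum>i<M. q i)"
      using q(1) by (intro sum_mono) (auto simp: power2_eq_square mult_left_le)
    then show ?case using q(2) by simp
  next
    case (Suc j)
    obtain l where l: "l < M" "\<epsilon> < ?q j l" using persist[of j] Suc.prems by auto
    have "\<epsilon>\<^sup>2 / (4 * real k) \<le> dirichlet M (?q j)"
      using bnd mass by (intro dirichlet_lower[where q = "?q j", OF _ _ k l \<epsilon>]) auto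
    then have "a * (\<epsilon>\<^sup>2 / (4 * real k)) \<le> a * dirichlet M (?q j)" by (rule mult_left_mono[OF _ a(1)])
    moreover have "(\<Sum>i<M. (?q (Suc j) i)\<^sup>2) \<le> (\<Sum>i<M. (?q j i)\<^sup>2) - a * dirichlet M (?q j)"
      using sum_path_step_sq[of "?q j"] by simp
    moreover have "(\<Sum>i<M. (?q j i)\<^sup>2) \<le> 2 - real j * (a * (\<epsilon>\<^sup>2 / (4 * real k)))"
      using Suc by simp
    moreover have "real (Suc j) * (a * (\<epsilon>\<^sup>2 / (4 * real k)))
        = real j * (a * (\<epsilon>\<^sup>2 / (4 * real k))) + a * (\<epsilon>\<^sup>2 / (4 * real k))"
      by (simp only: of_nat_Suc distrib_right mult_1 add.commute)
    ultimately show ?case by linarith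
  qed
  have "0 \<le> (\<Sum>i<M. (?q n i)\<^sup>2)" by (intro sum_nonneg) auto
  with energy[of n] have "real n * (a * (\<epsilon>\<^sup>2 / (4 * real k))) \<le> 2" by simp
  then show False using n k by (simp add: field_simps)
qed

end

section \<open>Smearing of pair functions\<close>

text \<open>The distance in the linear order of \<open>{..<N}\<close>, not the cyclic one. The
  identification of the gaps \<open>i\<close> and \<open>N - 2 - i\<close> on the torus is imposed
  on the gap profiles \<open>q\<close> instead.\<close>

definition site_dist :: "nat \<Rightarrow> nat \<Rightarrow> nat" where
  "site_dist x y = (if x < y then y - x else x - y)"

lemma mixed_diff_commute: "u \<noteq> v \<Longrightarrow> mixed_diff u v f \<eta> = mixed_diff v u f \<eta>"
  by (simp add: mixed_diff_def fun_upd_twist[of u v])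

lemma bond_left: "b + 1 < N \<Longrightarrow> bond N b b = b + 1"
  and bond_right: "b + 1 < N \<Longrightarrow> bond N b (b + 1) = b"
  and bond_other: "x \<noteq> b \<Longrightarrow> x \<noteq> (b + 1) mod N \<Longrightarrow> bond N b x = x"
  and bond_last: "0 < N \<Longrightarrow> bond N (N - 1) (N - 1) = 0"
  and bond_first: "0 < N \<Longrightarrow> bond N (N - 1) 0 = N - 1"
  by (simp_all add: bond_def)

lemma succ_mod: "(b :: nat) < N \<Longrightarrow> (b + 1) mod N = (if b = N - 1 then 0 else b + 1)"
proof (cases "b = N - 1")
  case True
  moreover assume "b < N"
  ultimately have "b + 1 = N" by arith
  then show ?thesis using True by simp
next
  case False
  moreover assume "b < N"
  ultimately have "b + 1 < N" by arith
  then show ?thesis using False by simp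
qed

text \<open>Only the bonds touching \<open>u\<close> or \<open>v\<close> matter, and each of the two
  particles contributes one step of the gap in either direction, hence the factor 2. A bond joining
  the two sites merely swaps them and leaves the gap unchanged; this produces the reflection at both
  ends. A particle crossing from 0 to \<open>N - 1\<close> or back reverses the linear order and
  turns the new gap \<open>i + 1\<close> into \<open>N - 2 - (i + 1)\<close>; the symmetry of
  \<open>q\<close> absorbs this.\<close>

lemma sum_bond_dist:
  fixes q :: "nat \<Rightarrow> real"
  assumes N: "3 \<le> N" and uv: "u < v" "v < N"
    and sym: "\<And>i. i < N - 1 \<Longrightarrow> q (N - 2 - i) = q i"
  shows "(\<Sum>b<N. q (site_dist (bond N b u) (bond N b v) - 1) - q (v - u - 1))
    = 2 * path_lap (N - 1) q (v - u - 1)"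
proof -
  define i where "i = v - u - 1"
  have v: "v = u + i + 1" and iN: "i < N - 1" using uv by (auto simp: i_def)
  define D where "D x y = q (site_dist x y - 1)" for x y
  have D: "D x (x + j + 1) = q j" "D (x + j + 1) x = q j" for x j
    by (simp_all add: D_def site_dist_def)
  have D_sym: "D x y = D y x" for x y by (simp add: D_def site_dist_def)
  define t where "t b = D (bond N b u) (bond N b v) - q i" for b
  define u' where "u' = (if u = 0 then N - 1 else u - 1)"
  have u': "u' < N" "(u' + 1) mod N = u" using uv by (auto simp: u'_def succ_mod)
  have t0: "t b = 0" if "b < N" "b \<notin> {u', u, v - 1, v}" for b
  proof -
    have "(b + 1) mod N \<noteq> u" "(b + 1) mod N \<noteq> v"
      using that uv by (auto simp: succ_mod u'_def split: if_splits)
    then have "bond N b u = u" "bond N b v = v"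
      using that by (auto intro: bond_other)
    then show ?thesis by (simp add: t_def v D)
  qed
  have tu: "t u = q (i - 1) - q i" if "0 < i"
  proof -
    define j where "j = i - 1"
    have j: "i = j + 1" using that unfolding j_def by arith
    have "bond N u u = u + 1" using uv v by (intro bond_left) simp
    moreover have "bond N u v = v" using uv v j by (intro bond_other) (auto simp: succ_mod)
    moreover have "D (u + 1) v = q j" using D(1)[of "u + 1" j] by (simp add: v j algebra_simps)
    ultimately show ?thesis by (simp add: t_def j)
  qed
  have tv1: "t (v - 1) = q (i - 1) - q i" if "0 < i"
  proof -
    define j where "j = i - 1"
    have j: "i = j + 1" using that unfolding j_def by arith
    have "bond N (v - 1) v = v - 1" using bond_right[of "v - 1" N] uv v by simp
    moreover have "bond N (v - 1) u = u" using uv v j by (intro bond_other) (auto simp: succ_mod)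
    moreover have "D u (v - 1) = q j" using D(1)[of u j] by (simp add: v j algebra_simps)
    ultimately show ?thesis by (simp add: t_def j)
  qed
  have tu': "t u' = q (i + 1) - q i" if "\<not> (u = 0 \<and> v = N - 1)"
  proof (cases "u = 0")
    case True
    have "u' = N - 1" "v < N - 1" using that True uv by (auto simp: u'_def)
    then have b: "bond N u' u = N - 1" "bond N u' v = v"
      using True N uv by (auto simp: bond_first intro!: bond_other)
    have "N - 1 = v + (N - 2 - (i + 1)) + 1" "i + 1 < N - 1"
      using \<open>v < N - 1\<close> v True by auto
    then have "D (N - 1) v = q (i + 1)" using D(2)[of v "N - 2 - (i + 1)"] sym[of "i + 1"] by metis
    then show ?thesis by (simp add: t_def b)
  next
    case False
    define w where "w = u - 1"
    have w: "u = w + 1" using False unfolding w_def by arith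
    then have [simp]: "u' = w" by (simp add: u'_def)
    have "bond N w u = w" using bond_right[of w N] uv w by simp
    moreover have "bond N w v = v" using uv v w by (intro bond_other) (auto simp: succ_mod)
    moreover have "D w v = q (i + 1)" using D(1)[of w "i + 1"] by (simp add: v w algebra_simps)
    ultimately show ?thesis by (simp add: t_def)
  qed
  have tv: "t v = q (i + 1) - q i" if "\<not> (u = 0 \<and> v = N - 1)"
  proof (cases "v = N - 1")
    case True
    then have u: "0 < u" using that by simp
    have b: "bond N v v = 0" "bond N v u = u"
      using True N uv u by (auto simp: bond_last intro!: bond_other)
    have "u = 0 + (N - 2 - (i + 1)) + 1" "i + 1 < N - 1"
      using True v u N by auto
    then have "D u 0 = q (i + 1)" using D(2)[of 0 "N - 2 - (i + 1)"] sym[of "i + 1"] by metis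
    then show ?thesis by (simp add: t_def b)
  next
    case False
    have "bond N v v = v + 1" using uv False by (intro bond_left) simp
    moreover have "bond N v u = u" using uv False by (intro bond_other) (auto simp: succ_mod)
    moreover have "D u (v + 1) = q (i + 1)" using D(1)[of u "i + 1"] by (simp add: v algebra_simps)
    ultimately show ?thesis by (simp add: t_def)
  qed
  \<comment> \<open>The four bonds listed are distinct unless the pair is adjacent: then either
    \<open>v - 1 = u\<close>, the reflection at gap 0, or the pair is adjacent through the closing
    bond, where \<open>u' = v\<close>, the reflection at gap \<open>N - 2\<close>. For
    \<open>N \<ge> 3\<close> these two cases exclude each other.\<close>
  have sum: "(\<Sum>b<N. t b) = (\<Sum>b\<in>{u', u, v - 1, v}. t b)"
    using uv t0 u' by (intro sum.mono_neutral_right) auto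
  consider "i = 0" | "u = 0" "v = N - 1" "0 < i" | "0 < i" "\<not> (u = 0 \<and> v = N - 1)" by blast
  then have "(\<Sum>b\<in>{u', u, v - 1, v}. t b) = 2 * path_lap (N - 1) q i"
  proof cases
    case 1
    then have n: "\<not> (u = 0 \<and> v = N - 1)" and e: "v - 1 = u" and ne: "u' \<noteq> u" "u' \<noteq> v" "u \<noteq> v"
      using v N uv by (auto simp: u'_def split: if_splits)
    have "bond N u u = v" "bond N u v = u" using bond_left[of u N] bond_right[of u N] v 1 uv by auto
    then have "t u = 0" using D(2)[of u i] 1 by (simp add: t_def v)
    then have "(\<Sum>b\<in>{u', u, v - 1, v}. t b) = 2 * (q (i + 1) - q i)"
      unfolding e using tu'[OF n] tv[OF n] ne by simp
    moreover have "Suc 0 < N - 1" using N by simp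
    ultimately show ?thesis using 1 by (simp add: path_lap_def One_nat_def)
  next
    case 2
    have e: "u' = v" using 2 by (simp add: u'_def)
    have ne: "u \<noteq> v" "v - 1 \<noteq> u" "v - 1 \<noteq> v" using 2 v N by auto
    have "bond N v v = u" "bond N v u = v" using bond_last[of N] bond_first[of N] 2 N by auto
    then have "t v = 0" using D(2)[of u i] by (simp add: t_def v)
    moreover have "\<not> Suc i < N - 1" using 2 v by simp
    moreover have "(\<Sum>b\<in>{u', u, v - 1, v}. t b) = t v + (t u + t (v - 1))"
    proof -
      have "{u', u, v - 1, v} = {v, u, v - 1}" by (auto simp: e)
      then show ?thesis using ne by simp
    qed
    ultimately show ?thesis using tu tv1 2(3) by (simp add: path_lap_def)
  next
    case 3
    have ne: "u' \<noteq> u" "u' \<noteq> v - 1" "u' \<noteq> v" "u \<noteq> v - 1" "u \<noteq> v" "v - 1 \<noteq> v"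
      using 3 uv v N by (auto simp: u'_def split: if_splits)
    have "Suc i < N - 1" using 3 v uv by auto
    then show ?thesis using tu tv1 tu' tv ne 3 by (simp add: path_lap_def One_nat_def)
  qed
  then show ?thesis using sum by (simp add: t_def D_def i_def)
qed

text \<open>The gap \<open>v - u - 1\<close> of two exclusion particles performs a symmetric walk reflected at both ends of
  \<open>{0..<N - 1}\<close>, so a bound on mixed differences by the gap is propagated by \<open>path_step\<close>.\<close>

definition pair_bound :: "nat \<Rightarrow> real \<Rightarrow> (nat \<Rightarrow> real) \<Rightarrow> (config \<Rightarrow> real) \<Rightarrow> bool" where
  "pair_bound N b q f \<longleftrightarrow>
     (\<forall>\<eta>\<in>configs N. \<forall>u v. u < v \<longrightarrow> v < N \<longrightarrow> \<bar>mixed_diff u v f \<eta>\<bar> \<le> b * q (v - u - 1))"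

lemma pair_boundD:
  assumes "pair_bound N b q f" "\<eta> \<in> configs N" "x < N" "y < N" "x \<noteq> y"
  shows "\<bar>mixed_diff x y f \<eta>\<bar> \<le> b * q (site_dist x y - 1)"
proof (cases "x < y")
  case True
  then show ?thesis using assms(1,2,4) unfolding pair_bound_def site_dist_def by simp
next
  case False
  then have "\<bar>mixed_diff y x f \<eta>\<bar> \<le> b * q (x - y - 1)"
    using assms unfolding pair_bound_def by (metis linorder_neqE_nat)
  then show ?thesis using False mixed_diff_commute[OF assms(5), of f \<eta>] by (simp add: site_dist_def)
qed

lemma mixed_diff_euler: "mixed_diff u v (euler N h f) \<eta> = (1 - h * real N ^ 3) * mixed_diff u v f \<eta>
    + h * (real N)\<^sup>2 * (\<Sum>b<N. mixed_diff (bond N b u) (bond N b v) f (\<eta> \<circ> bond N b))"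
  unfolding mixed_diff_def euler_convex bond_upd
  by (simp add: sum.distrib sum_subtractf algebra_simps)

text \<open>By duality the mixed difference after an Euler step is a combination, with nonnegative
  weights of sum 1, of mixed differences at the displaced pairs. Summing the bounds over the bonds
  with \<open>sum_bond_dist\<close> gives one step of the gap walk, whose size
  \<open>2 * h * N^2\<close> contains the factor 2 of the two moving particles.\<close>

lemma pair_bound_euler:
  assumes N: "3 \<le> N" and f: "pair_bound N b q f" and b: "0 \<le> b"
    and sym: "\<And>i. i < N - 1 \<Longrightarrow> q (N - 2 - i) = q i"
    and h: "0 \<le> h" "h * real N ^ 3 \<le> 1"
  shows "pair_bound N b (path_step (N - 1) (2 * h * (real N)\<^sup>2) q) (euler N h f)"
  unfolding pair_bound_def
proof (intro ballI allI impI)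
  fix \<eta> u v assume A: "\<eta> \<in> configs N" "u < v" "v < N"
  let ?d = "v - u - 1"
  have "\<bar>mixed_diff u v (euler N h f) \<eta>\<bar> \<le> \<bar>(1 - h * real N ^ 3) * mixed_diff u v f \<eta>\<bar>
      + \<bar>h * (real N)\<^sup>2 * (\<Sum>x<N. mixed_diff (bond N x u) (bond N x v) f (\<eta> \<circ> bond N x))\<bar>"
    unfolding mixed_diff_euler by (rule abs_triangle_ineq)
  also have "\<dots> = (1 - h * real N ^ 3) * \<bar>mixed_diff u v f \<eta>\<bar>
      + h * (real N)\<^sup>2 * \<bar>\<Sum>x<N. mixed_diff (bond N x u) (bond N x v) f (\<eta> \<circ> bond N x)\<bar>"
    using h by (simp add: abs_mult)
  also have "\<dots> \<le> (1 - h * real N ^ 3) * (b * q ?d)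
      + h * (real N)\<^sup>2 * (\<Sum>x<N. b * q (site_dist (bond N x u) (bond N x v) - 1))"
  proof (intro add_mono mult_left_mono)
    show "\<bar>mixed_diff u v f \<eta>\<bar> \<le> b * q ?d" using f A by (simp add: pair_bound_def)
    have "\<bar>\<Sum>x<N. mixed_diff (bond N x u) (bond N x v) f (\<eta> \<circ> bond N x)\<bar>
        \<le> (\<Sum>x<N. \<bar>mixed_diff (bond N x u) (bond N x v) f (\<eta> \<circ> bond N x)\<bar>)" by (rule sum_abs)
    also have "\<dots> \<le> (\<Sum>x<N. b * q (site_dist (bond N x u) (bond N x v) - 1))"
      using A by (intro sum_mono pair_boundD[OF f] configs_bond) (auto simp: bond_less_iff)
    finally show "\<bar>\<Sum>x<N. mixed_diff (bond N x u) (bond N x v) f (\<eta> \<circ> bond N x)\<bar>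
      \<le> (\<Sum>x<N. b * q (site_dist (bond N x u) (bond N x v) - 1))" .
  qed (use h in auto)
  also have "\<dots> = b * (q ?d + h * (real N)\<^sup>2 *
      (\<Sum>x<N. q (site_dist (bond N x u) (bond N x v) - 1) - q ?d))"
    unfolding sum_distrib_left[symmetric] sum_subtractf
    by (simp add: algebra_simps power2_eq_square power3_eq_cube)
  also have "\<dots> = b * path_step (N - 1) (2 * h * (real N)\<^sup>2) q ?d"
    using sum_bond_dist[where q = q, OF N A(2,3) sym] by (simp add: path_step_def)
  finally show "\<bar>mixed_diff u v (euler N h f) \<eta>\<bar> \<le> b * path_step (N - 1) (2 * h * (real N)\<^sup>2) q ?d" .
qed

lemma path_step_sym:
  assumes "\<And>i. i < N - 1 \<Longrightarrow> q (N - 2 - i) = q i" "i < N - 1"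
  shows "path_step (N - 1) a q (N - 2 - i) = path_step (N - 1) a q i"
proof -
  have 1: "Suc (N - 2 - i) < N - 1 \<longleftrightarrow> 0 < i" "0 < N - 2 - i \<longleftrightarrow> Suc i < N - 1" using assms(2) by auto
  have 2: "q (N - 2 - i) = q i" by (rule assms)+
  have 3: "q (Suc (N - 2 - i)) = q (i - 1)" if "0 < i"
  proof -
    have "Suc (N - 2 - i) = N - 2 - (i - 1)" "i - 1 < N - 1" using assms(2) that by auto
    then show ?thesis using assms(1)[of "i - 1"] by simp
  qed
  have 4: "q (N - 2 - i - 1) = q (Suc i)" if "Suc i < N - 1"
    using assms(1)[of "Suc i"] that by (simp add: One_nat_def)
  have "path_lap (N - 1) q (N - 2 - i) = path_lap (N - 1) q i"
    unfolding path_lap_def 1 2 using 3 4 by (cases "0 < i"; cases "Suc i < N - 1") (simp_all only: if_True if_False add.commute)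
  then show ?thesis by (simp only: path_step_def 2)
qed

section \<open>Weighted sums over neighbouring pairs: Lipschitz constants, mixed differences and
  their smearing\<close>

definition pair_sum :: "nat \<Rightarrow> (nat \<Rightarrow> real) \<Rightarrow> config \<Rightarrow> real" where
  "pair_sum N \<gamma> \<eta> = (\<Sum>x<N. \<gamma> x * (real (\<eta> x) * real (\<eta> ((x + 1) mod N))))"

text \<open>A site enters only two of the neighbouring products, one with each neighbour, hence
  \<open>2 * b\<close>.\<close>

lemma site_lipschitz_pair_sum:
  assumes N: "2 \<le> N" and \<gamma>: "\<And>x. x < N \<Longrightarrow> \<bar>\<gamma> x\<bar> \<le> b"
  shows "site_lipschitz N (2 * b) (pair_sum N \<gamma>)"
  unfolding site_lipschitz_def
proof (intro ballI allI impI)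
  fix \<eta> u and i :: nat assume A: "\<eta> \<in> configs N" "u < N" "i \<in> {0, 1}"
  let ?\<eta>' = "\<eta>(u := i)"
  let ?t = "\<lambda>x. \<gamma> x * (real (?\<eta>' x) * real (?\<eta>' ((x + 1) mod N)) - real (\<eta> x) * real (\<eta> ((x + 1) mod N)))"
  define u' where "u' = (if u = 0 then N - 1 else u - 1)"
  have u': "u' < N" using A by (auto simp: u'_def)
  have b0: "0 \<le> b" using \<gamma>[of u] A by linarith
  have z: "?t x = 0" if "x < N" "x \<notin> {u', u}" for x
  proof -
    have "(x + 1) mod N \<noteq> u" using that by (auto simp: u'_def mod_Suc One_nat_def split: if_splits)
    then have "?\<eta>' x = \<eta> x" "?\<eta>' ((x + 1) mod N) = \<eta> ((x + 1) mod N)" using that by auto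
    then show ?thesis by (simp only: diff_self mult_zero_right)
  qed
  have le: "\<bar>?t x\<bar> \<le> b" if "x < N" for x
  proof -
    have conf: "?\<eta>' \<in> configs N" using A by (intro configs_upd)
    have xN: "(x + 1) mod N < N" using N by simp
    have m: "\<zeta> y \<in> {0, 1}" if "\<zeta> \<in> configs N" "y < N" for \<zeta> y using configs_cases[OF that] by blast
    have "?\<eta>' x \<in> {0, 1}" "?\<eta>' ((x + 1) mod N) \<in> {0, 1}" "\<eta> x \<in> {0, 1}" "\<eta> ((x + 1) mod N) \<in> {0, 1}"
      by (rule m[OF conf that], rule m[OF conf xN], rule m[OF A(1) that], rule m[OF A(1) xN])
    moreover have "\<bar>real i1 * real i2 - real i3 * real i4\<bar> \<le> 1"
      if "i1 \<in> {0, 1}" "i2 \<in> {0, 1}" "i3 \<in> {0, 1}" "i4 \<in> {0, 1}" for i1 i2 i3 i4 :: nat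
      using that by auto
    ultimately have "\<bar>real (?\<eta>' x) * real (?\<eta>' ((x + 1) mod N)) - real (\<eta> x) * real (\<eta> ((x + 1) mod N))\<bar> \<le> 1"
      by blast
    then have "\<bar>\<gamma> x\<bar> * \<bar>real (?\<eta>' x) * real (?\<eta>' ((x + 1) mod N)) - real (\<eta> x) * real (\<eta> ((x + 1) mod N))\<bar> \<le> b * 1"
      by (intro mult_mono \<gamma> that b0 abs_ge_zero)
    then show ?thesis unfolding abs_mult by (simp only: mult_1_right)
  qed
  have "pair_sum N \<gamma> ?\<eta>' - pair_sum N \<gamma> \<eta> = (\<Sum>x<N. ?t x)"
    by (simp only: pair_sum_def sum_subtractf right_diff_distrib)
  moreover have "(\<Sum>x<N. ?t x) = (\<Sum>x\<in>{u', u}. ?t x)"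
    by (rule sum.mono_neutral_right) (use A u' in simp, use A u' in simp, use z in blast)
  ultimately have eq: "pair_sum N \<gamma> ?\<eta>' - pair_sum N \<gamma> \<eta> = (\<Sum>x\<in>{u', u}. ?t x)"
    by (rule trans)
  have "\<bar>\<Sum>x\<in>{u', u}. ?t x\<bar> \<le> (\<Sum>x\<in>{u', u}. \<bar>?t x\<bar>)" by (rule sum_abs)
  also have "\<dots> \<le> (\<Sum>x\<in>{u', u}. b)"
    by (rule sum_mono, rule le) (use A u' in blast)
  also have "\<dots> \<le> 2 * b" using b0 by (cases "u' = u") auto
  finally show "\<bar>pair_sum N \<gamma> ?\<eta>' - pair_sum N \<gamma> \<eta>\<bar> \<le> 2 * b" unfolding eq .
qed

text \<open>Mixed differences see only the product of exactly the two chosen sites, hence only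
  adjacent pairs; gap \<open>N - 2\<close> is the pair consisting of 0 and \<open>N - 1\<close>,
  adjacent through the closing bond.\<close>

lemma pair_bound_pair_sum:
  assumes N: "3 \<le> N" and \<gamma>: "\<And>x. x < N \<Longrightarrow> \<bar>\<gamma> x\<bar> \<le> b" and b: "0 \<le> b"
  shows "pair_bound N b (\<lambda>i. of_bool (i = 0 \<or> i = N - 2)) (pair_sum N \<gamma>)"
  unfolding pair_bound_def
proof (intro ballI allI impI)
  fix \<eta> u v assume A: "\<eta> \<in> configs N" "u < v" "v < N"
  define E where "E x \<longleftrightarrow> x = u \<and> (x + 1) mod N = v \<or> x = v \<and> (x + 1) mod N = u" for x
  have s: "(x + 1) mod N = (if x = N - 1 then 0 else x + 1)" if "x < N" for x
    using that by (auto simp: mod_Suc One_nat_def)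
  have eq: "mixed_diff u v (pair_sum N \<gamma>) \<eta> = (\<Sum>x<N. \<gamma> x * of_bool (E x))"
  proof -
  have "mixed_diff u v (pair_sum N \<gamma>) \<eta> = (\<Sum>x<N. \<gamma> x * mixed_diff u v (\<lambda>\<eta>. real (\<eta> x) * real (\<eta> ((x + 1) mod N))) \<eta>)"
    unfolding mixed_diff_def pair_sum_def by (simp add: sum.distrib sum_subtractf algebra_simps)
  also have "\<dots> = (\<Sum>x<N. \<gamma> x * of_bool (E x))"
  proof (intro sum.cong refl arg_cong2[where f = "(*)"])
    fix x assume "x \<in> {..<N}"
    then have "(x + 1) mod N \<noteq> x" using N by (auto simp: s)
    then show "mixed_diff u v (\<lambda>\<eta>. real (\<eta> x) * real (\<eta> ((x + 1) mod N))) \<eta> = of_bool (E x)"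
      using A unfolding mixed_diff_def E_def by auto
  qed
  finally show ?thesis .
  qed
  have "\<bar>\<Sum>x<N. \<gamma> x * of_bool (E x)\<bar> \<le> b * of_bool (v - u - 1 = 0 \<or> v - u - 1 = N - 2)"
  proof (cases "v = u + 1")
    case True
    then have "E x \<longleftrightarrow> x = u" if "x < N" for x using A N that by (auto simp: E_def s)
    then have "(\<Sum>x<N. \<gamma> x * of_bool (E x)) = (\<Sum>x\<in>{u}. \<gamma> x)"
      using A by (intro sum.mono_neutral_cong_right) auto
    then show ?thesis using \<gamma>[of u] A True by simp
  next
    case F: False
    show ?thesis
    proof (cases "u = 0 \<and> v = N - 1")
      case True
      then have "E x \<longleftrightarrow> x = v" if "x < N" for x using A N that by (auto simp: E_def s)
      then have "(\<Sum>x<N. \<gamma> x * of_bool (E x)) = (\<Sum>x\<in>{v}. \<gamma> x)"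
        using A by (intro sum.mono_neutral_cong_right) auto
      then show ?thesis using \<gamma>[of v] A True by (simp add: One_nat_def numeral_2_eq_2)
    next
      case False
      then have "\<not> E x" if "x < N" for x using A N that F by (auto simp: E_def s)
      then have "(\<Sum>x<N. \<gamma> x * of_bool (E x)) = 0" by (intro sum.neutral) auto
      then show ?thesis using b by simp
    qed
  qed
  then show "\<bar>mixed_diff u v (pair_sum N \<gamma>) \<eta>\<bar> \<le> b * of_bool (v - u - 1 = 0 \<or> v - u - 1 = N - 2)"
    unfolding eq .
qed

text \<open>The initial gap profile has values at most 1 and mass at most 2, so the gap walk
  flattens it below \<open>\<epsilon>\<close> after a diffusive time. The constant
  \<open>\<kappa>\<close> depends on \<open>\<epsilon>\<close> alone and serves all weights, kernels
  and large \<open>N\<close>; it has to be fixed before the exponential parameter.\<close>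

lemma pair_smearing:
  assumes \<epsilon>: "0 < \<epsilon>"
  shows "\<exists>\<kappa>>0. \<exists>N0. \<forall>N\<ge>N0. \<forall>K b \<gamma>. ssep_kernel N K \<longrightarrow> 0 \<le> b \<longrightarrow> (\<forall>x<N. \<bar>\<gamma> x\<bar> \<le> (b :: real)) \<longrightarrow>
     mixed_diff_le N (b * \<epsilon>) (kernel_op K (\<kappa> / (real N)\<^sup>2) (pair_sum N \<gamma>))"
proof -
  obtain k :: nat where "4 / \<epsilon> < real k" using reals_Archimedean2 by blast
  moreover have "0 < 4 / \<epsilon>" using \<epsilon> by simp
  ultimately have k: "0 < k" "4 \<le> \<epsilon> * real k" using \<epsilon> by (auto simp: field_simps intro: Suc_leI gr0I)
  \<comment> \<open>The window length \<open>k\<close> satisfies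
    \<open>4 \<le> \<epsilon> * k\<close>. Over time \<open>\<kappa> / N^2\<close> the total size of
    the gap steps is \<open>n * a = 2 * \<kappa>\<close>, and
    \<open>2 * \<kappa> * \<epsilon>^2 = 16 * k\<close> exceeds the \<open>8 * k\<close> required by
    \<open>path_step_nash\<close>.\<close>
  define \<kappa> where "\<kappa> = 8 * real k / \<epsilon>\<^sup>2"
  have \<kappa>: "0 < \<kappa>" using \<epsilon> k by (simp add: \<kappa>_def)
  show ?thesis
  proof (intro exI[of _ \<kappa>] conjI \<kappa> exI[of _ "k + 3"] allI impI)
    fix N :: nat and K and b :: real and \<gamma> :: "nat \<Rightarrow> real" assume kN: "k + 3 \<le> N" and K: "ssep_kernel N K" and b: "0 \<le> b" and \<gamma>: "\<forall>x<N. \<bar>\<gamma> x\<bar> \<le> b"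
    interpret ssep_kernel N K by (rule K)
    define \<tau> where "\<tau> = \<kappa> / (real N)\<^sup>2"
    have \<tau>: "0 < \<tau>" using \<kappa> kN by (simp add: \<tau>_def)
    define q :: "nat \<Rightarrow> real" where "q i = of_bool (i = 0 \<or> i = N - 2)" for i
    have symq: "q (N - 2 - i) = q i" if "i < N - 1" for i using that by (auto simp: q_def)
    \<comment> \<open>The symmetry of the profile is carried through the induction together with the
      bound, because every Euler step uses it.\<close>
    have it: "pair_bound N b ((path_step (N - 1) (2 * h * (real N)\<^sup>2) ^^ n) q) ((euler N h ^^ n) (pair_sum N \<gamma>))
       \<and> (\<forall>i<N - 1. (path_step (N - 1) (2 * h * (real N)\<^sup>2) ^^ n) q (N - 2 - i) = (path_step (N - 1) (2 * h * (real N)\<^sup>2) ^^ n) q i)"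
      if h: "0 \<le> h" "h * real N ^ 3 \<le> 1" for h n
    proof (induction n)
      case 0
      show ?case using pair_bound_pair_sum[OF _ _ b, of N \<gamma>] \<gamma> N symq by (simp add: q_def[abs_def])
    next
      case (Suc n)
      then show ?case using pair_bound_euler[OF _ _ b _ h] path_step_sym N by simp
    qed
    have sumq: "(\<Sum>i<N - 1. q i) \<le> 2"
    proof -
      have "(\<Sum>i<N - 1. q i) \<le> (\<Sum>i<N - 1. of_bool (i = 0) + of_bool (i = N - 2))"
        by (intro sum_mono) (auto simp: q_def)
      also have "\<dots> \<le> 2" using N by (simp add: sum.distrib of_bool_def sum.delta)
      finally show ?thesis .
    qed
    show "mixed_diff_le N (b * \<epsilon>) (kernel_op K (\<kappa> / (real N)\<^sup>2) (pair_sum N \<gamma>))"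
      unfolding mixed_diff_le_def \<tau>_def[symmetric]
    proof (intro ballI allI impI)
      fix \<eta> u v assume A: "\<eta> \<in> configs N" "u < N" "v < N" "u \<noteq> v"
      have lim: "(\<lambda>n. \<bar>mixed_diff u v ((euler N (\<tau> / real n) ^^ n) (pair_sum N \<gamma>)) \<eta>\<bar>)
          \<longlonglongrightarrow> \<bar>mixed_diff u v (P \<tau> (pair_sum N \<gamma>)) \<eta>\<bar>"
        using A by (intro tendsto_intros mixed_diff_tendsto euler_tendsto \<tau>)
      have "(\<lambda>n. \<tau> / real n) \<longlonglongrightarrow> 0" by (rule lim_const_over_n)
      then have l: "(\<lambda>n. \<tau> / real n * real N ^ 3) \<longlonglongrightarrow> 0 * real N ^ 3" "(\<lambda>n. 2 * (\<tau> / real n) * (real N)\<^sup>2) \<longlonglongrightarrow> 2 * 0 * (real N)\<^sup>2"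
        by (intro tendsto_intros; simp)+
      have ev: "\<forall>\<^sub>F n in sequentially. \<tau> / real n * real N ^ 3 < 1"
        "\<forall>\<^sub>F n in sequentially. 2 * (\<tau> / real n) * (real N)\<^sup>2 < 1 / 4"
        using order_tendstoD(2)[OF l(1), of 1] order_tendstoD(2)[OF l(2), of "1 / 4"] by simp_all
      show "\<bar>mixed_diff u v (P \<tau> (pair_sum N \<gamma>)) \<eta>\<bar> \<le> b * \<epsilon>"
      proof (rule tendsto_upperbound[OF lim])
        show "\<forall>\<^sub>F n in sequentially. \<bar>mixed_diff u v ((euler N (\<tau> / real n) ^^ n) (pair_sum N \<gamma>)) \<eta>\<bar> \<le> b * \<epsilon>"
          using ev eventually_gt_at_top[of 0]
        proof eventually_elim
          case (elim n)
          let ?a = "2 * (\<tau> / real n) * (real N)\<^sup>2"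
          have na: "real n * ?a = 2 * \<kappa>" using elim N by (simp add: \<tau>_def)
          have "\<bar>mixed_diff u v ((euler N (\<tau> / real n) ^^ n) (pair_sum N \<gamma>)) \<eta>\<bar>
             \<le> b * (path_step (N - 1) ?a ^^ n) q (site_dist u v - 1)"
            using it[of "\<tau> / real n" n] elim \<tau>
            by (intro pair_boundD[OF _ A(1) A(2) A(3) A(4)]) auto
          also have "\<dots> \<le> b * \<epsilon>"
          proof (intro mult_left_mono b path_step_nash[where k = k])
            show "8 * real k < real n * ?a * \<epsilon>\<^sup>2" unfolding na using k \<epsilon> by (simp add: \<kappa>_def)
            show "site_dist u v - 1 < N - 1" using A by (auto simp: site_dist_def)
          qed (use elim \<tau> kN k \<epsilon> sumq in \<open>auto simp: q_def\<close>)
          finally show ?case .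
        qed
      qed simp
    qed
  qed
qed

section \<open>Exponential moments at a fixed time\<close>

lemma prodE_pair: 
  assumes "x < N" "y < N" "x \<noteq> y"
  shows "prodE N \<rho> (\<lambda>\<eta>. real (\<eta> x) * real (\<eta> y)) = \<rho> x * \<rho> y"
proof -
  have "prodE N \<rho> (\<lambda>\<eta>. real (\<eta> x) * real (\<eta> y)) =
    prodE N \<rho> (site_avg x (\<rho> x) (site_avg y (\<rho> y) (\<lambda>\<eta>. real (\<eta> x) * real (\<eta> y))))"
    using assms by (simp add: prodE_site_avg)
  also have "site_avg x (\<rho> x) (site_avg y (\<rho> y) (\<lambda>\<eta>. real (\<eta> x) * real (\<eta> y))) = (\<lambda>_. \<rho> x * \<rho> y)"
    using assms by (auto simp: site_avg_def fun_eq_iff)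
  finally show ?thesis by simp
qed

lemma prodE_pair_sum:
  assumes "2 \<le> N"
  shows "prodE N \<rho> (pair_sum N \<gamma>) = (\<Sum>x<N. \<gamma> x * (\<rho> x * \<rho> ((x + 1) mod N)))"
proof -
  have "prodE N \<rho> (\<lambda>\<eta>. \<gamma> x * (real (\<eta> x) * real (\<eta> ((x + 1) mod N)))) = \<gamma> x * (\<rho> x * \<rho> ((x + 1) mod N))"
    if "x < N" for x
    unfolding prodE_cmult using that assms by (subst prodE_pair) (auto simp: succ_mod)
  then show ?thesis unfolding pair_sum_def[abs_def] prodE_sum by (intro sum.cong) auto
qed

lemma mixed_diff_le_pair_sum:
  assumes "3 \<le> N" "\<And>x. x < N \<Longrightarrow> \<bar>\<gamma> x\<bar> \<le> b" "0 \<le> b"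
  shows "mixed_diff_le N b (pair_sum N \<gamma>)"
  unfolding mixed_diff_le_def
proof (intro ballI allI impI)
  fix \<eta> u v assume A: "\<eta> \<in> configs N" "u < N" "v < N" "u \<noteq> v"
  have "\<bar>mixed_diff u v (pair_sum N \<gamma>) \<eta>\<bar> \<le> b * of_bool (site_dist u v - 1 = 0 \<or> site_dist u v - 1 = N - 2)"
    by (rule pair_boundD[OF pair_bound_pair_sum[OF assms] A])
  also have "\<dots> \<le> b" using assms(3) by simp
  finally show "\<bar>mixed_diff u v (pair_sum N \<gamma>) \<eta>\<bar> \<le> b" .
qed

lemma energy_diff_le:
  assumes "unit_density N \<rho>" "unit_density N \<rho>'" "\<And>x. x < N \<Longrightarrow> \<bar>\<rho> x - \<rho>' x\<bar> \<le> D"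
  shows "energy N \<rho> - energy N \<rho>' \<le> 2 * real N * D"
proof -
  have "energy N \<rho> - energy N \<rho>' = (\<Sum>x<N. (\<rho> x)\<^sup>2 - (\<rho>' x)\<^sup>2)"
    by (simp add: energy_def sum_subtractf)
  also have "\<dots> \<le> (\<Sum>x<N. 2 * D)"
  proof (rule sum_mono)
    fix x assume x: "x \<in> {..<N}"
    then have b: "0 \<le> \<rho> x" "\<rho> x \<le> 1" "0 \<le> \<rho>' x" "\<rho>' x \<le> 1" "\<bar>\<rho> x - \<rho>' x\<bar> \<le> D"
      using assms by (auto simp: unit_density_def)
    have "(\<rho> x)\<^sup>2 - (\<rho>' x)\<^sup>2 = (\<rho> x - \<rho>' x) * (\<rho> x + \<rho>' x)" by (simp add: power2_eq_square algebra_simps)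
    also have "\<dots> \<le> \<bar>\<rho> x - \<rho>' x\<bar> * (\<rho> x + \<rho>' x)" using b by (intro mult_right_mono) auto
    also have "\<dots> \<le> D * 2" using b by (intro mult_mono) auto
    finally show "(\<rho> x)\<^sup>2 - (\<rho>' x)\<^sup>2 \<le> 2 * D" by simp
  qed
  finally show ?thesis by simp
qed

lemma energy_le:
  assumes "unit_density N \<rho>" shows "0 \<le> energy N \<rho>" "energy N \<rho> \<le> real N"
proof -
  show "0 \<le> energy N \<rho>" by (auto simp: energy_def intro: sum_nonneg)
  have "energy N \<rho> \<le> (\<Sum>x<N. 1)"
    using assms unfolding energy_def unit_density_def by (intro sum_mono power_le_one) auto
  then show "energy N \<rho> \<le> real N" by simp
qed

context ssep_kernel
begin

lemma P_mono:
  assumes "0 \<le> t" "\<And>\<eta>. \<eta> \<in> configs N \<Longrightarrow> f \<eta> \<le> g \<eta>" "\<eta> \<in> configs N"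
  shows "P t f \<eta> \<le> P t g \<eta>"
  using assms by (intro markov_op_mono[OF markov_op_kernel[OF finite_configs K]])

lemma P_cmult: "0 \<le> t \<Longrightarrow> \<eta> \<in> configs N \<Longrightarrow> P t (\<lambda>\<eta>. a * f \<eta>) \<eta> = a * P t f \<eta>"
  by (rule markov_op_cmult[OF markov_op_kernel[OF finite_configs K]])

text \<open>Four costs add up, with \<open>c = 2 * b\<close>. Moving the exponential outside the
  last time span \<open>\<tau>\<close> costs \<open>16 * b^2 * \<tau> * N^3\<close>. Passing to the
  product law at \<open>t - \<tau>\<close> costs \<open>\<theta> / 2\<close> times an energy drop of
  at most \<open>N\<close>, that is \<open>N * (24 * b^2 + 9 * b * \<epsilon>)\<close>.
  Concentration under that product law costs \<open>4 * b^2 * N\<close>. Returning from the smeared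
  observable to the pair sum at time \<open>t\<close> costs \<open>b * N * D\<close>.\<close>

lemma exp_moment:
  assumes \<rho>: "unit_density N \<rho>" and \<tau>: "0 < \<tau>" "\<tau> < t"
    and b: "0 \<le> b" "b \<le> 1 / 4" and \<gamma>: "\<And>x. x < N \<Longrightarrow> \<bar>\<gamma> x\<bar> \<le> b"
    and smear: "mixed_diff_le N (b * \<epsilon>) (P \<tau> (pair_sum N \<gamma>))" and \<epsilon>: "0 \<le> \<epsilon>" "\<epsilon> \<le> 1"
    and D: "\<And>x. x < N \<Longrightarrow> \<bar>mean_density (t - \<tau>) \<rho> x - mean_density t \<rho> x\<bar> \<le> D"
  shows "prodE N \<rho> (P t (\<lambda>\<eta>. exp (pair_sum N \<gamma> \<eta>))) \<le>
    exp (prodE N (mean_density t \<rho>) (pair_sum N \<gamma>)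
      + (16 * b\<^sup>2 * (\<tau> * real N ^ 3) + real N * (28 * b\<^sup>2 + 9 * b * \<epsilon> + b * D)))"
proof -
  let ?g = "pair_sum N \<gamma>" and ?s = "t - \<tau>"
  let ?Q = "P \<tau> ?g" and ?r = "mean_density (t - \<tau>) \<rho>"
  define c where "c = 2 * b"
  define \<theta> where "\<theta> = 12 * c\<^sup>2 + 18 * (b * \<epsilon>)"
  define A where "A = \<tau> * real N ^ 3 * (2 * c)\<^sup>2"
  have s: "0 < ?s" using \<tau> by simp
  have r: "unit_density N ?r" by (rule unit_density_mean_density[OF s \<rho>])
  have be: "0 \<le> b * \<epsilon>" "b * \<epsilon> \<le> 1" using b \<epsilon> mult_mono[of b 1 \<epsilon> 1] by auto
  have site_lipschitz: "site_lipschitz N c ?g" unfolding c_def using N by (intro site_lipschitz_pair_sum \<gamma>) auto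
  have lipQ: "site_lipschitz N c ?Q" by (rule site_lipschitz_P[OF site_lipschitz \<tau>(1)])
  have mixed_diff: "mixed_diff_dominated N \<theta> (\<lambda>\<eta>. exp (?Q \<eta>))"
    unfolding \<theta>_def using b be by (intro mixed_diff_dominated_exp lipQ smear) (auto simp: c_def)
  have \<theta>: "0 \<le> \<theta>" using be by (simp add: \<theta>_def)
  have "prodE N \<rho> (P t (\<lambda>\<eta>. exp (?g \<eta>))) = prodE N \<rho> (P ?s (P \<tau> (\<lambda>\<eta>. exp (?g \<eta>))))"
    using kernel_op_add[OF finite_configs K, of ?s \<tau>] s \<tau> by (intro prodE_cong) auto
  also have "\<dots> \<le> prodE N \<rho> (\<lambda>\<eta>. exp A * P ?s (\<lambda>\<eta>. exp (?Q \<eta>)) \<eta>)"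
  proof (rule prodE_mono)
    fix \<eta> assume \<eta>: "\<eta> \<in> configs N"
    have "P ?s (P \<tau> (\<lambda>\<eta>. exp (?g \<eta>))) \<eta> \<le> P ?s (\<lambda>\<eta>. exp A * exp (?Q \<eta>)) \<eta>"
    proof (rule P_mono[OF _ _ \<eta>])
      fix \<zeta> assume "\<zeta> \<in> configs N"
      from P_exp_le[OF site_lipschitz _ \<tau>(1) this] show "P \<tau> (\<lambda>\<eta>. exp (?g \<eta>)) \<zeta> \<le> exp A * exp (?Q \<zeta>)"
        using b by (simp add: A_def c_def mult.commute flip: exp_add)
    qed (use s in simp)
    also have "\<dots> = exp A * P ?s (\<lambda>\<eta>. exp (?Q \<eta>)) \<eta>" using s \<eta> by (simp add: P_cmult)
    finally show "P ?s (P \<tau> (\<lambda>\<eta>. exp (?g \<eta>))) \<eta> \<le> exp A * P ?s (\<lambda>\<eta>. exp (?Q \<eta>)) \<eta>" .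
  qed (use \<rho> in \<open>auto simp: unit_density_def\<close>)
  also have "\<dots> = exp A * prodE N \<rho> (P ?s (\<lambda>\<eta>. exp (?Q \<eta>)))" by (rule prodE_cmult)
  also have "\<dots> \<le> exp A * (exp (\<theta> / 2 * (energy N \<rho> - energy N ?r)) * prodE N ?r (\<lambda>\<eta>. exp (?Q \<eta>)))"
    by (intro mult_left_mono prodE_P_le[OF s \<rho> mixed_diff \<theta>]) auto
  also have "\<dots> \<le> exp A * (exp (\<theta> / 2 * real N) * exp (prodE N ?r ?Q + real N * c\<^sup>2))"
  proof (intro mult_left_mono mult_mono)
    show "prodE N ?r (\<lambda>\<eta>. exp (?Q \<eta>)) \<le> exp (prodE N ?r ?Q + real N * c\<^sup>2)"
      using b by (intro prodE_exp_le r lipQ) (auto simp: c_def)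
    have "energy N \<rho> - energy N ?r \<le> real N" using energy_le[OF \<rho>] energy_le[OF r] by linarith
    then show "exp (\<theta> / 2 * (energy N \<rho> - energy N ?r)) \<le> exp (\<theta> / 2 * real N)"
      using \<theta> by (simp add: mult_left_mono)
    show "0 \<le> prodE N ?r (\<lambda>\<eta>. exp (?Q \<eta>))" using r by (intro prodE_nonneg) (auto simp: unit_density_def)
  qed auto
  also have "\<dots> = exp (prodE N ?r ?Q + (A + \<theta> / 2 * real N + real N * c\<^sup>2))"
    by (simp add: algebra_simps flip: exp_add)
  also have "\<dots> \<le> exp (prodE N (mean_density t \<rho>) ?g + (16 * b\<^sup>2 * (\<tau> * real N ^ 3)
      + real N * (28 * b\<^sup>2 + 9 * b * \<epsilon> + b * D)))"
  proof -
    have dg: "mixed_diff_le N b ?g" by (rule mixed_diff_le_pair_sum[OF N]) (use \<gamma> b in auto)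
    have same: "mean_density \<tau> ?r x = mean_density t \<rho> x" if "x < N" for x
      using mean_density_add[OF s \<tau>(1) \<rho> that] by simp
    \<comment> \<open>Here the unsmeared pair sum has mixed differences of order \<open>b\<close>,
      so an energy drop of order \<open>N\<close> would be too expensive. The drop is taken only
      over the short span from \<open>t - \<tau>\<close> to \<open>t\<close>, where it is at most
      \<open>2 * N * D\<close>.\<close>
    have "prodE N ?r ?Q \<le> prodE N (mean_density \<tau> ?r) ?g + b / 2 * (energy N ?r - energy N (mean_density \<tau> ?r))"
      using abs_le_D1[OF prodE_P_additive[OF \<tau>(1) r dg]] by linarith
    also have "prodE N (mean_density \<tau> ?r) ?g = prodE N (mean_density t \<rho>) ?g"
      by (rule prodE_density_irrelevant) (simp add: same)
    also have "b / 2 * (energy N ?r - energy N (mean_density \<tau> ?r)) \<le> b / 2 * (2 * real N * D)"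
      using b D same by (intro mult_left_mono energy_diff_le r unit_density_mean_density \<tau>) auto
    finally have "prodE N ?r ?Q \<le> prodE N (mean_density t \<rho>) ?g + b * real N * D" by simp
    moreover have "A + \<theta> / 2 * real N + real N * c\<^sup>2 =
        16 * b\<^sup>2 * (\<tau> * real N ^ 3) + real N * (28 * b\<^sup>2 + 9 * b * \<epsilon>)"
      by (simp add: A_def \<theta>_def c_def power2_eq_square algebra_simps)
    ultimately show ?thesis by (simp add: algebra_simps)
  qed
  finally show ?thesis .
qed

text \<open>The exponential of an absolute value is at most the sum of the two one-sided
  exponentials. Both are pair sums, with weights \<open>\<gamma>\<close> and their negatives, so the
  smearing hypothesis is stated for every weight bounded by \<open>b\<close>.\<close>

lemma exp_abs_moment:
  assumes \<rho>: "unit_density N \<rho>" and \<tau>: "0 < \<tau>" "\<tau> < t"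
    and b: "0 \<le> b" "b \<le> 1 / 4" and \<gamma>: "\<And>x. x < N \<Longrightarrow> \<bar>\<gamma> x\<bar> \<le> b"
    and smear: "\<And>\<gamma>. (\<And>x. x < N \<Longrightarrow> \<bar>\<gamma> x\<bar> \<le> b) \<Longrightarrow> mixed_diff_le N (b * \<epsilon>) (P \<tau> (pair_sum N \<gamma>))"
    and \<epsilon>: "0 \<le> \<epsilon>" "\<epsilon> \<le> 1"
    and D: "\<And>x. x < N \<Longrightarrow> \<bar>mean_density (t - \<tau>) \<rho> x - mean_density t \<rho> x\<bar> \<le> D"
    and m: "\<bar>(\<Sum>x<N. \<gamma> x * (mean_density t \<rho> x * mean_density t \<rho> ((x + 1) mod N))) - m\<bar> \<le> E"
  shows "prodE N \<rho> (P t (\<lambda>\<eta>. exp \<bar>pair_sum N \<gamma> \<eta> - m\<bar>)) \<le>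
    2 * exp (E + (16 * b\<^sup>2 * (\<tau> * real N ^ 3) + real N * (28 * b\<^sup>2 + 9 * b * \<epsilon> + b * D)))"
proof -
  let ?R = "16 * b\<^sup>2 * (\<tau> * real N ^ 3) + real N * (28 * b\<^sup>2 + 9 * b * \<epsilon> + b * D)"
  let ?m = "\<Sum>x<N. \<gamma> x * (mean_density t \<rho> x * mean_density t \<rho> ((x + 1) mod N))"
  have t: "0 < t" using \<tau> by simp
  have neg: "pair_sum N (\<lambda>x. - \<gamma> x) \<eta> = - pair_sum N \<gamma> \<eta>" for \<eta>
    by (simp add: pair_sum_def sum_negf)
  have N2: "2 \<le> N" using N by simp
  have 1: "prodE N \<rho> (P t (\<lambda>\<eta>. exp (pair_sum N \<gamma> \<eta>))) \<le> exp (?m + ?R)"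
    using exp_moment[OF \<rho> \<tau> b \<gamma> smear[OF \<gamma>] \<epsilon> D] unfolding prodE_pair_sum[OF N2] .
  have 2: "prodE N \<rho> (P t (\<lambda>\<eta>. exp (- pair_sum N \<gamma> \<eta>))) \<le> exp (- ?m + ?R)"
    using exp_moment[OF \<rho> \<tau> b, of "\<lambda>x. - \<gamma> x" \<epsilon> D] smear[of "\<lambda>x. - \<gamma> x"] \<gamma> \<epsilon> D
    unfolding prodE_pair_sum[OF N2] neg by (simp add: sum_negf)
  have "prodE N \<rho> (P t (\<lambda>\<eta>. exp \<bar>pair_sum N \<gamma> \<eta> - m\<bar>)) \<le>
      prodE N \<rho> (\<lambda>\<eta>. exp (- m) * P t (\<lambda>\<eta>. exp (pair_sum N \<gamma> \<eta>)) \<eta> + exp m * P t (\<lambda>\<eta>. exp (- pair_sum N \<gamma> \<eta>)) \<eta>)"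
  proof (rule prodE_mono)
    fix \<eta> assume \<eta>: "\<eta> \<in> configs N"
    have "exp \<bar>y - m\<bar> \<le> exp (- m) * exp y + exp m * exp (- y)" for y
      by (cases "y \<ge> m") (simp_all add: abs_if flip: exp_add)
    then have "P t (\<lambda>\<eta>. exp \<bar>pair_sum N \<gamma> \<eta> - m\<bar>) \<eta> \<le>
        P t (\<lambda>\<eta>. exp (- m) * exp (pair_sum N \<gamma> \<eta>) + exp m * exp (- pair_sum N \<gamma> \<eta>)) \<eta>"
      using t by (intro P_mono \<eta>) auto
    also have "\<dots> = exp (- m) * P t (\<lambda>\<eta>. exp (pair_sum N \<gamma> \<eta>)) \<eta> + exp m * P t (\<lambda>\<eta>. exp (- pair_sum N \<gamma> \<eta>)) \<eta>"
      using markov_op_lin[OF markov_op_kernel[OF finite_configs K], of t \<eta> "exp (- m)"] t \<eta>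
      by (simp add: P_cmult)
    finally show "P t (\<lambda>\<eta>. exp \<bar>pair_sum N \<gamma> \<eta> - m\<bar>) \<eta> \<le>
      exp (- m) * P t (\<lambda>\<eta>. exp (pair_sum N \<gamma> \<eta>)) \<eta> + exp m * P t (\<lambda>\<eta>. exp (- pair_sum N \<gamma> \<eta>)) \<eta>" .
  qed (use \<rho> in \<open>auto simp: unit_density_def\<close>)
  also have "\<dots> = exp (- m) * prodE N \<rho> (P t (\<lambda>\<eta>. exp (pair_sum N \<gamma> \<eta>)))
      + exp m * prodE N \<rho> (P t (\<lambda>\<eta>. exp (- pair_sum N \<gamma> \<eta>)))"
    by (simp add: prodE_lin prodE_cmult)
  also have "\<dots> \<le> exp (- m) * exp (?m + ?R) + exp m * exp (- ?m + ?R)"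
    by (intro add_mono mult_left_mono 1 2) auto
  also have "\<dots> = exp (?m - m + ?R) + exp (m - ?m + ?R)"
    by (simp add: algebra_simps flip: exp_add)
  also have "\<dots> \<le> exp (E + ?R) + exp (E + ?R)" using m by (intro add_mono) auto
  finally show ?thesis by simp
qed

end

section \<open>One-time laws of the process\<close>

definition site_weight :: "real \<Rightarrow> nat \<Rightarrow> real" where
  "site_weight r i = (if i = 1 then r else 1 - r)"

lemma configs_Suc:
  "configs (Suc N) = (\<lambda>\<xi>. \<xi>(N := 0)) ` configs N \<union> (\<lambda>\<xi>. \<xi>(N := 1)) ` configs N"
proof (intro equalityI subsetI)
  fix \<xi> assume \<xi>: "\<xi> \<in> configs (Suc N)"
  then have c: "\<xi>(N := undefined) \<in> configs N" by (auto simp: configs_def PiE_iff extensional_def)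
  have "\<xi> N = 0 \<or> \<xi> N = 1" by (rule configs_cases[OF \<xi>]) simp
  then have "\<xi> = (\<xi>(N := undefined))(N := 0) \<or> \<xi> = (\<xi>(N := undefined))(N := 1)"
    by (metis fun_upd_triv fun_upd_upd)
  then show "\<xi> \<in> (\<lambda>\<xi>. \<xi>(N := 0)) ` configs N \<union> (\<lambda>\<xi>. \<xi>(N := 1)) ` configs N"
    using c by blast
qed (auto intro: configs_Suc_upd)

lemma prodE_eq_sum:
  "prodE N \<rho> h = (\<Sum>\<xi>\<in>configs N. h \<xi> * (\<Prod>x<N. site_weight (\<rho> x) (\<xi> x)))"
proof (induction N arbitrary: h)
  case 0 then show ?case by (simp add: configs_def)
next
  case (Suc N)
  let ?F = "\<lambda>\<xi>. h \<xi> * (\<Prod>x<Suc N. site_weight (\<rho> x) (\<xi> x))"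
  have inj: "inj_on (\<lambda>\<xi>. \<xi>(N := i)) (configs N)" for i
  proof (rule inj_onI)
    fix \<xi> \<xi>' assume A: "\<xi> \<in> configs N" "\<xi>' \<in> configs N" "\<xi>(N := i) = \<xi>'(N := i)"
    then have "\<xi> N = undefined" "\<xi>' N = undefined" by (auto simp: configs_def PiE_iff extensional_def)
    then show "\<xi> = \<xi>'" using A(3) by (metis fun_upd_triv fun_upd_upd)
  qed
  have disj: "(\<lambda>\<xi>. \<xi>(N := 0)) ` configs N \<inter> (\<lambda>\<xi>. \<xi>(N := 1)) ` configs N = {}"
    by (auto dest: fun_cong[of _ _ N])
  have w: "(\<Prod>x<N. site_weight (\<rho> x) ((\<xi>(N := i)) x)) = (\<Prod>x<N. site_weight (\<rho> x) (\<xi> x))" for \<xi> i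
    by (intro prod.cong) auto
  have "(\<Sum>\<xi>\<in>configs (Suc N). ?F \<xi>) = (\<Sum>\<xi>\<in>configs N. ?F (\<xi>(N := 0))) + (\<Sum>\<xi>\<in>configs N. ?F (\<xi>(N := 1)))"
    unfolding configs_Suc using disj inj
    by (subst sum.union_disjoint) (simp_all add: sum.reindex)
  also have "\<dots> = (\<Sum>\<xi>\<in>configs N. site_avg N (\<rho> N) h \<xi> * (\<Prod>x<N. site_weight (\<rho> x) (\<xi> x)))"
    unfolding sum.distrib[symmetric] prod.lessThan_Suc w site_avg_def site_weight_def
    by (intro sum.cong) (auto simp: algebra_simps)
  finally show ?case unfolding prodE_Suc Suc.IH by simp
qed

text \<open>Integrating the Markov property relative to the filtration at time 0 removes the
  conditional expectation and leaves the kernel averaged over the initial law, which independence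
  and the marginals identify as a product law.\<close>

lemma ssep_one_time_law:
  assumes N: "3 \<le> N" and X: "ssep_from_product N \<phi> M X"
  shows "\<exists>K. ssep_kernel N K \<and> (\<forall>t\<ge>0. \<forall>f.
     (\<integral>\<omega>. f (X t \<omega>) \<partial>M) = prodE N (\<lambda>x. \<phi> (real x / real N)) (kernel_op K t f))"
proof -
  let ?S = "configs N"
  have M: "prob_space M" and meas: "\<And>t. 0 \<le> t \<Longrightarrow> X t \<in> measurable M (count_space ?S)"
    using X by (auto simp: ssep_from_product_def markov_process_with_generator_def)
  obtain K where K: "markov_semigroup ?S K" "has_generator ?S K (ssep_generator N)"
    and ce: "\<And>s t f. 0 \<le> s \<Longrightarrow> 0 \<le> t \<Longrightarrow> AE \<omega> in M.
           real_cond_exp M (natural_filtration M X s) (\<lambda>\<omega>'. f (X (s + t) \<omega>')) \<omega> =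
           measure_pmf.expectation (K t (X s \<omega>)) f"
    using X unfolding ssep_from_product_def markov_process_with_generator_def by blast
  interpret prob_space M by (rule M)
  have XS: "X t \<omega> \<in> ?S" if "0 \<le> t" "\<omega> \<in> space M" for t \<omega>
    using measurable_space[OF meas[OF that(1)] that(2)] by simp
  have fm: "(\<lambda>\<omega>. f (X t \<omega>)) \<in> borel_measurable M" if "0 \<le> t" for f :: "config \<Rightarrow> real" and t
    by (rule measurable_compose[OF meas[OF that]]) simp
  have fi: "integrable M (\<lambda>\<omega>. f (X t \<omega>))" if "0 \<le> t" for f :: "config \<Rightarrow> real" and t
  proof (rule integrable_const_bound[where B = "\<Sum>\<xi>\<in>?S. \<bar>f \<xi>\<bar>"])
    show "AE \<omega> in M. norm (f (X t \<omega>)) \<le> (\<Sum>\<xi>\<in>?S. \<bar>f \<xi>\<bar>)"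
      using XS[OF that] by (intro AE_I2) (auto intro!: member_le_sum)
  qed (rule fm[OF that])
  have sub: "subalgebra M (natural_filtration M X 0)"
    unfolding subalgebra_def natural_filtration_def
  proof
    show "space (sigma (space M) {X s -` A \<inter> space M |s A. 0 \<le> s \<and> s \<le> 0}) = space M"
      by (rule space_measure_of) auto
    \<comment> \<open>The filtration admits arbitrary sets of states. Since the process takes values
      in \<open>configs N\<close>, such a set can first be intersected with this state space, whose
      subsets are all measurable.\<close>
    have "X s -` A \<inter> space M \<in> sets M" if "0 \<le> s" for s A
    proof -
      have "X s -` A \<inter> space M = X s -` (A \<inter> ?S) \<inter> space M" using XS[OF that] by auto
      then show ?thesis using measurable_sets[OF meas[OF that], of "A \<inter> ?S"] by simp
    qed
    then have "{X s -` A \<inter> space M |s A. 0 \<le> s \<and> s \<le> 0} \<subseteq> sets M" by blast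
    then have "sigma_sets (space M) {X s -` A \<inter> space M |s A. 0 \<le> s \<and> s \<le> 0} \<subseteq> sets M"
      by (rule sets.sigma_sets_subset)
    then show "sets (sigma (space M) {X s -` A \<inter> space M |s A. 0 \<le> s \<and> s \<le> 0}) \<subseteq> sets M"
      by (subst sets_measure_of) auto
  qed
  interpret finite_measure_subalgebra M "natural_filtration M X 0"
    by unfold_locales (rule sub)
  have one: "(\<integral>\<omega>. f (X t \<omega>) \<partial>M) = (\<integral>\<omega>. kernel_op K t f (X 0 \<omega>) \<partial>M)" if t: "0 \<le> t" for t f
  proof -
    have "(\<integral>\<omega>. f (X t \<omega>) \<partial>M) = (\<integral>\<omega>. real_cond_exp M (natural_filtration M X 0) (\<lambda>\<omega>. f (X t \<omega>)) \<omega> \<partial>M)"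
      by (rule real_cond_exp_int(2)[symmetric]) (rule fi[OF t])
    also have "\<dots> = (\<integral>\<omega>. kernel_op K t f (X 0 \<omega>) \<partial>M)"
      using ce[of 0 t f] t fm[of 0] by (intro integral_cong_AE) (auto simp: kernel_op_def)
    finally show ?thesis .
  qed
  have two: "(\<integral>\<omega>. h (X 0 \<omega>) \<partial>M) = prodE N (\<lambda>x. \<phi> (real x / real N)) h" for h :: "config \<Rightarrow> real"
  proof -
    let ?A = "\<lambda>\<xi>. X 0 -` {\<xi>} \<inter> space M"
    have As: "?A \<xi> \<in> sets M" if "\<xi> \<in> ?S" for \<xi>
      using measurable_sets[OF meas[of 0], of "{\<xi>}"] that by simp
    have pr: "prob (?A \<xi>) = (\<Prod>x<N. site_weight (\<phi> (real x / real N)) (\<xi> x))" if \<xi>: "\<xi> \<in> ?S" for \<xi>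
    proof -
      have ind: "indep_vars (\<lambda>_. count_space UNIV) (\<lambda>x \<omega>. X 0 \<omega> x) {..<N}"
        and mar: "\<And>x. x < N \<Longrightarrow> \<P>(\<omega> in M. X 0 \<omega> x = 1) = \<phi> (real x / real N)"
        using X by (auto simp: ssep_from_product_def)
      have xm: "(\<lambda>\<omega>. X 0 \<omega> x) \<in> measurable M (count_space UNIV)" if "x < N" for x
        by (rule measurable_compose[OF meas[of 0]]) auto
      have ne: "{..<N} \<noteq> {}" using N by (metis lessThan_iff empty_iff less_le_trans zero_less_numeral)
      have "?A \<xi> = (\<Inter>x\<in>{..<N}. (\<lambda>\<omega>. X 0 \<omega> x) -` {\<xi> x} \<inter> space M)"
      proof (intro equalityI subsetI)
        fix \<omega> assume \<omega>: "\<omega> \<in> (\<Inter>x\<in>{..<N}. (\<lambda>\<omega>. X 0 \<omega> x) -` {\<xi> x} \<inter> space M)"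
        have "0 < N" using N by simp
        then have sp: "\<omega> \<in> space M" using \<omega> by blast
        have "X 0 \<omega> x = \<xi> x" for x
        proof (cases "x < N")
          case True then show ?thesis using \<omega> by blast
        next
          case False
          then show ?thesis using XS[of 0 \<omega>] sp \<xi> by (auto simp: configs_def PiE_iff extensional_def)
        qed
        then show "\<omega> \<in> ?A \<xi>" using sp by auto
      qed auto
      then have "prob (?A \<xi>) = (\<Prod>x<N. prob ((\<lambda>\<omega>. X 0 \<omega> x) -` {\<xi> x} \<inter> space M))"
        using indep_varsD[OF ind ne _ subset_refl, of "\<lambda>x. {\<xi> x}"] by simp
      also have "\<dots> = (\<Prod>x<N. site_weight (\<phi> (real x / real N)) (\<xi> x))"
      proof (rule prod.cong[OF refl])
        fix x assume x: "x \<in> {..<N}"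
        have p1: "prob ((\<lambda>\<omega>. X 0 \<omega> x) -` {1} \<inter> space M) = \<phi> (real x / real N)"
        proof -
          have "(\<lambda>\<omega>. X 0 \<omega> x) -` {1} \<inter> space M = {\<omega> \<in> space M. X 0 \<omega> x = 1}" by auto
          then show ?thesis using mar[of x] x by simp
        qed
        show "prob ((\<lambda>\<omega>. X 0 \<omega> x) -` {\<xi> x} \<inter> space M) = site_weight (\<phi> (real x / real N)) (\<xi> x)"
        proof (cases "\<xi> x = 1")
          case True then show ?thesis using p1 by (simp add: site_weight_def)
        next
          case False
          then have 0: "\<xi> x = 0" using configs_cases[OF \<xi>, of x] x by auto
          have "X 0 \<omega> x = 0 \<or> X 0 \<omega> x = 1" if "\<omega> \<in> space M" for \<omega>
            using configs_cases[OF XS[OF _ that], of 0 x] x by auto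
          then have "(\<lambda>\<omega>. X 0 \<omega> x) -` {\<xi> x} \<inter> space M = space M - ((\<lambda>\<omega>. X 0 \<omega> x) -` {1} \<inter> space M)"
            using 0 by auto
          then show ?thesis
            using p1 x False measurable_sets[OF xm, of x "{1}"] by (simp add: prob_compl site_weight_def)
        qed
      qed
      finally show ?thesis .
    qed
    have "(\<integral>\<omega>. h (X 0 \<omega>) \<partial>M) = (\<integral>\<omega>. (\<Sum>\<xi>\<in>?S. h \<xi> * indicator (?A \<xi>) \<omega>) \<partial>M)"
    proof (rule Bochner_Integration.integral_cong[OF refl])
      fix \<omega> assume \<omega>: "\<omega> \<in> space M"
      have "(\<Sum>\<xi>\<in>?S. h \<xi> * indicator (?A \<xi>) \<omega>) = (\<Sum>\<xi>\<in>?S. if \<xi> = X 0 \<omega> then h \<xi> else 0)"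
        using \<omega> by (intro sum.cong) (auto simp: indicator_def)
      then show "h (X 0 \<omega>) = (\<Sum>\<xi>\<in>?S. h \<xi> * indicator (?A \<xi>) \<omega>)"
        using XS[OF _ \<omega>, of 0] by (simp add: sum.delta')
    qed
    also have "\<dots> = (\<Sum>\<xi>\<in>?S. h \<xi> * prob (?A \<xi>))"
      using As by (subst Bochner_Integration.integral_sum) (auto simp: less_top[symmetric])
    finally show ?thesis unfolding prodE_eq_sum using pr by simp
  qed
  have "ssep_kernel N K" using N K by unfold_locales
  then show ?thesis using one two by auto
qed

section \<open>Trigonometric polynomials and the discrete heat equation\<close>

text \<open>A list entry is an amplitude, a frequency and a phase; phases account for sines. The
  exponential factor makes the sum an explicit solution of the heat equation with period 1 in
  space.\<close>

fun trig :: "(real \<times> int \<times> real) list \<Rightarrow> real \<Rightarrow> real \<Rightarrow> real" where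
  "trig [] t u = 0"
| "trig ((c, k, \<theta>) # xs) t u =
     c * exp (- (2 * pi * real_of_int k)\<^sup>2 * t) * cos (2 * pi * real_of_int k * u + \<theta>) + trig xs t u"

lemma trig_append: "trig (xs @ ys) t u = trig xs t u + trig ys t u"
  by (induction xs t u rule: trig.induct) auto

definition trig_scale :: "real \<Rightarrow> (real \<times> int \<times> real) list \<Rightarrow> (real \<times> int \<times> real) list" where
  "trig_scale a xs = map (\<lambda>(c, k, \<theta>). (a * c, k, \<theta>)) xs"

lemma trig_trig_scale: "trig (trig_scale a xs) t u = a * trig xs t u"
  by (induction xs t u rule: trig.induct) (auto simp: trig_scale_def algebra_simps)

lemma cos_add_2pi_int: "cos (x + 2 * pi * real_of_int k) = cos x"
  using cos.plus_of_int[of x k] by (simp add: mult_ac)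

lemma trig_periodic: "trig xs t (u + 1) = trig xs t u"
proof (induction xs t u rule: trig.induct)
  case (2 c k \<theta> xs t u)
  have "2 * pi * real_of_int k * (u + 1) + \<theta> = (2 * pi * real_of_int k * u + \<theta>) + 2 * pi * real_of_int k"
    by (simp add: algebra_simps)
  then show ?case using 2 by (simp only: trig.simps cos_add_2pi_int)
qed simp

lemma continuous_on_trig [continuous_intros]:
  fixes f g :: "'a::t2_space \<Rightarrow> real"
  assumes "continuous_on S f" "continuous_on S g"
  shows "continuous_on S (\<lambda>x. trig xs (f x) (g x))"
proof (induction xs)
  case (Cons a xs)
  obtain c k \<theta> where a: "a = (c, k, \<theta>)" by (cases a)
  have "continuous_on S (\<lambda>x. cos (2 * pi * real_of_int k * g x + \<theta>))"
    by (rule continuous_on_cos) (intro continuous_intros assms)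
  moreover have "continuous_on S (\<lambda>x. exp (- (2 * pi * real_of_int k)\<^sup>2 * f x))"
    by (rule continuous_on_exp) (intro continuous_intros assms)
  ultimately show ?case unfolding a trig.simps
    by (intro continuous_on_add continuous_on_mult continuous_on_const Cons)
qed simp

text \<open>Product-to-sum formula. The statement is confined to time 0: products are wanted for
  density among initial values, and a product of heat solutions need not be a heat solution.\<close>

lemma trig_monomial_mult:
  "\<exists>zs. \<forall>u. trig zs 0 u = c * cos (2 * pi * real_of_int k * u + \<theta>) * trig ys 0 u"
proof (induction ys)
  case Nil
  show ?case by (intro exI[of _ "[]"]) simp
next
  case (Cons a ys)
  obtain d l \<psi> where a: "a = (d, l, \<psi>)" by (cases a)
  obtain zs where zs: "\<forall>u. trig zs 0 u = c * cos (2 * pi * real_of_int k * u + \<theta>) * trig ys 0 u"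
    using Cons by blast
  show ?case
  proof (intro exI[of _ "(c * d / 2, k + l, \<theta> + \<psi>) # (c * d / 2, k - l, \<theta> - \<psi>) # zs"] allI)
    fix u
    define x y where "x = 2 * pi * real_of_int k * u + \<theta>" and "y = 2 * pi * real_of_int l * u + \<psi>"
    have e: "2 * pi * real_of_int (k + l) * u + (\<theta> + \<psi>) = x + y"
      "2 * pi * real_of_int (k - l) * u + (\<theta> - \<psi>) = x - y"
      by (simp_all add: x_def y_def algebra_simps)
    have "cos (x + y) + cos (x - y) = 2 * (cos x * cos y)" by (simp add: cos_add cos_diff)
    then have "c * d / 2 * cos (x + y) + c * d / 2 * cos (x - y) = c * cos x * (d * cos y)"
      unfolding distrib_left[symmetric] by simp
    moreover have "trig zs 0 u = c * cos x * trig ys 0 u" using zs by (simp add: x_def)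
    moreover have "trig (a # ys) 0 u = d * cos y + trig ys 0 u" by (simp add: a y_def)
    moreover have "trig ((c * d / 2, k + l, \<theta> + \<psi>) # (c * d / 2, k - l, \<theta> - \<psi>) # zs) 0 u =
        c * d / 2 * cos (x + y) + (c * d / 2 * cos (x - y) + trig zs 0 u)"
      unfolding trig.simps e by simp
    ultimately have "trig ((c * d / 2, k + l, \<theta> + \<psi>) # (c * d / 2, k - l, \<theta> - \<psi>) # zs) 0 u =
        c * cos x * trig (a # ys) 0 u" by (simp add: distrib_left)
    then show "trig ((c * d / 2, k + l, \<theta> + \<psi>) # (c * d / 2, k - l, \<theta> - \<psi>) # zs) 0 u =
        c * cos (2 * pi * real_of_int k * u + \<theta>) * trig (a # ys) 0 u" by (simp only: x_def)
  qed
qed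

lemma trig_mult: "\<exists>zs. \<forall>u. trig zs 0 u = trig xs 0 u * trig ys 0 u"
proof (induction xs)
  case Nil
  show ?case by (intro exI[of _ "[]"]) simp
next
  case (Cons a xs)
  obtain c k \<theta> where a: "a = (c, k, \<theta>)" by (cases a)
  obtain zs where "\<forall>u. trig zs 0 u = trig xs 0 u * trig ys 0 u" using Cons by blast
  moreover obtain zs' where "\<forall>u. trig zs' 0 u = c * cos (2 * pi * real_of_int k * u + \<theta>) * trig ys 0 u"
    using trig_monomial_mult by blast
  ultimately show ?case
    by (intro exI[of _ "zs' @ zs"]) (simp add: a trig_append algebra_simps)
qed

lemma real_polynomial_function_trig:
  "real_polynomial_function g \<Longrightarrow> \<exists>xs. \<forall>u. trig xs 0 u = g (cis (2 * pi * u))"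
proof (induction rule: real_polynomial_function.induct)
  case (linear f)
  show ?case
  proof (intro exI[of _ "[(f 1, 1, 0), (f \<i>, 1, - pi / 2)]"] allI)
    fix u
    interpret bounded_linear f by (rule linear)
    have "cis (2 * pi * u) = cos (2 * pi * u) *\<^sub>R 1 + sin (2 * pi * u) *\<^sub>R \<i>"
      by (simp add: complex_eq_iff)
    then have "f (cis (2 * pi * u)) = cos (2 * pi * u) * f 1 + sin (2 * pi * u) * f \<i>"
      by (simp only: add scale real_scaleR_def)
    moreover have "cos (2 * pi * u + - pi / 2) = sin (2 * pi * u)"
      by (simp add: cos_diff)
    ultimately show "trig [(f 1, 1, 0), (f \<i>, 1, - pi / 2)] 0 u = f (cis (2 * pi * u))" by simp
  qed
next
  case (const c)
  show ?case by (intro exI[of _ "[(c, 0, 0)]"]) simp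
next
  case (add f g)
  then obtain xs ys where "\<forall>u. trig xs 0 u = f (cis (2 * pi * u))" "\<forall>u. trig ys 0 u = g (cis (2 * pi * u))" by blast
  then show ?case by (intro exI[of _ "xs @ ys"]) (simp add: trig_append)
next
  case (mult f g)
  then obtain xs ys where "\<forall>u. trig xs 0 u = f (cis (2 * pi * u))" "\<forall>u. trig ys 0 u = g (cis (2 * pi * u))" by blast
  then show ?case using trig_mult[of xs ys] by simp
qed

text \<open>The map \<open>E\<close> onto the unit circle identifies only the end points of
  \<open>{0..1}\<close>, so \<open>f\<close> descends to a function \<open>\<Phi>\<close> on the
  circle. The graph of \<open>\<Phi>\<close> is a continuous image of \<open>{0..1}\<close>, hence
  compact, which yields continuity; Stone-Weierstrass then gives a real polynomial in the
  coordinates of the plane.\<close>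

lemma trig_dense:
  fixes f :: "real \<Rightarrow> real"
  assumes f: "continuous_on {0..1} f" "f 0 = f 1" and \<epsilon>: "0 < \<epsilon>"
  shows "\<exists>xs. \<forall>u\<in>{0..1}. \<bar>trig xs 0 u - f u\<bar> < \<epsilon>"
proof -
  define E where "E u = cis (2 * pi * u)" for u :: real
  define S where "S = E ` {0..1}"
  define \<Phi> where "\<Phi> z = f (inv_into {0..1} E z)" for z
  have contE: "continuous_on A E" for A unfolding E_def by (intro continuous_intros)
  have S: "compact S" unfolding S_def by (intro compact_continuous_image contE) auto
  have same: "f u = f v" if "u \<in> {0..1}" "v \<in> {0..1}" "E u = E v" for u v
  proof -
    have "sin (2 * pi * u) = sin (2 * pi * v) \<and> cos (2 * pi * u) = cos (2 * pi * v)"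
      using that(3) by (simp add: E_def complex_eq_iff)
    then obtain n where n: "2 * pi * u = 2 * pi * v + 2 * pi * real_of_int n"
      using sin_cos_eq_iff[of "2 * pi * u" "2 * pi * v"] by auto
    then have "2 * pi * u = 2 * pi * (v + real_of_int n)" by (simp add: algebra_simps)
    then have uv: "u = v + real_of_int n" by simp
    then have "n = 0 \<or> n = 1 \<or> n = -1" using that by (auto; linarith)
    then show ?thesis using uv that f(2) by auto
  qed
  have \<Phi>: "\<Phi> (E u) = f u" if "u \<in> {0..1}" for u
    unfolding \<Phi>_def using that by (intro same inv_into_into f_inv_into_f) auto
  have "(\<lambda>z. (z, \<Phi> z)) ` S = (\<lambda>u. (E u, f u)) ` {0..1}"
    unfolding S_def image_image using \<Phi> by (intro image_cong) auto
  moreover have "compact ((\<lambda>u. (E u, f u)) ` {0..1})"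
    by (intro compact_continuous_image continuous_intros contE f) auto
  ultimately have "closed ((\<lambda>z. (z, \<Phi> z)) ` S)" by (simp add: compact_imp_closed)
  moreover have "\<Phi> \<in> S \<rightarrow> f ` {0..1}" using \<Phi> by (auto simp: S_def)
  moreover have "compact (f ` {0..1})" by (intro compact_continuous_image f) auto
  ultimately have "continuous_on S \<Phi>" by (intro continuous_from_closed_graph)
  then obtain g where g: "real_polynomial_function g" "\<And>z. z \<in> S \<Longrightarrow> \<bar>\<Phi> z - g z\<bar> < \<epsilon>"
    using Stone_Weierstrass_real_polynomial_function[OF S _ \<epsilon>] by blast
  obtain xs where xs: "\<forall>u. trig xs 0 u = g (E u)"
    using real_polynomial_function_trig[OF g(1)] by (auto simp: E_def)
  show ?thesis
  proof (intro exI[of _ xs] ballI)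
    fix u :: real assume u: "u \<in> {0..1}"
    have "\<bar>\<Phi> (E u) - g (E u)\<bar> < \<epsilon>" using u by (intro g) (auto simp: S_def)
    then show "\<bar>trig xs 0 u - f u\<bar> < \<epsilon>" using xs \<Phi>[OF u] by (simp add: abs_minus_commute)
  qed
qed

section \<open>Euler scheme, Fourier modes and maximum principle of the lattice heat
  equation\<close>

definition heat_step :: "nat \<Rightarrow> real \<Rightarrow> (nat \<Rightarrow> real) \<Rightarrow> nat \<Rightarrow> real" where
  "heat_step N h \<psi> x = \<psi> x + h * (real N)\<^sup>2 * (\<Sum>b<N. \<psi> (bond N b x) - \<psi> x)"

lemma heat_step_lin:
  "heat_step N h (\<lambda>x. a * \<psi> x + \<zeta> x) x = a * heat_step N h \<psi> x + heat_step N h \<zeta> x"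
  by (simp add: heat_step_def sum.distrib sum_subtractf sum_distrib_left algebra_simps)

lemma heat_step_funpow_lin:
  "(heat_step N h ^^ n) (\<lambda>x. a * \<psi> x + \<zeta> x) x = a * (heat_step N h ^^ n) \<psi> x + (heat_step N h ^^ n) \<zeta> x"
proof (induction n arbitrary: x)
  case (Suc n)
  have "(heat_step N h ^^ n) (\<lambda>x. a * \<psi> x + \<zeta> x) = (\<lambda>x. a * (heat_step N h ^^ n) \<psi> x + (heat_step N h ^^ n) \<zeta> x)"
    using Suc by blast
  then show ?case by (simp add: heat_step_lin)
qed simp

lemma heat_step_abs_le:
  assumes h: "0 \<le> h" "h * real N ^ 3 \<le> 1" and \<psi>: "\<And>x. x < N \<Longrightarrow> \<bar>\<psi> x\<bar> \<le> c" and x: "x < N"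
  shows "\<bar>heat_step N h \<psi> x\<bar> \<le> c"
proof -
  have eq: "heat_step N h \<psi> x = (1 - h * real N ^ 3) * \<psi> x + h * (real N)\<^sup>2 * (\<Sum>b<N. \<psi> (bond N b x))"
    by (simp add: heat_step_def sum_subtractf algebra_simps power2_eq_square power3_eq_cube)
  have "\<bar>heat_step N h \<psi> x\<bar> \<le> \<bar>(1 - h * real N ^ 3) * \<psi> x\<bar> + \<bar>h * (real N)\<^sup>2 * (\<Sum>b<N. \<psi> (bond N b x))\<bar>"
    unfolding eq by (rule abs_triangle_ineq)
  also have "\<dots> = (1 - h * real N ^ 3) * \<bar>\<psi> x\<bar> + h * (real N)\<^sup>2 * \<bar>\<Sum>b<N. \<psi> (bond N b x)\<bar>"
    using h by (simp add: abs_mult)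
  also have "\<dots> \<le> (1 - h * real N ^ 3) * c + h * (real N)\<^sup>2 * (real N * c)"
  proof (intro add_mono mult_left_mono \<psi> x)
    have "\<bar>\<Sum>b<N. \<psi> (bond N b x)\<bar> \<le> (\<Sum>b<N. \<bar>\<psi> (bond N b x)\<bar>)" by (rule sum_abs)
    also have "\<dots> \<le> (\<Sum>b<N. c)" using x by (intro sum_mono \<psi>) (auto simp: bond_less_iff)
    finally show "\<bar>\<Sum>b<N. \<psi> (bond N b x)\<bar> \<le> real N * c" by simp
  qed (use h in auto)
  also have "\<dots> = c" by (simp add: algebra_simps power2_eq_square power3_eq_cube)
  finally show ?thesis .
qed

lemma heat_step_funpow_abs_le:
  assumes h: "0 \<le> h" "h * real N ^ 3 \<le> 1" and \<psi>: "\<And>x. x < N \<Longrightarrow> \<bar>\<psi> x\<bar> \<le> c" and x: "x < N"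
  shows "\<bar>(heat_step N h ^^ n) \<psi> x\<bar> \<le> c"
  using x by (induction n arbitrary: x) (auto intro: \<psi> heat_step_abs_le[OF h])

text \<open>Eigenvalue of \<open>N^2\<close> times the discrete Laplacian at frequency
  \<open>k\<close>, that is \<open>- 4 * (N * sin (pi * k / N))^2\<close>.\<close>

definition eigen :: "nat \<Rightarrow> int \<Rightarrow> real" where
  "eigen N k = (real N)\<^sup>2 * (2 * cos (2 * pi * real_of_int k / real N) - 2)"

lemma eigen_nonpos: "eigen N k \<le> 0"
  using mult_left_mono[of "2 * cos (2 * pi * real_of_int k / real N) - 2" 0 "(real N)\<^sup>2"]
    cos_le_one[of "2 * pi * real_of_int k / real N"] by (simp add: eigen_def)

lemma sum_bond_diff:
  fixes \<psi> :: "nat \<Rightarrow> real"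
  assumes N: "3 \<le> N" and x: "x < N"
  defines "w \<equiv> (if x = 0 then N - 1 else x - 1)"
  shows "(\<Sum>b<N. \<psi> (bond N b x) - \<psi> x) = \<psi> ((x + 1) mod N) + \<psi> w - 2 * \<psi> x"
proof -
  have w: "w < N" "(w + 1) mod N = x" "w \<noteq> x"
    using x N by (auto simp: w_def mod_Suc One_nat_def)
  have "(\<Sum>b<N. \<psi> (bond N b x) - \<psi> x) = (\<Sum>b\<in>{w, x}. \<psi> (bond N b x) - \<psi> x)"
  proof (rule sum.mono_neutral_right)
    show "\<forall>b\<in>{..<N} - {w, x}. \<psi> (bond N b x) - \<psi> x = 0"
    proof
      fix b assume b: "b \<in> {..<N} - {w, x}"
      then have "(b + 1) mod N \<noteq> x"
        by (auto simp: w_def mod_Suc One_nat_def split: if_splits)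
      then show "\<psi> (bond N b x) - \<psi> x = 0" using b by (simp add: bond_def)
    qed
  qed (use w x in auto)
  also have "\<dots> = \<psi> ((x + 1) mod N) + \<psi> w - 2 * \<psi> x"
  proof -
    have "bond N x x = (x + 1) mod N" by (simp add: bond_def)
    moreover have "bond N w x = w" using w(2) unfolding bond_def by (metis transpose_apply_second)
    ultimately show ?thesis using w(3) by simp
  qed
  finally show ?thesis .
qed

lemma heat_step_cos:
  fixes k :: int and \<theta> :: real
  assumes N: "3 \<le> N" and x: "x < N"
  defines "\<psi> \<equiv> \<lambda>x::nat. cos (2 * pi * real_of_int k * (real x / real N) + \<theta>)"
  shows "heat_step N h \<psi> x = (1 + h * eigen N k) * \<psi> x"
proof -
  define y where "y = 2 * pi * real_of_int k * (real x / real N) + \<theta>"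
  define d where "d = 2 * pi * real_of_int k / real N"
  have N0: "real N \<noteq> 0" using N by simp
  have y: "\<psi> x = cos y" by (simp add: \<psi>_def y_def)
  have up: "\<psi> ((x + 1) mod N) = cos (y + d)"
  proof (cases "x = N - 1")
    case True
    then have "(x + 1) mod N = 0" "real x = real N - 1" using x by (auto simp: of_nat_diff)
    moreover have "y + d = \<theta> + 2 * pi * real_of_int k"
    proof -
      have "real x / real N + 1 / real N = 1" using N0 \<open>real x = real N - 1\<close> by (simp add: field_simps)
      moreover have "y + d = \<theta> + 2 * pi * real_of_int k * (real x / real N + 1 / real N)"
        unfolding y_def d_def distrib_left by simp
      ultimately show ?thesis by simp
    qed
    ultimately show ?thesis using cos_add_2pi_int[of \<theta> k] by (simp add: \<psi>_def)
  next
    case False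
    then have "x + 1 < N" using x by simp
    then have "(x + 1) mod N = x + 1" by simp
    moreover have "2 * pi * real_of_int k * (real (x + 1) / real N) + \<theta> = y + d"
      using N0 by (simp add: y_def d_def field_simps)
    ultimately show ?thesis unfolding \<psi>_def by presburger
  qed
  have down: "\<psi> (if x = 0 then N - 1 else x - 1) = cos (y - d)"
  proof (cases "x = 0")
    case True
    have "2 * pi * real_of_int k * (real (N - 1) / real N) + \<theta> = y - d + 2 * pi * real_of_int k"
      using N0 N True by (simp add: y_def d_def of_nat_diff field_simps)
    then show ?thesis using True cos_add_2pi_int[of "y - d" k] by (simp add: \<psi>_def)
  next
    case False
    have "2 * pi * real_of_int k * (real (x - 1) / real N) + \<theta> = y - d"
      using N0 False by (simp add: y_def d_def of_nat_diff field_simps)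
    then show ?thesis using False by (simp add: \<psi>_def)
  qed
  have "cos (y + d) + cos (y - d) = 2 * cos d * cos y" by (simp add: cos_add cos_diff)
  moreover have "heat_step N h \<psi> x = \<psi> x + h * (real N)\<^sup>2 *
      (\<psi> ((x + 1) mod N) + \<psi> (if x = 0 then N - 1 else x - 1) - 2 * \<psi> x)"
    unfolding heat_step_def sum_bond_diff[OF N x] ..
  ultimately show ?thesis
    unfolding up down y eigen_def d_def[symmetric] by (simp add: algebra_simps)
qed

lemma heat_step_cong:
  assumes "\<And>x. x < N \<Longrightarrow> \<psi> x = \<zeta> x" "x < N"
  shows "(heat_step N h ^^ n) \<psi> x = (heat_step N h ^^ n) \<zeta> x"
  using assms(2) by (induction n arbitrary: x) (simp_all add: heat_step_def assms(1) bond_less_iff)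

lemma heat_step_funpow_cos:
  assumes N: "3 \<le> N" and x: "x < N"
  shows "(heat_step N h ^^ n) (\<lambda>x. cos (2 * pi * real_of_int k * (real x / real N) + \<theta>)) x
    = (1 + h * eigen N k) ^ n * cos (2 * pi * real_of_int k * (real x / real N) + \<theta>)"
  using x
proof (induction n arbitrary: x)
  case (Suc n)
  let ?\<psi> = "\<lambda>x. cos (2 * pi * real_of_int k * (real x / real N) + \<theta>)"
  have "(heat_step N h ^^ Suc n) ?\<psi> x = heat_step N h ((heat_step N h ^^ n) ?\<psi>) x" by simp
  also have "\<dots> = heat_step N h (\<lambda>x. (1 + h * eigen N k) ^ n * ?\<psi> x + 0) x"
    using heat_step_cong[of N "(heat_step N h ^^ n) ?\<psi>" "\<lambda>x. (1 + h * eigen N k) ^ n * ?\<psi> x + 0" x "Suc 0" h] Suc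
    by simp
  also have "\<dots> = (1 + h * eigen N k) ^ n * heat_step N h ?\<psi> x"
    unfolding heat_step_lin by (simp add: heat_step_def)
  also have "\<dots> = (1 + h * eigen N k) ^ Suc n * ?\<psi> x"
    unfolding heat_step_cos[OF N Suc.prems] by simp
  finally show ?case .
qed simp

text \<open>The lattice counterpart of \<open>trig\<close>: the same modes, decaying with the
  discrete eigenvalues. It is defined for all real \<open>u\<close> but solves the lattice equation
  at the points \<open>x / N\<close>.\<close>

fun ntrig :: "nat \<Rightarrow> (real \<times> int \<times> real) list \<Rightarrow> real \<Rightarrow> real \<Rightarrow> real" where
  "ntrig N [] t u = 0"
| "ntrig N ((c, k, \<theta>) # xs) t u =
     c * exp (t * eigen N k) * cos (2 * pi * real_of_int k * u + \<theta>) + ntrig N xs t u"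

lemma heat_step_tendsto_ntrig:
  assumes N: "3 \<le> N" and x: "x < N"
  shows "(\<lambda>n. (heat_step N (t / real n) ^^ n) (\<lambda>x. trig xs 0 (real x / real N)) x)
    \<longlonglongrightarrow> ntrig N xs t (real x / real N)"
proof (induction xs)
  case Nil
  have "(heat_step N h ^^ n) (\<lambda>x. 0) x = 0" for h n
    by (induction n arbitrary: x) (simp_all add: heat_step_def)
  then show ?case by simp
next
  case (Cons a xs)
  obtain c k \<theta> where a: "a = (c, k, \<theta>)" by (cases a)
  have lim: "(\<lambda>n. (1 + t / real n * eigen N k) ^ n) \<longlonglongrightarrow> exp (t * eigen N k)"
    using tendsto_exp_limit_sequentially[of "t * eigen N k"] by simp
  have "(\<lambda>n. c * ((1 + t / real n * eigen N k) ^ n * cos (2 * pi * real_of_int k * (real x / real N) + \<theta>))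
      + (heat_step N (t / real n) ^^ n) (\<lambda>x. trig xs 0 (real x / real N)) x)
    \<longlonglongrightarrow> c * (exp (t * eigen N k) * cos (2 * pi * real_of_int k * (real x / real N) + \<theta>)) + ntrig N xs t (real x / real N)"
    by (intro tendsto_intros lim Cons)
  moreover have "trig (a # xs) 0 u = c * cos (2 * pi * real_of_int k * u + \<theta>) + trig xs 0 u" for u
    by (simp add: a)
  moreover have "ntrig N (a # xs) t u = c * (exp (t * eigen N k) * cos (2 * pi * real_of_int k * u + \<theta>)) + ntrig N xs t u" for u
    by (simp add: a)
  ultimately show ?case
    by (simp only: heat_step_funpow_lin heat_step_funpow_cos[OF N x])
qed

lemma heat_scale_ev:
  fixes t :: real
  assumes "0 < t"
  shows "\<forall>\<^sub>F n in sequentially. 0 \<le> t / real n \<and> t / real n * real N ^ 3 \<le> 1"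
proof -
  have "(\<lambda>n. t / real n * real N ^ 3) \<longlonglongrightarrow> 0"
    by (rule tendsto_mult_left_zero[OF lim_const_over_n])
  then have "\<forall>\<^sub>F n in sequentially. t / real n * real N ^ 3 < 1"
    by (rule order_tendstoD) simp
  then show ?thesis by eventually_elim (use assms in auto)
qed

lemma eigen_tendsto: "(\<lambda>N. eigen N k) \<longlonglongrightarrow> - (2 * pi * real_of_int k)\<^sup>2"
proof -
  define a where "a = pi * real_of_int k"
  have "(\<lambda>N. real N * sin (a / real N)) \<longlonglongrightarrow> a"
  proof (cases "a = 0")
    case False
    have "((\<lambda>y. sin y / y) \<longlongrightarrow> 1) (at (0::real))" 
      using DERIV_sin[of "0::real"] unfolding has_field_derivative_iff by simp
    moreover have "filterlim (\<lambda>N. a / real N) (at 0) sequentially"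
      unfolding filterlim_at
    proof
      show "(\<lambda>N. a / real N) \<longlonglongrightarrow> 0" by (rule lim_const_over_n)
      show "\<forall>\<^sub>F N in sequentially. a / real N \<in> UNIV \<and> a / real N \<noteq> 0"
        using eventually_gt_at_top[of 0] by eventually_elim (use False in auto)
    qed
    ultimately have "(\<lambda>N. sin (a / real N) / (a / real N)) \<longlonglongrightarrow> 1" by (rule filterlim_compose)
    then have "(\<lambda>N. a * (sin (a / real N) / (a / real N))) \<longlonglongrightarrow> a * 1" by (intro tendsto_intros)
    then have "(\<lambda>N. a * (sin (a / real N) / (a / real N))) \<longlonglongrightarrow> a" by simp
    then show ?thesis
      by (rule Lim_transform_eventually)
        (use False in \<open>auto intro!: eventually_mono[OF eventually_gt_at_top[of 0]]\<close>)
  qed simp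
  then have "(\<lambda>N. - 4 * (real N * sin (a / real N))\<^sup>2) \<longlonglongrightarrow> - 4 * a\<^sup>2" by (intro tendsto_intros)
  moreover have "eigen N k = - 4 * (real N * sin (a / real N))\<^sup>2" for N
  proof -
    have "2 * pi * real_of_int k / real N = 2 * (a / real N)" by (simp add: a_def)
    then have c: "cos (2 * pi * real_of_int k / real N) = 1 - 2 * (sin (a / real N))\<^sup>2"
      by (simp only: cos_double_sin)
    show ?thesis unfolding eigen_def c power_mult_distrib by (simp add: algebra_simps)
  qed
  ultimately show ?thesis by (simp add: a_def power_mult_distrib mult.assoc)
qed

lemma exp_diff_le:
  fixes x y :: real
  assumes "x \<le> 0" "y \<le> 0"
  shows "\<bar>exp x - exp y\<bar> \<le> \<bar>x - y\<bar>"
proof -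
  have "exp y - exp x \<le> y - x" if "x \<le> y" "y \<le> 0" for x y :: real
  proof -
    have "exp y - exp x = exp y * (1 - exp (x - y))" by (simp add: algebra_simps flip: exp_add)
    also have "\<dots> \<le> 1 * (1 - exp (x - y))" using that by (intro mult_right_mono) auto
    also have "\<dots> \<le> y - x" using exp_ge_add_one_self[of "x - y"] unfolding mult_1 by linarith
    finally show ?thesis .
  qed
  from this[of x y] this[of y x] assms show ?thesis by (cases "x \<le> y") (auto simp: abs_if)
qed

text \<open>The exponential is 1-Lipschitz on nonpositive reals, so convergence of finitely many
  eigenvalues gives convergence uniform over times up to \<open>T\<close> and over all
  points.\<close>

lemma ntrig_uniform:
  assumes "0 < \<epsilon>"
  shows "\<forall>\<^sub>F N in sequentially. \<forall>t\<in>{0..T}. \<forall>u. \<bar>ntrig N xs t u - trig xs t u\<bar> < \<epsilon>"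
  using assms
proof (induction xs arbitrary: \<epsilon>)
  case (Cons a xs)
  obtain c k \<theta> where a: "a = (c, k, \<theta>)" by (cases a)
  have "(\<lambda>N. \<bar>c\<bar> * (T * \<bar>eigen N k - (- (2 * pi * real_of_int k)\<^sup>2)\<bar>)) \<longlonglongrightarrow> \<bar>c\<bar> * (T * \<bar>- (2 * pi * real_of_int k)\<^sup>2 - (- (2 * pi * real_of_int k)\<^sup>2)\<bar>)"
    by (intro tendsto_intros eigen_tendsto)
  then have "\<forall>\<^sub>F N in sequentially. \<bar>c\<bar> * (T * \<bar>eigen N k - (- (2 * pi * real_of_int k)\<^sup>2)\<bar>) < \<epsilon> / 2"
    using Cons.prems by (intro order_tendstoD) auto
  moreover have "\<forall>\<^sub>F N in sequentially. \<forall>t\<in>{0..T}. \<forall>u. \<bar>ntrig N xs t u - trig xs t u\<bar> < \<epsilon> / 2"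
    using Cons.prems by (intro Cons.IH) simp
  ultimately show ?case
  proof eventually_elim
    case (elim N)
    show ?case
    proof (intro ballI allI)
      fix t u assume t: "t \<in> {0..T}"
      let ?C = "cos (2 * pi * real_of_int k * u + \<theta>)" and ?l = "- (2 * pi * real_of_int k)\<^sup>2"
      have "\<bar>exp (t * eigen N k) - exp (t * ?l)\<bar> \<le> \<bar>t * eigen N k - t * ?l\<bar>"
        using t by (intro exp_diff_le mult_nonneg_nonpos eigen_nonpos) auto
      also have "\<dots> = t * \<bar>eigen N k - ?l\<bar>"
      proof -
        have "0 \<le> t" using t by simp
        then show ?thesis by (simp only: right_diff_distrib[symmetric] abs_mult abs_of_nonneg)
      qed
      also have "\<dots> \<le> T * \<bar>eigen N k - ?l\<bar>" using t by (intro mult_right_mono) auto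
      finally have e: "\<bar>exp (t * eigen N k) - exp (t * ?l)\<bar> \<le> T * \<bar>eigen N k - ?l\<bar>" .
      have "\<bar>c * (exp (t * eigen N k) - exp (t * ?l)) * ?C\<bar> = \<bar>c\<bar> * \<bar>exp (t * eigen N k) - exp (t * ?l)\<bar> * \<bar>?C\<bar>"
        by (simp add: abs_mult)
      also have "\<dots> \<le> \<bar>c\<bar> * (T * \<bar>eigen N k - ?l\<bar>) * 1"
        using e abs_cos_le_one order_trans[OF abs_ge_zero e] by (intro mult_mono) auto
      finally have "\<bar>c * (exp (t * eigen N k) - exp (t * ?l)) * ?C\<bar> < \<epsilon> / 2" using elim(1) by simp
      moreover have "\<bar>ntrig N xs t u - trig xs t u\<bar> < \<epsilon> / 2" using elim(2) t by blast
      moreover have "ntrig N (a # xs) t u - trig (a # xs) t u =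
          c * (exp (t * eigen N k) - exp (t * ?l)) * ?C + (ntrig N xs t u - trig xs t u)"
        by (simp add: a algebra_simps)
      ultimately show "\<bar>ntrig N (a # xs) t u - trig (a # xs) t u\<bar> < \<epsilon>" by linarith
    qed
  qed
qed simp

lemma ntrig_abs_le:
  assumes N: "3 \<le> N" and x: "x < N" and t: "0 < t" and c: "\<And>u. \<bar>trig xs 0 u\<bar> \<le> c"
  shows "\<bar>ntrig N xs t (real x / real N)\<bar> \<le> c"
proof (rule tendsto_upperbound[OF tendsto_rabs[OF heat_step_tendsto_ntrig[OF N x]]])
  show "\<forall>\<^sub>F n in sequentially. \<bar>(heat_step N (t / real n) ^^ n) (\<lambda>x. trig xs 0 (real x / real N)) x\<bar> \<le> c"
    using heat_scale_ev[OF t, of N] by eventually_elim (intro heat_step_funpow_abs_le c x; simp)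
qed simp

text \<open>The maximum principle for the heat equation is inherited from the lattice, where each
  Euler step is a convex combination for small step size. Periodicity brings the point into
  \<open>{0..<1}\<close>, and lattice points approach it as \<open>N\<close> grows.\<close>

lemma trig_abs_le:
  assumes c: "\<And>u. \<bar>trig xs 0 u\<bar> \<le> c" and t: "0 \<le> t"
  shows "\<bar>trig xs t u\<bar> \<le> c"
proof (cases "t = 0")
  case False
  then have t: "0 < t" using t by simp
  interpret periodic_fun_simple' "trig xs t" by standard (rule trig_periodic)
  define v where "v = frac u"
  have v: "0 \<le> v" "v < 1" by (auto simp: v_def frac_lt_1)
  have uv: "trig xs t u = trig xs t v"
  proof -
    have "u = v + of_int \<lfloor>u\<rfloor>" by (simp add: v_def frac_def)
    then show ?thesis by (metis plus_of_int)
  qed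
  \<comment> \<open>The lattice site immediately to the left of \<open>v\<close>, or at
    \<open>v\<close>.\<close>
  define x where "x N = nat \<lfloor>v * real N\<rfloor>" for N
  have rx: "real (x N) = of_int \<lfloor>v * real N\<rfloor>" for N using v by (simp add: x_def)
  have xN: "x N < N" if "0 < N" for N
  proof -
    have "v * real N < real N" using v that by simp
    then have "real (x N) < real N" unfolding rx by linarith
    then show ?thesis by simp
  qed
  have "(\<lambda>N. real (x N) / real N) \<longlonglongrightarrow> v"
  proof (rule tendsto_sandwich[of "\<lambda>N. v - 1 / real N" _ _ "\<lambda>N. v"])
    show "\<forall>\<^sub>F N in sequentially. v - 1 / real N \<le> real (x N) / real N"
      using eventually_gt_at_top[of 0]
    proof eventually_elim
      case (elim N)
      have "v * real N - 1 \<le> real (x N)" unfolding rx by linarith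
      then have "(v * real N - 1) / real N \<le> real (x N) / real N" by (rule divide_right_mono) simp
      then show ?case using elim by (simp add: diff_divide_distrib)
    qed
    show "\<forall>\<^sub>F N in sequentially. real (x N) / real N \<le> v"
      using eventually_gt_at_top[of 0]
    proof eventually_elim
      case (elim N)
      have "real (x N) \<le> v * real N" unfolding rx by linarith
      then show ?case using elim by (simp add: field_simps)
    qed
    have "(\<lambda>N. v - 1 / real N) \<longlonglongrightarrow> v - 0" by (intro tendsto_intros lim_const_over_n)
    then show "(\<lambda>N. v - 1 / real N) \<longlonglongrightarrow> v" by simp
  qed simp
  moreover have "isCont (trig xs t) v"
  proof -
    have "continuous_on UNIV (trig xs t)"
      by (rule continuous_on_trig[of UNIV "\<lambda>_. t" "\<lambda>u. u" xs, OF continuous_on_const continuous_on_id])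
    then show ?thesis using continuous_on_eq_continuous_at open_UNIV by blast
  qed
  ultimately have lim: "(\<lambda>N. \<bar>trig xs t (real (x N) / real N)\<bar>) \<longlonglongrightarrow> \<bar>trig xs t v\<bar>"
    using isCont_tendsto_compose by (intro tendsto_rabs) blast
  have "\<bar>trig xs t v\<bar> \<le> c + \<epsilon>" if "0 < \<epsilon>" for \<epsilon>
  proof (rule tendsto_upperbound[OF lim])
    show "\<forall>\<^sub>F N in sequentially. \<bar>trig xs t (real (x N) / real N)\<bar> \<le> c + \<epsilon>"
      using ntrig_uniform[OF that, of t xs] eventually_ge_at_top[of 3]
    proof eventually_elim
      case (elim N)
      have "\<bar>ntrig N xs t (real (x N) / real N)\<bar> \<le> c"
        using elim by (intro ntrig_abs_le xN t c) auto
      moreover have "\<bar>ntrig N xs t (real (x N) / real N) - trig xs t (real (x N) / real N)\<bar> < \<epsilon>"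
        using elim t by auto
      ultimately show ?case by linarith
    qed
  qed simp
  then have "\<bar>trig xs t v\<bar> \<le> c" by (rule field_le_epsilon)
  then show ?thesis unfolding uv .
qed (simp add: c)

section \<open>Hydrodynamic limit of the mean densities\<close>

text \<open>The heat flow is specified by approximation, uniform over all times, by explicit
  evolutions of trigonometric polynomials close to \<open>\<phi>\<close>. Periodicity, Fourier
  coefficients and the hydrodynamic limit are read off from this property instead of a heat
  kernel.\<close>

definition is_heat_flow :: "(real \<Rightarrow> real) \<Rightarrow> (real \<Rightarrow> real \<Rightarrow> real) \<Rightarrow> bool" where
  "is_heat_flow \<phi> R \<longleftrightarrow>
     continuous_on ({0..} \<times> UNIV) (\<lambda>(t, u). R t u) \<and>
     (\<forall>\<epsilon>>0. \<exists>xs. (\<forall>u. \<bar>trig xs 0 u - \<phi> u\<bar> \<le> \<epsilon>) \<and> (\<forall>t\<ge>0. \<forall>u. \<bar>trig xs t u - R t u\<bar> \<le> \<epsilon>))"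

lemma torus_continuous_trig_dense:
  assumes "torus_continuous \<phi>" "0 < \<epsilon>"
  shows "\<exists>xs. \<forall>u. \<bar>trig xs 0 u - \<phi> u\<bar> < \<epsilon>"
proof -
  interpret \<phi>: periodic_fun_simple' \<phi> using assms by (simp add: torus_continuous_def)
  have "continuous_on {0..1} \<phi>" using assms by (auto simp: torus_continuous_def intro: continuous_on_subset)
  moreover have "\<phi> 0 = \<phi> 1" using \<phi>.of_1 by simp
  ultimately obtain xs where xs: "\<And>u. u \<in> {0..1} \<Longrightarrow> \<bar>trig xs 0 u - \<phi> u\<bar> < \<epsilon>"
    using trig_dense assms(2) by blast
  interpret t: periodic_fun_simple' "trig xs 0" by standard (rule trig_periodic)
  have "\<bar>trig xs 0 u - \<phi> u\<bar> < \<epsilon>" for u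
  proof -
    have "u = frac u + of_int \<lfloor>u\<rfloor>" by (simp add: frac_def)
    then have "trig xs 0 u = trig xs 0 (frac u)" "\<phi> u = \<phi> (frac u)"
      by (metis t.plus_of_int, metis \<phi>.plus_of_int)
    then show ?thesis using xs[of "frac u"] frac_ge_0[of u] frac_lt_1[of u] by simp
  qed
  then show ?thesis by blast
qed

text \<open>The difference of two trigonometric evolutions is again one, obtained by concatenating
  lists, so the maximum principle bounds it by its initial size.\<close>

lemma trig_diff_le:
  assumes "\<And>u. \<bar>trig xs 0 u - \<phi> u\<bar> \<le> a" "\<And>u. \<bar>trig ys 0 u - \<phi> u\<bar> \<le> b" "0 \<le> t"
  shows "\<bar>trig xs t u - trig ys t u\<bar> \<le> a + b"
proof -
  have d: "trig (xs @ trig_scale (-1) ys) t u = trig xs t u - trig ys t u" for t u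
    by (simp add: trig_append trig_trig_scale)
  have "\<bar>trig (xs @ trig_scale (-1) ys) 0 u\<bar> \<le> a + b" for u
    using assms(1)[of u] assms(2)[of u] unfolding d by linarith
  from trig_abs_le[OF this assms(3)] show ?thesis unfolding d .
qed

text \<open>Approximants of \<open>\<phi>\<close> with error \<open>1 / Suc n\<close> have
  evolutions that are Cauchy uniformly in \<open>t \<ge> 0\<close> and \<open>u\<close>. Their limit
  inherits joint continuity and the same rate of approximation.\<close>

lemma heat_flow_exists:
  assumes \<phi>: "torus_continuous \<phi>"
  shows "\<exists>R. is_heat_flow \<phi> R"
proof -
  have "\<forall>n. \<exists>xs. \<forall>u. \<bar>trig xs 0 u - \<phi> u\<bar> \<le> 1 / real (Suc n)"
    using torus_continuous_trig_dense[OF \<phi>] by (metis less_imp_le of_nat_0_less_iff zero_less_Suc zero_less_divide_1_iff)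
  then obtain xs where xs: "\<And>n u. \<bar>trig (xs n) 0 u - \<phi> u\<bar> \<le> 1 / real (Suc n)" by metis
  have diff: "\<bar>trig (xs n) t u - trig (xs m) t u\<bar> \<le> 1 / real (Suc n) + 1 / real (Suc m)" if "0 \<le> t" for n m t u
    by (rule trig_diff_le[OF xs xs that])
  define R where "R t u = lim (\<lambda>n. trig (xs n) t u)" for t u
  have lim: "(\<lambda>n. trig (xs n) t u) \<longlonglongrightarrow> R t u" if t: "0 \<le> t" for t u
  proof -
    have "Cauchy (\<lambda>n. trig (xs n) t u)"
    proof (rule metric_CauchyI)
      fix e :: real assume e: "0 < e"
      obtain M where M: "1 / real (Suc M) < e / 2" using nat_approx_posE[of "e / 2"] e by (auto simp: inverse_eq_divide)
      have "dist (trig (xs m) t u) (trig (xs n) t u) < e" if "M \<le> m" "M \<le> n" for m n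
      proof -
        have "1 / real (Suc m) \<le> 1 / real (Suc M)" "1 / real (Suc n) \<le> 1 / real (Suc M)"
          using that by (simp_all add: frac_le)
        then show ?thesis using diff[OF t, of m u n] M by (simp add: dist_real_def)
      qed
      then show "\<exists>M. \<forall>m\<ge>M. \<forall>n\<ge>M. dist (trig (xs m) t u) (trig (xs n) t u) < e" by blast
    qed
    then show ?thesis unfolding R_def by (simp add: Cauchy_convergent_iff convergent_LIMSEQ_iff)
  qed
  have close: "\<bar>trig (xs n) t u - R t u\<bar> \<le> 1 / real (Suc n)" if t: "0 \<le> t" for n t u
  proof (rule LIMSEQ_le)
    show "(\<lambda>m. \<bar>trig (xs n) t u - trig (xs m) t u\<bar>) \<longlonglongrightarrow> \<bar>trig (xs n) t u - R t u\<bar>"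
      by (intro tendsto_intros lim t)
    have "(\<lambda>m. 1 / real (Suc n) + 1 / real (Suc m)) \<longlonglongrightarrow> 1 / real (Suc n) + 0"
      by (intro tendsto_intros LIMSEQ_Suc lim_const_over_n)
    then show "(\<lambda>m. 1 / real (Suc n) + 1 / real (Suc m)) \<longlonglongrightarrow> 1 / real (Suc n)" by simp
  qed (use diff[OF t] in auto)
  have "is_heat_flow \<phi> R"
    unfolding is_heat_flow_def
  proof (intro conjI allI impI)
    show "continuous_on ({0..} \<times> UNIV) (\<lambda>(t, u). R t u)"
    proof (rule uniform_limit_theorem)
      show "\<forall>\<^sub>F n in sequentially. continuous_on ({0..} \<times> UNIV) (\<lambda>x. trig (xs n) (fst x) (snd x))"
        by (intro always_eventually allI continuous_on_trig continuous_intros)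
      show "uniform_limit ({0..} \<times> UNIV) (\<lambda>n x. trig (xs n) (fst x) (snd x)) (\<lambda>(t, u). R t u) sequentially"
      proof (rule uniform_limitI)
        fix e :: real assume e: "0 < e"
        obtain M where M: "1 / real (Suc M) < e" using nat_approx_posE[of e] e by (auto simp: inverse_eq_divide)
        have "\<forall>x\<in>{0..} \<times> UNIV. dist (trig (xs n) (fst x) (snd x)) (case x of (t, u) \<Rightarrow> R t u) < e" if "M \<le> n" for n
        proof
          fix x :: "real \<times> real" assume x: "x \<in> {0..} \<times> UNIV"
          have "1 / real (Suc n) \<le> 1 / real (Suc M)" using that by (simp add: frac_le)
          then show "dist (trig (xs n) (fst x) (snd x)) (case x of (t, u) \<Rightarrow> R t u) < e"
            using close[of "fst x" n "snd x"] x M by (auto simp: dist_real_def)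
        qed
        then show "\<forall>\<^sub>F n in sequentially. \<forall>x\<in>{0..} \<times> UNIV. dist (trig (xs n) (fst x) (snd x)) (case x of (t, u) \<Rightarrow> R t u) < e"
          by (rule eventually_sequentiallyI)
      qed
    qed simp
  next
    fix \<epsilon> :: real assume e: "0 < \<epsilon>"
    obtain M where M: "1 / real (Suc M) < \<epsilon>" using nat_approx_posE[of \<epsilon>] e by (auto simp: inverse_eq_divide)
    show "\<exists>xs. (\<forall>u. \<bar>trig xs 0 u - \<phi> u\<bar> \<le> \<epsilon>) \<and> (\<forall>t\<ge>0. \<forall>u. \<bar>trig xs t u - R t u\<bar> \<le> \<epsilon>)"
    proof (intro exI[of _ "xs M"] conjI allI impI)
      show "\<bar>trig (xs M) 0 u - \<phi> u\<bar> \<le> \<epsilon>" for u using M xs[of M u] by linarith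
      show "\<bar>trig (xs M) t u - R t u\<bar> \<le> \<epsilon>" if "0 \<le> t" for t u using M close[OF that, of M u] by linarith
    qed
  qed
  then show ?thesis by blast
qed

section \<open>Mean densities as solutions of the lattice heat equation\<close>

lemma euler_lin: "euler N h (\<lambda>\<eta>. a * f \<eta> + g \<eta>) = (\<lambda>\<eta>. a * euler N h f \<eta> + euler N h g \<eta>)"
  by (rule ext) (simp add: euler_def sum.distrib sum_subtractf sum_distrib_left algebra_simps)

lemma euler_funpow_lin:
  "(euler N h ^^ n) (\<lambda>\<eta>. a * f \<eta> + g \<eta>) = (\<lambda>\<eta>. a * (euler N h ^^ n) f \<eta> + (euler N h ^^ n) g \<eta>)"
  by (induction n) (simp_all add: euler_lin)

lemma euler_funpow_0: "(euler N h ^^ n) (\<lambda>\<eta>. 0) = (\<lambda>_. 0)"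
  by (induction n) (simp_all add: euler_def[abs_def])

lemma euler_funpow_sum:
  "(euler N h ^^ n) (\<lambda>\<eta>. \<Sum>i\<in>I. f i \<eta>) = (\<lambda>\<eta>. \<Sum>i\<in>I. (euler N h ^^ n) (f i) \<eta>)"
proof (induction I rule: infinite_finite_induct)
  case (insert i I)
  then show ?case using euler_funpow_lin[of n N h 1 "f i" "\<lambda>\<eta>. \<Sum>i\<in>I. f i \<eta>"] by simp
qed (simp_all add: euler_funpow_0)

text \<open>The generator maps an occupation variable to a linear combination of occupation
  variables, so the equation for the means is closed. The innermost Euler step is peeled off,
  because that is where the occupation variable is still explicit.\<close>

lemma prodE_euler_occupation:
  assumes "x < N"
  shows "prodE N \<rho> ((euler N h ^^ n) (\<lambda>\<eta>. real (\<eta> x))) = (heat_step N h ^^ n) \<rho> x"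
  using assms
proof (induction n arbitrary: x)
  case 0 then show ?case by (simp add: prodE_occupation)
next
  case (Suc n)
  let ?E = "euler N h ^^ n" and ?o = "\<lambda>x \<eta>. real (\<eta> x)"
  have 1: "euler N h (?o x) = (\<lambda>\<eta>. h * (real N)\<^sup>2 * (\<Sum>b<N. (-1) * ?o x \<eta> + ?o (bond N b x) \<eta>) + ?o x \<eta>)"
    by (rule ext) (simp add: euler_def sum_subtractf sum.distrib algebra_simps)
  have 2: "?E (euler N h (?o x)) = (\<lambda>\<eta>. h * (real N)\<^sup>2 * (\<Sum>b<N. (-1) * ?E (?o x) \<eta> + ?E (?o (bond N b x)) \<eta>) + ?E (?o x) \<eta>)"
    unfolding 1 euler_funpow_lin euler_funpow_sum ..
  have "prodE N \<rho> ((euler N h ^^ Suc n) (?o x)) = prodE N \<rho> (?E (euler N h (?o x)))"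
    by (simp add: funpow_swap1)
  also have "\<dots> = h * (real N)\<^sup>2 * (\<Sum>b<N. (-1) * prodE N \<rho> (?E (?o x)) + prodE N \<rho> (?E (?o (bond N b x)))) + prodE N \<rho> (?E (?o x))"
    unfolding 2 prodE_lin prodE_sum ..
  also have "\<dots> = h * (real N)\<^sup>2 * (\<Sum>b<N. (-1) * (heat_step N h ^^ n) \<rho> x + (heat_step N h ^^ n) \<rho> (bond N b x)) + (heat_step N h ^^ n) \<rho> x"
    using Suc by (simp add: bond_less_iff)
  also have "\<dots> = (heat_step N h ^^ Suc n) \<rho> x"
    by (simp add: heat_step_def)
  finally show ?case .
qed

context ssep_kernel
begin

lemma heat_step_tendsto_mean_density:
  assumes "0 < t" "x < N"
  shows "(\<lambda>n. (heat_step N (t / real n) ^^ n) \<rho> x) \<longlonglongrightarrow> mean_density t \<rho> x"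
  unfolding mean_density_def prodE_euler_occupation[OF assms(2), symmetric]
  by (intro tendsto_prodE euler_tendsto assms tendsto_const)

text \<open>Both profiles evolve by the same linear contraction in the supremum norm, so their
  initial distance is never exceeded.\<close>

lemma mean_density_close_ntrig:
  assumes t: "0 < t" and x: "x < N" and close: "\<And>u. \<bar>trig xs 0 u - \<phi> u\<bar> \<le> \<epsilon>"
  shows "\<bar>ntrig N xs t (real x / real N) - mean_density t (\<lambda>x. \<phi> (real x / real N)) x\<bar> \<le> \<epsilon>"
proof -
  let ?a = "\<lambda>x. trig xs 0 (real x / real N)" and ?b = "\<lambda>x. \<phi> (real x / real N)"
  have lim: "(\<lambda>n. \<bar>(heat_step N (t / real n) ^^ n) ?a x - (heat_step N (t / real n) ^^ n) ?b x\<bar>)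
      \<longlonglongrightarrow> \<bar>ntrig N xs t (real x / real N) - mean_density t ?b x\<bar>"
    by (intro tendsto_intros heat_step_tendsto_ntrig heat_step_tendsto_mean_density N x t)
  show ?thesis
  proof (rule tendsto_upperbound[OF lim])
    show "\<forall>\<^sub>F n in sequentially. \<bar>(heat_step N (t / real n) ^^ n) ?a x - (heat_step N (t / real n) ^^ n) ?b x\<bar> \<le> \<epsilon>"
      using heat_scale_ev[OF t, of N]
    proof eventually_elim
      case (elim n)
      have "\<bar>(heat_step N (t / real n) ^^ n) (\<lambda>x. (-1) * ?b x + ?a x) x\<bar> \<le> \<epsilon>"
        using elim close by (intro heat_step_funpow_abs_le x) auto
      then show ?case unfolding heat_step_funpow_lin by simp
    qed
  qed simp
qed

end

text \<open>The trigonometric approximant is fixed before \<open>N\<close>. Contraction on the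
  lattice and approximation of the heat flow hold for all \<open>N\<close> and \<open>t\<close>;
  only the eigenvalues must converge, so one threshold serves all times in \<open>{0<..T}\<close>
  and all kernels.\<close>

lemma hydrodynamic_limit:
  assumes R: "is_heat_flow \<phi> R" and \<epsilon>: "0 < \<epsilon>"
  shows "\<exists>N0. \<forall>N\<ge>N0. \<forall>K. ssep_kernel N K \<longrightarrow> (\<forall>t\<in>{0<..T}. \<forall>x<N.
     \<bar>ssep_kernel.mean_density N K t (\<lambda>x. \<phi> (real x / real N)) x - R t (real x / real N)\<bar> \<le> \<epsilon>)"
proof -
  obtain xs where xs: "\<And>u. \<bar>trig xs 0 u - \<phi> u\<bar> \<le> \<epsilon> / 3" "\<And>t u. 0 \<le> t \<Longrightarrow> \<bar>trig xs t u - R t u\<bar> \<le> \<epsilon> / 3"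
    using R \<epsilon> unfolding is_heat_flow_def by (metis zero_less_divide_iff zero_less_numeral)
  obtain N0 where N0: "\<And>N t u. N0 \<le> N \<Longrightarrow> t \<in> {0..T} \<Longrightarrow> \<bar>ntrig N xs t u - trig xs t u\<bar> < \<epsilon> / 3"
    using ntrig_uniform[of "\<epsilon> / 3" T xs] \<epsilon> unfolding eventually_sequentially
    by (metis zero_less_divide_iff zero_less_numeral)
  show ?thesis
  proof (intro exI[of _ N0] allI impI ballI)
    fix N K t x assume A: "N0 \<le> N" "ssep_kernel N K" "t \<in> {0<..T}" "x < N"
    interpret ssep_kernel N K by (rule A)
    have t: "0 < t" "t \<in> {0..T}" "0 \<le> t" using A by auto
    show "\<bar>mean_density t (\<lambda>x. \<phi> (real x / real N)) x - R t (real x / real N)\<bar> \<le> \<epsilon>"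
      using mean_density_close_ntrig[OF t(1) A(4) xs(1)] N0[OF A(1) t(2), of "real x / real N"] xs(2)[OF t(3), of "real x / real N"]
      by linarith
  qed
qed

section \<open>Uniqueness of weak solutions\<close>

abbreviation circle_int :: "(real \<Rightarrow> real) \<Rightarrow> real" where
  "circle_int g \<equiv> (LBINT u:{0..<1}. g u)"

lemma set_integrable_continuous_Ico:
  fixes g :: "real \<Rightarrow> real"
  assumes "continuous_on {0..1} g"
  shows "set_integrable lborel {0..<1} g"
  by (rule set_integrable_subset[OF borel_integrable_atLeastAtMost'[OF assms]]) auto

lemma circle_int_abs_le:
  fixes g :: "real \<Rightarrow> real"
  assumes g: "set_integrable lborel {0..<1} g" and c: "\<And>u. u \<in> {0..<1} \<Longrightarrow> \<bar>g u\<bar> \<le> c"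
  shows "\<bar>circle_int g\<bar> \<le> c"
proof -
  have one: "circle_int (\<lambda>_. c) = c" for c :: real
    by (simp add: set_lebesgue_integral_def)
  have int: "set_integrable lborel {0..<1::real} (\<lambda>_. c)" for c :: real
    by (rule set_integrable_continuous_Ico) simp
  have "circle_int g \<le> circle_int (\<lambda>_. c)" "circle_int (\<lambda>_. - c) \<le> circle_int g"
    using c by (intro set_integral_mono g int; force simp: abs_le_iff)+
  then show ?thesis unfolding one by auto
qed

lemma circle_int_cos:
  assumes "m \<noteq> 0"
  shows "circle_int (\<lambda>u. cos (2 * pi * real_of_int m * u + \<theta>)) = 0"
proof -
  let ?w = "2 * pi * real_of_int m"
  have w: "?w \<noteq> 0" using assms by simp
  have "circle_int (\<lambda>u. cos (?w * u + \<theta>)) = (LBINT u=ereal 0..ereal 1. cos (?w * u + \<theta>))"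
    by (rule interval_integral_Ico[symmetric]) simp
  also have "\<dots> = sin (?w * 1 + \<theta>) / ?w - sin (?w * 0 + \<theta>) / ?w"
  proof (rule interval_integral_FTC_finite)
    show "continuous_on {min 0 1..max 0 1} (\<lambda>u. cos (?w * u + \<theta>))"
      by (intro continuous_on_cos continuous_intros)
    fix u :: real
    have "((\<lambda>u. sin (?w * u + \<theta>) / ?w) has_real_derivative cos (?w * u + \<theta>)) (at u within {min 0 1..max 0 1})"
      using w by (auto intro!: derivative_eq_intros)
    then show "((\<lambda>u. sin (?w * u + \<theta>) / ?w) has_vector_derivative cos (?w * u + \<theta>)) (at u within {min 0 1..max 0 1})"
      by (simp add: has_real_derivative_iff_has_vector_derivative)
  qed
  also have "\<dots> = 0"
    using sin.plus_of_int[of \<theta> m] by (simp add: mult_ac add.commute)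
  finally show ?thesis .
qed

lemma continuous_on_cos_affine: "continuous_on S (\<lambda>u::real. cos (2 * pi * real_of_int k * u + \<theta>))"
  by (intro continuous_on_cos continuous_intros)

lemma continuous_on_trig_space: "continuous_on S (\<lambda>u::real. trig xs t u)"
  by (intro continuous_on_trig continuous_intros)

lemma circle_int_add:
  "set_integrable lborel {0..<1} f \<Longrightarrow> set_integrable lborel {0..<1} g \<Longrightarrow>
    circle_int (\<lambda>u. f u + g u) = circle_int f + circle_int g"
  by (rule set_integral_add)

lemma circle_int_diff:
  "set_integrable lborel {0..<1} f \<Longrightarrow> set_integrable lborel {0..<1} g \<Longrightarrow>
    circle_int (\<lambda>u. f u - g u) = circle_int f - circle_int g"
  by (rule set_integral_diff)

lemma circle_int_cos_cos:
  assumes "j \<noteq> k" "j \<noteq> - k"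
  shows "circle_int (\<lambda>u. cos (2 * pi * real_of_int j * u + \<theta>) * cos (2 * pi * real_of_int k * u + \<psi>)) = 0"
proof -
  have "cos (2 * pi * real_of_int j * u + \<theta>) * cos (2 * pi * real_of_int k * u + \<psi>) =
     1 / 2 * (cos (2 * pi * real_of_int (j + k) * u + (\<theta> + \<psi>)) + cos (2 * pi * real_of_int (j - k) * u + (\<theta> - \<psi>)))" for u
  proof -
    define x y where "x = 2 * pi * real_of_int j * u + \<theta>" and "y = 2 * pi * real_of_int k * u + \<psi>"
    have "2 * pi * real_of_int (j + k) * u + (\<theta> + \<psi>) = x + y" "2 * pi * real_of_int (j - k) * u + (\<theta> - \<psi>) = x - y"
      by (simp_all add: x_def y_def algebra_simps)
    then show ?thesis by (simp add: cos_add cos_diff x_def[symmetric] y_def[symmetric])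
  qed
  then have "circle_int (\<lambda>u. cos (2 * pi * real_of_int j * u + \<theta>) * cos (2 * pi * real_of_int k * u + \<psi>)) =
     1 / 2 * (circle_int (\<lambda>u. cos (2 * pi * real_of_int (j + k) * u + (\<theta> + \<psi>)))
       + circle_int (\<lambda>u. cos (2 * pi * real_of_int (j - k) * u + (\<theta> - \<psi>))))"
    by (simp only: set_integral_mult_right circle_int_add set_integrable_continuous_Ico continuous_on_cos_affine)
  also have "\<dots> = 0" using assms by (simp only: circle_int_cos) simp
  finally show ?thesis .
qed

text \<open>Orthogonality leaves only the frequencies \<open>k\<close> and \<open>- k\<close>, and
  these share one decay factor.\<close>

lemma circle_int_trig_cos:
  "circle_int (\<lambda>u. trig xs t u * cos (2 * pi * real_of_int k * u + \<psi>)) =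
    exp (- (2 * pi * real_of_int k)\<^sup>2 * t) * circle_int (\<lambda>u. trig xs 0 u * cos (2 * pi * real_of_int k * u + \<psi>))"
proof (induction xs)
  case Nil
  then show ?case by (simp add: set_lebesgue_integral_def)
next
  case (Cons a xs)
  obtain c j \<theta> where a: "a = (c, j, \<theta>)" by (cases a)
  let ?C = "\<lambda>u. cos (2 * pi * real_of_int k * u + \<psi>)" and ?D = "\<lambda>u. cos (2 * pi * real_of_int j * u + \<theta>)"
  let ?e = "\<lambda>j. exp (- (2 * pi * real_of_int j)\<^sup>2 * t)"
  have int: "set_integrable lborel {0..<1} (\<lambda>u. d * (?D u * ?C u))" "set_integrable lborel {0..<1} (\<lambda>u. trig xs s u * ?C u)" for d s
    by (intro set_integrable_continuous_Ico continuous_on_mult continuous_on_const continuous_on_cos_affine continuous_on_trig_space)+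
  have split: "circle_int (\<lambda>u. trig (a # xs) s u * ?C u) =
      c * exp (- (2 * pi * real_of_int j)\<^sup>2 * s) * circle_int (\<lambda>u. ?D u * ?C u) + circle_int (\<lambda>u. trig xs s u * ?C u)" for s
  proof -
    have "trig (a # xs) s u * ?C u = c * exp (- (2 * pi * real_of_int j)\<^sup>2 * s) * (?D u * ?C u) + trig xs s u * ?C u" for u
      by (simp add: a algebra_simps)
    then show ?thesis by (simp only: circle_int_add int set_integral_mult_right)
  qed
  have "?e j * circle_int (\<lambda>u. ?D u * ?C u) = ?e k * circle_int (\<lambda>u. ?D u * ?C u)"
  proof (cases "j = k \<or> j = - k")
    case True then show ?thesis by auto
  next
    case False then show ?thesis by (simp add: circle_int_cos_cos)
  qed
  then show ?case unfolding split Cons by (simp add: algebra_simps)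
qed

text \<open>The integral equation supplies the regularity: an integrable \<open>F\<close> has a
  continuous primitive, so \<open>F\<close> is continuous, hence differentiable. Then
  \<open>F t * exp (l * t)\<close> has derivative 0 and keeps its initial value
  \<open>c\<close>.\<close>

lemma volterra_exp:
  fixes F :: "real \<Rightarrow> real"
  assumes int: "\<And>t. 0 \<le> t \<Longrightarrow> set_integrable lborel {0..t} F"
    and eq: "\<And>t. 0 \<le> t \<Longrightarrow> F t = c - l * (LBINT s:{0..t}. F s)" and T: "0 \<le> T"
  shows "F T = c * exp (- l * T)"
proof -
  have I: "F integrable_on {0..T}" by (rule set_borel_integral_eq_integral(1)[OF int[OF T]])
  have eq': "F t = c - l * integral {0..t} F" if "0 \<le> t" for t
    using eq[OF that] set_borel_integral_eq_integral(2)[OF int[OF that]] by simp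
  have "continuous_on {0..T} (\<lambda>t. c - l * integral {0..t} F)"
    by (intro continuous_intros indefinite_integral_continuous_1 I)
  then have cont: "continuous_on {0..T} F"
    by (rule continuous_on_cong[THEN iffD1, rotated 2]) (auto simp: eq')
  have der: "(F has_real_derivative - l * F t) (at t within {0..T})" if t: "t \<in> {0..T}" for t
  proof -
    have "((\<lambda>t. c - l * integral {0..t} F) has_real_derivative - l * F t) (at t within {0..T})"
      by (auto intro!: derivative_eq_intros integral_has_real_derivative[OF cont t])
    then show ?thesis
      by (rule has_field_derivative_transform_within[where d = 1]) (use t in \<open>auto simp: eq'\<close>)
  qed
  have "\<exists>d. \<forall>t\<in>{0..T}. F t * exp (l * t) = d"
  proof (rule has_field_derivative_zero_constant)
    fix t assume "t \<in> {0..T}"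
    then show "((\<lambda>t. F t * exp (l * t)) has_real_derivative 0) (at t within {0..T})"
      by (auto intro!: derivative_eq_intros der)
  qed simp
  then obtain d where d: "\<And>t. t \<in> {0..T} \<Longrightarrow> F t * exp (l * t) = d" by blast
  have "F 0 = c" using eq'[of 0] by simp
  then have "F T * exp (l * T) = c" using d[of 0] d[of T] T by simp
  then show ?thesis by (simp add: exp_minus field_simps)
qed

text \<open>A cosine mode is an eigenfunction of the second derivative, so testing with it yields a
  closed scalar equation for this coefficient. Joint integrability of \<open>\<rho>\<close> in time
  and space makes the coefficient integrable in time by Fubini, as \<open>volterra_exp\<close>
  demands.\<close>

lemma weak_solution_coeff:
  assumes \<rho>: "heat_weak_solution \<phi> \<rho>" and t: "0 \<le> t"
  shows "circle_int (\<lambda>u. \<rho> t u * cos (2 * pi * real_of_int k * u + \<theta>)) =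
    circle_int (\<lambda>u. \<phi> u * cos (2 * pi * real_of_int k * u + \<theta>)) * exp (- (2 * pi * real_of_int k)\<^sup>2 * t)"
proof -
  let ?w = "2 * pi * real_of_int k"
  let ?f = "\<lambda>u. cos (?w * u + \<theta>)"
  define F where "F s = circle_int (\<lambda>u. \<rho> s u * ?f u)" for s
  have "F t = circle_int (\<lambda>u. \<phi> u * ?f u) * exp (- ?w\<^sup>2 * t)"
  proof (rule volterra_exp[OF _ _ t])
    fix t :: real assume t: "0 \<le> t"
    have "set_integrable lborel ({0..t} \<times> {0..<1}) (\<lambda>(s, u). \<rho> s u)"
      using \<rho> t by (simp add: heat_weak_solution_def)
    then have I: "integrable (lborel \<Otimes>\<^sub>M lborel) (\<lambda>x. indicator ({0..t} \<times> {0..<1}) x *\<^sub>R (case x of (s, u) \<Rightarrow> \<rho> s u))"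
      by (simp add: set_integrable_def lborel_prod)
    then have "integrable (lborel \<Otimes>\<^sub>M lborel) (\<lambda>x. (indicator ({0..t} \<times> {0..<1}) x *\<^sub>R (case x of (s, u) \<Rightarrow> \<rho> s u)) * ?f (snd x))"
    proof (rule Bochner_Integration.integrable_bound)
      have "?f \<in> borel_measurable borel" by (rule borel_measurable_continuous_onI[OF continuous_on_cos_affine])
      then have "?f \<in> borel_measurable lborel" by simp
      then have "(\<lambda>x. ?f (snd x)) \<in> borel_measurable (lborel \<Otimes>\<^sub>M lborel)"
        by (rule measurable_compose[OF measurable_snd])
      then show "(\<lambda>x. (indicator ({0..t} \<times> {0..<1}) x *\<^sub>R (case x of (s, u) \<Rightarrow> \<rho> s u)) * ?f (snd x)) \<in> borel_measurable (lborel \<Otimes>\<^sub>M lborel)"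
        by (rule borel_measurable_times[OF borel_measurable_integrable[OF I]])
      have "\<bar>x * ?f u\<bar> \<le> \<bar>x\<bar>" for x u :: real
        unfolding abs_mult by (rule mult_left_le) (rule abs_cos_le_one, rule abs_ge_zero)
      then show "AE x in lborel \<Otimes>\<^sub>M lborel. norm ((indicator ({0..t} \<times> {0..<1}) x *\<^sub>R (case x of (s, u) \<Rightarrow> \<rho> s u)) * ?f (snd x))
          \<le> norm (indicator ({0..t} \<times> {0..<1}) x *\<^sub>R (case x of (s, u) \<Rightarrow> \<rho> s u))"
        unfolding real_norm_def by (intro always_eventually allI)
    qed
    then have "integrable lborel (\<lambda>s. \<integral>u. (indicator ({0..t} \<times> {0..<1}) (s, u) *\<^sub>R \<rho> s u) * ?f u \<partial>lborel)"
      by (drule_tac lborel_pair.integrable_fst') (simp only: snd_conv prod.case)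
    moreover have "(\<integral>u. (indicator ({0..t} \<times> {0..<1}) (s, u) *\<^sub>R \<rho> s u) * ?f u \<partial>lborel) = indicator {0..t} s *\<^sub>R F s" for s
    proof -
      have "(\<integral>u. (indicator ({0..t} \<times> {0..<1}) (s, u) *\<^sub>R \<rho> s u) * ?f u \<partial>lborel)
        = (\<integral>u. indicator {0..t} s *\<^sub>R (indicator {0..<1} u *\<^sub>R (\<rho> s u * ?f u)) \<partial>lborel)"
        by (intro Bochner_Integration.integral_cong) (auto simp: indicator_def)
      then show ?thesis by (simp add: F_def set_lebesgue_integral_def)
    qed
    ultimately show "set_integrable lborel {0..t} F" by (simp add: set_integrable_def)
    have d1: "(?f has_real_derivative - ?w * sin (?w * u + \<theta>)) (at u)" for u
      by (auto intro!: derivative_eq_intros)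
    have d2: "((\<lambda>u. - ?w * sin (?w * u + \<theta>)) has_real_derivative - ?w\<^sup>2 * ?f u) (at u)" for u
      by (auto intro!: derivative_eq_intros simp: power2_eq_square)
    have per: "periodic_fun_simple' ?f"
    proof
      fix u
      have "?w * (u + 1) + \<theta> = (?w * u + \<theta>) + 2 * pi * real_of_int k" by (simp add: algebra_simps)
      then show "?f (u + 1) = ?f u" by (simp only: cos_add_2pi_int)
    qed
    have cont: "continuous_on UNIV (\<lambda>u. - ?w\<^sup>2 * ?f u)"
      by (intro continuous_on_mult continuous_on_const continuous_on_cos_affine)
    have W: "\<And>f f' f''. periodic_fun_simple' f \<Longrightarrow> (\<forall>u. (f has_real_derivative f' u) (at u)) \<Longrightarrow>
        (\<forall>u. (f' has_real_derivative f'' u) (at u)) \<Longrightarrow> continuous_on UNIV f'' \<Longrightarrow>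
        circle_int (\<lambda>u. \<rho> t u * f u) = circle_int (\<lambda>u. \<phi> u * f u)
          + (LBINT s:{0..t}. circle_int (\<lambda>u. \<rho> s u * f'' u))"
      using \<rho> t unfolding heat_weak_solution_def by blast
    have "F t = circle_int (\<lambda>u. \<phi> u * ?f u) + (LBINT s:{0..t}. circle_int (\<lambda>u. \<rho> s u * (- ?w\<^sup>2 * ?f u)))"
      unfolding F_def by (rule W[OF per allI[OF d1] allI[OF d2] cont])
    moreover have "circle_int (\<lambda>u. \<rho> s u * (- ?w\<^sup>2 * ?f u)) = - ?w\<^sup>2 * F s" for s
    proof -
      have "circle_int (\<lambda>u. \<rho> s u * (- ?w\<^sup>2 * ?f u)) = circle_int (\<lambda>u. - ?w\<^sup>2 * (\<rho> s u * ?f u))"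
        by (simp only: mult.left_commute)
      then show ?thesis unfolding F_def by (simp only: set_integral_mult_right)
    qed
    ultimately have "F t = circle_int (\<lambda>u. \<phi> u * ?f u) + (LBINT s:{0..t}. - ?w\<^sup>2 * F s)" by (simp only:)
    then have "F t = circle_int (\<lambda>u. \<phi> u * ?f u) + - ?w\<^sup>2 * (LBINT s:{0..t}. F s)"
      by (simp only: set_integral_mult_right)
    then show "F t = circle_int (\<lambda>u. \<phi> u * ?f u) - ?w\<^sup>2 * (LBINT s:{0..t}. F s)" by simp
  qed
  then show ?thesis by (simp add: F_def)
qed

text \<open>Periodic continuous test functions approximate indicators of intervals starting at 0, so
  \<open>h\<close>, extended by 0, integrates to 0 over every half-line. The half-lines generate the
  Borel sets and are stable under intersection, which extends this to all Borel sets.\<close>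

lemma AE_zero_of_continuous_tests:
  fixes h :: "real \<Rightarrow> real"
  assumes h: "set_integrable lborel {0..<1} h"
    and zero: "\<And>f. continuous_on {0..1} f \<Longrightarrow> f 0 = f 1 \<Longrightarrow> circle_int (\<lambda>u. h u * f u) = 0"
  shows "AE u in lborel. u \<in> {0..<1} \<longrightarrow> h u = 0"
proof -
  define H where "H u = indicator {0..<1} u * h u" for u
  have H: "integrable lborel H" using h by (simp add: set_integrable_def H_def[abs_def])
  have total: "(\<integral>u. H u \<partial>lborel) = 0"
    using zero[of "\<lambda>_. 1"] by (simp add: H_def[abs_def] set_lebesgue_integral_def)
  have half: "(LBINT u:{..a}. H u) = 0" for a
  proof -
    consider "a \<le> 0" | "1 \<le> a" | "0 < a" "a < 1" by linarith
    then show ?thesis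
    proof cases
      case 1
      have "(LBINT u:{..a}. H u) = integral\<^sup>L (lborel :: real measure) (\<lambda>_. 0)"
        unfolding set_lebesgue_integral_def
      proof (rule Bochner_Integration.integral_cong_AE)
        show "(\<lambda>u. indicator {..a} u *\<^sub>R H u) \<in> borel_measurable lborel" using H by (intro borel_measurable_scaleR) auto
        show "AE u in lborel. indicator {..a} u *\<^sub>R H u = 0"
          using AE_lborel_singleton[of 0] by eventually_elim (use 1 in \<open>auto simp: indicator_def H_def\<close>)
      qed simp
      then show ?thesis by simp
    next
      case 2
      have "(LBINT u:{..a}. H u) = (\<integral>u. H u \<partial>lborel)"
        unfolding set_lebesgue_integral_def
        by (intro Bochner_Integration.integral_cong) (use 2 in \<open>auto simp: H_def indicator_def\<close>)
      then show ?thesis using total by simp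
    next
      case 3
      \<comment> \<open>Trapezoids vanishing at 0, rising with slope \<open>n\<close> to height 1,
        and falling with slope \<open>- n\<close> from \<open>a\<close> on. They converge to the
        indicator of the points of \<open>{0..<1}\<close> up to \<open>a\<close>, except at the
        point 0.\<close>
      define f where "f n u = max 0 (min 1 (min (real n * u) (1 + real n * (a - u))))" for n u
      have lim: "(\<lambda>n. \<integral>u. H u * f n u \<partial>lborel) \<longlonglongrightarrow> (\<integral>u. indicator {..a} u *\<^sub>R H u \<partial>lborel)"
      proof (rule integral_dominated_convergence[where w = "\<lambda>u. \<bar>H u\<bar>"])
        show "(\<lambda>u. indicator {..a} u *\<^sub>R H u) \<in> borel_measurable lborel" using H by (intro borel_measurable_scaleR) auto
        show "(\<lambda>u. H u * f n u) \<in> borel_measurable lborel" for n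
          using H unfolding f_def by (intro borel_measurable_times borel_measurable_max borel_measurable_min) auto
        show "integrable lborel (\<lambda>u. \<bar>H u\<bar>)" using H by auto
        show "AE u in lborel. norm (H u * f n u) \<le> \<bar>H u\<bar>" for n
          by (intro always_eventually allI) (auto simp: abs_mult f_def intro!: mult_left_le)
        show "AE u in lborel. (\<lambda>n. H u * f n u) \<longlonglongrightarrow> indicator {..a} u *\<^sub>R H u"
          using AE_lborel_singleton[of 0]
        proof eventually_elim
          case (elim u)
          show ?case
          proof (cases "u \<in> {0..<1}")
            case False then show ?thesis by (simp add: H_def)
          next
            case True
            then have u: "0 < u" using elim by auto
            have "\<forall>\<^sub>F n in sequentially. f n u = indicator {..a} u"
            proof (cases "u \<le> a")
              case True
              obtain m :: nat where "1 / u < real m" using reals_Archimedean2 by blast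
              then have m: "1 \<le> real m * u" using u by (simp add: field_simps)
              show ?thesis
              proof (rule eventually_sequentiallyI[of m])
                fix n assume "m \<le> n"
                then have "real m * u \<le> real n * u" using u by (intro mult_right_mono) auto
                moreover have "0 \<le> real n * (a - u)" using True by simp
                ultimately show "f n u = indicator {..a} u" using m True unfolding f_def by simp
              qed
            next
              case False
              obtain m :: nat where "1 / (u - a) < real m" using reals_Archimedean2 by blast
              then have m: "1 \<le> real m * (u - a)" using False by (simp add: field_simps)
              show ?thesis
              proof (rule eventually_sequentiallyI[of m])
                fix n assume "m \<le> n"
                then have "real m * (u - a) \<le> real n * (u - a)" using False by (intro mult_right_mono) auto
                then have "1 + real n * (a - u) \<le> 0" using m by (simp add: algebra_simps)
                then show "f n u = indicator {..a} u" using False unfolding f_def by simp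
              qed
            qed
            then have "\<forall>\<^sub>F n in sequentially. indicator {..a} u *\<^sub>R H u = H u * f n u"
              by eventually_elim simp
            then show ?thesis by (rule Lim_transform_eventually[OF tendsto_const])
          qed
        qed
      qed
      \<comment> \<open>From this index on the trapezoid has returned to 0 before reaching 1, so its
        values at 0 and 1 agree and it is an admissible test function.\<close>
      obtain m :: nat where "1 / (1 - a) < real m" using reals_Archimedean2 by blast
      then have m: "1 \<le> real m * (1 - a)" using 3 by (simp add: field_simps)
      have "\<forall>\<^sub>F n in sequentially. 0 = (\<integral>u. H u * f n u \<partial>lborel)"
      proof (rule eventually_sequentiallyI[of m])
        fix n assume "m \<le> n"
        then have "real m * (1 - a) \<le> real n * (1 - a)" using 3 by (intro mult_right_mono) auto
        then have "1 + real n * (a - 1) \<le> 0" using m by (simp add: algebra_simps)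
        then have "f n 0 = f n 1" unfolding f_def by simp
        moreover have "continuous_on {0..1} (f n)"
          unfolding f_def by (intro continuous_intros continuous_on_max continuous_on_min)
        ultimately have "circle_int (\<lambda>u. h u * f n u) = 0" by (intro zero)
        then show "0 = (\<integral>u. H u * f n u \<partial>lborel)"
          by (simp add: H_def[abs_def] set_lebesgue_integral_def mult.assoc)
      qed
      then have "(\<lambda>n. \<integral>u. H u * f n u \<partial>lborel) \<longlonglongrightarrow> 0"
        by (rule Lim_transform_eventually[OF tendsto_const])
      then show ?thesis using LIMSEQ_unique[OF lim] by (simp add: set_lebesgue_integral_def)
    qed
  qed
  have all: "(LBINT u:A. H u) = 0" if "A \<in> sets lborel" for A
  proof -
    have "Int_stable (range (\<lambda>a::real. {..a}))" by (auto simp: Int_stable_def)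
    moreover have "range (\<lambda>a::real. {..a}) \<subseteq> Pow UNIV" by auto
    moreover have "A \<in> sigma_sets UNIV (range (\<lambda>a::real. {..a}))"
      using that by (simp add: borel_eq_atMost)
    ultimately show ?thesis
    proof (induction rule: sigma_sets_induct_disjoint)
      case (basic A) then show ?case using half by auto
    next
      case empty show ?case by (simp add: set_lebesgue_integral_def)
    next
      case (compl A)
      have A: "A \<in> sets lborel" using compl(1) by (simp add: borel_eq_atMost)
      have "(LBINT u:UNIV - A. H u) = (\<integral>u. H u - indicator A u *\<^sub>R H u \<partial>lborel)"
        unfolding set_lebesgue_integral_def by (intro Bochner_Integration.integral_cong) (auto simp: indicator_def)
      also have "\<dots> = (\<integral>u. H u \<partial>lborel) - (LBINT u:A. H u)"
        unfolding set_lebesgue_integral_def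
        using integrable_mult_indicator[OF A H] H by (intro Bochner_Integration.integral_diff) auto
      finally show ?case using compl total by simp
    next
      case (union A)
      have A: "A i \<in> sets lborel" for i using union(2) by (auto simp: borel_eq_atMost)
      have "set_integrable lborel (\<Union>i. A i) H"
        unfolding set_integrable_def using A by (intro integrable_mult_indicator H) auto
      then have "(LBINT u:(\<Union>i. A i). H u) = (\<Sum>i. (LBINT u:A i. H u))"
        using union(1) A by (intro lebesgue_integral_countable_add) (auto simp: disjoint_family_on_def)
      then show ?case using union(3) by simp
    qed
  qed
  have "AE u in lborel. H u = 0"
    by (rule density_unique_real[OF H]) (use all in \<open>auto simp: set_lebesgue_integral_def\<close>)
  then show ?thesis by eventually_elim (auto simp: H_def)
qed

lemma set_integrable_mult_continuous:
  fixes h f :: "real \<Rightarrow> real"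
  assumes h: "set_integrable lborel {0..<1} h" and f: "continuous_on {0..1} f"
  shows "set_integrable lborel {0..<1} (\<lambda>u. h u * f u)"
proof -
  have "compact (f ` {0..1})" by (intro compact_continuous_image f) auto
  then have "bounded (f ` {0..1})" by (rule compact_imp_bounded)
  then obtain C where "\<forall>y\<in>f ` {0..1}. norm y \<le> C" unfolding bounded_iff by blast
  then have C: "\<bar>f u\<bar> \<le> C" if "u \<in> {0..1}" for u using that by auto
  have H: "integrable lborel (\<lambda>u. indicator {0..<1} u *\<^sub>R h u)" using h by (simp add: set_integrable_def)
  have F: "integrable lborel (\<lambda>u. indicator {0..<1} u *\<^sub>R f u)"
    using set_integrable_continuous_Ico[OF f] by (simp add: set_integrable_def)
  have "integrable lborel (\<lambda>u. (indicator {0..<1} u *\<^sub>R h u) * (indicator {0..<1} u *\<^sub>R f u))"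
  proof (rule Bochner_Integration.integrable_bound)
    show "integrable lborel (\<lambda>u. C * (indicator {0..<1} u *\<^sub>R h u))"
      by (rule integrable_mult_right[OF H])
    show "(\<lambda>u. (indicator {0..<1} u *\<^sub>R h u) * (indicator {0..<1} u *\<^sub>R f u)) \<in> borel_measurable lborel"
      by (rule borel_measurable_times[OF borel_measurable_integrable[OF H] borel_measurable_integrable[OF F]])
    have "\<bar>h u\<bar> * \<bar>f u\<bar> \<le> \<bar>C\<bar> * \<bar>h u\<bar>" if "u \<in> {0..<1}" for u
    proof -
      have "\<bar>f u\<bar> \<le> \<bar>C\<bar>" using C[of u] that by auto
      then have "\<bar>h u\<bar> * \<bar>f u\<bar> \<le> \<bar>h u\<bar> * \<bar>C\<bar>" by (rule mult_left_mono) simp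
      then show ?thesis by (simp only: mult.commute)
    qed
    then show "AE u in lborel. norm ((indicator {0..<1} u *\<^sub>R h u) * (indicator {0..<1} u *\<^sub>R f u))
        \<le> norm (C * (indicator {0..<1} u *\<^sub>R h u))"
      by (intro always_eventually allI) (auto simp: indicator_def abs_mult)
  qed
  moreover have "(\<lambda>u. (indicator {0..<1} u *\<^sub>R h u) * (indicator {0..<1} u *\<^sub>R f u)) =
      (\<lambda>u. indicator {0..<1} u *\<^sub>R (h u * f u))" by (auto simp: indicator_def)
  ultimately show ?thesis by (simp add: set_integrable_def)
qed

section \<open>Fourier coefficients of the heat flow and identification of weak solutions\<close>

context
  fixes \<phi> :: "real \<Rightarrow> real" and R :: "real \<Rightarrow> real \<Rightarrow> real"
  assumes R: "is_heat_flow \<phi> R"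
begin

lemma heat_flow_continuous:
  assumes "0 \<le> t"
  shows "continuous_on S (R t)"
proof -
  have "continuous_on ({0..} \<times> UNIV) (\<lambda>(t, u). R t u)" using R by (simp add: is_heat_flow_def)
  moreover have "continuous_on S (\<lambda>u. (t, u))" by (intro continuous_intros)
  ultimately have "continuous_on S (\<lambda>u. (\<lambda>(t, u). R t u) (t, u))"
    by (rule continuous_on_compose2) (use assms in auto)
  then show ?thesis by simp
qed

lemma heat_flow_approx:
  "0 < \<epsilon> \<Longrightarrow> \<exists>xs. (\<forall>u. \<bar>trig xs 0 u - \<phi> u\<bar> \<le> \<epsilon>) \<and> (\<forall>t\<ge>0. \<forall>u. \<bar>trig xs t u - R t u\<bar> \<le> \<epsilon>)"
  using R unfolding is_heat_flow_def by simp

lemma heat_flow_periodic: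
  assumes "0 \<le> t"
  shows "R t (u + 1) = R t u"
proof -
  have "\<bar>R t (u + 1) - R t u\<bar> \<le> 0 + \<epsilon>" if e: "0 < \<epsilon>" for \<epsilon>
  proof -
    obtain xs where "\<forall>t\<ge>0. \<forall>u. \<bar>trig xs t u - R t u\<bar> \<le> \<epsilon> / 2"
      using heat_flow_approx[OF half_gt_zero[OF e]] by (elim exE conjE)
    then have xs: "\<bar>trig xs t u - R t u\<bar> \<le> \<epsilon> / 2" if "0 \<le> t" for t u using that by simp
    show ?thesis using xs[OF assms, of u] xs[OF assms, of "u + 1"] trig_periodic[of xs t u] by linarith
  qed
  then have "\<bar>R t (u + 1) - R t u\<bar> \<le> 0" by (rule field_le_epsilon)
  then show ?thesis by simp
qed

text \<open>Exact for trigonometric polynomials. Both sides change by at most half of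
  \<open>\<epsilon>\<close> under the approximation, because the cosine and the decay factor are
  bounded by 1.\<close>

lemma heat_flow_coeff:
  assumes \<phi>: "torus_continuous \<phi>" and t: "0 \<le> t"
  shows "circle_int (\<lambda>u. R t u * cos (2 * pi * real_of_int k * u + \<theta>)) =
    circle_int (\<lambda>u. \<phi> u * cos (2 * pi * real_of_int k * u + \<theta>)) * exp (- (2 * pi * real_of_int k)\<^sup>2 * t)"
proof -
  let ?f = "\<lambda>u. cos (2 * pi * real_of_int k * u + \<theta>)" and ?e = "exp (- (2 * pi * real_of_int k)\<^sup>2 * t)"
  have e1: "?e \<le> 1" using t by simp
  have c\<phi>: "continuous_on S \<phi>" for S
    using \<phi> continuous_on_subset[OF _ subset_UNIV] unfolding torus_continuous_def by blast
  have "\<bar>circle_int (\<lambda>u. R t u * ?f u) - circle_int (\<lambda>u. \<phi> u * ?f u) * ?e\<bar> \<le> 0 + \<epsilon>" if e: "0 < \<epsilon>" for \<epsilon>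
  proof -
    obtain xs where xs': "\<forall>u. \<bar>trig xs 0 u - \<phi> u\<bar> \<le> \<epsilon> / 2" "\<forall>t\<ge>0. \<forall>u. \<bar>trig xs t u - R t u\<bar> \<le> \<epsilon> / 2"
      using heat_flow_approx[OF half_gt_zero[OF e]] by (elim exE conjE)
    have xs: "\<bar>trig xs 0 u - \<phi> u\<bar> \<le> \<epsilon> / 2" "0 \<le> t \<Longrightarrow> \<bar>trig xs t u - R t u\<bar> \<le> \<epsilon> / 2" for t u
      using xs' by simp_all
    have close: "\<bar>circle_int (\<lambda>u. f u * ?f u) - circle_int (\<lambda>u. g u * ?f u)\<bar> \<le> \<epsilon> / 2"
      if "continuous_on {0..1} f" "continuous_on {0..1} g" "\<And>u. \<bar>f u - g u\<bar> \<le> \<epsilon> / 2" for f g :: "real \<Rightarrow> real"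
    proof -
      have i1: "set_integrable lborel {0..<1} (\<lambda>u. f u * ?f u)"
        by (rule set_integrable_continuous_Ico[OF continuous_on_mult[OF that(1) continuous_on_cos_affine]])
      have i2: "set_integrable lborel {0..<1} (\<lambda>u. g u * ?f u)"
        by (rule set_integrable_continuous_Ico[OF continuous_on_mult[OF that(2) continuous_on_cos_affine]])
      have le: "\<bar>f u * ?f u - g u * ?f u\<bar> \<le> \<epsilon> / 2" for u
      proof -
        have "\<bar>f u - g u\<bar> * \<bar>?f u\<bar> \<le> \<epsilon> / 2 * 1"
          using that(3)[of u] e by (intro mult_mono abs_cos_le_one) auto
        moreover have "\<bar>f u * ?f u - g u * ?f u\<bar> = \<bar>f u - g u\<bar> * \<bar>?f u\<bar>"
          by (simp only: abs_mult[symmetric] left_diff_distrib)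
        ultimately show ?thesis by simp
      qed
      have "\<bar>circle_int (\<lambda>u. f u * ?f u - g u * ?f u)\<bar> \<le> \<epsilon> / 2"
        by (rule circle_int_abs_le[OF set_integral_diff(1)[OF i1 i2] le])
      then show ?thesis unfolding set_integral_diff(2)[OF i1 i2] .
    qed
    define A where "A = circle_int (\<lambda>u. trig xs 0 u * ?f u)"
    define B where "B = circle_int (\<lambda>u. \<phi> u * ?f u)"
    define D where "D = circle_int (\<lambda>u. R t u * ?f u)"
    define e where "e = ?e"
    have "\<bar>circle_int (\<lambda>u. trig xs t u * ?f u) - D\<bar> \<le> \<epsilon> / 2"
      unfolding D_def by (rule close[OF continuous_on_trig_space heat_flow_continuous[OF t] xs(2)[OF t]])
    then have 1: "\<bar>e * A - D\<bar> \<le> \<epsilon> / 2"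
      unfolding circle_int_trig_cos[of xs t] A_def e_def .
    have "\<bar>A - B\<bar> \<le> \<epsilon> / 2"
      unfolding A_def B_def by (rule close[OF continuous_on_trig_space c\<phi> xs(1)])
    moreover have "0 \<le> e" "e \<le> 1" using e1 by (simp_all add: e_def)
    ultimately have "e * \<bar>A - B\<bar> \<le> 1 * (\<epsilon> / 2)" by (intro mult_mono) auto
    moreover have "\<bar>e * A - e * B\<bar> = e * \<bar>A - B\<bar>"
      using \<open>0 \<le> e\<close> by (simp only: right_diff_distrib[symmetric] abs_mult abs_of_nonneg)
    ultimately have "\<bar>D - B * e\<bar> \<le> 0 + \<epsilon>" using 1 unfolding mult.commute[of B e] by linarith
    then show ?thesis unfolding A_def B_def D_def e_def .
  qed
  then have "\<bar>circle_int (\<lambda>u. R t u * ?f u) - circle_int (\<lambda>u. \<phi> u * ?f u) * ?e\<bar> \<le> 0"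
    by (rule field_le_epsilon)
  then show ?thesis by (simp only: abs_le_zero_iff right_minus_eq)
qed

text \<open>The difference \<open>h\<close> at time \<open>t\<close> has vanishing Fourier
  coefficients, hence is orthogonal to trigonometric polynomials and, by uniform density and
  integrability of \<open>h\<close>, to every continuous test function with equal end values. The
  conclusion holds at each individual time, with a null set that may depend on it.\<close>

lemma weak_solution_unique:
  assumes \<phi>: "torus_continuous \<phi>" and \<rho>: "heat_weak_solution \<phi> \<rho>" and t: "0 \<le> t"
  shows "AE u in lborel. u \<in> {0..<1} \<longrightarrow> \<rho> t u = R t u"
proof -
  define h where "h u = \<rho> t u - R t u" for u
  have i\<rho>: "set_integrable lborel {0..<1} (\<rho> t)" using \<rho> t by (simp add: heat_weak_solution_def)
  have iR: "set_integrable lborel {0..<1} (R t)"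
    by (intro set_integrable_continuous_Ico heat_flow_continuous t)
  have h: "set_integrable lborel {0..<1} h" unfolding h_def[abs_def] by (intro set_integral_diff i\<rho> iR)
  have ih: "set_integrable lborel {0..<1} (\<lambda>u. h u * f u)" if "continuous_on {0..1} f" for f
    by (rule set_integrable_mult_continuous[OF h that])
  have cos0: "circle_int (\<lambda>u. h u * cos (2 * pi * real_of_int k * u + \<theta>)) = 0" for k \<theta>
    unfolding h_def left_diff_distrib
    by (subst circle_int_diff)
      (simp_all only: set_integrable_mult_continuous i\<rho> iR continuous_on_cos_affine
        weak_solution_coeff[OF \<rho> t] heat_flow_coeff[OF \<phi> t] diff_self)
  have trig0: "circle_int (\<lambda>u. h u * trig xs 0 u) = 0" for xs
  proof (induction xs)
    case Nil then show ?case by (simp add: set_lebesgue_integral_def)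
  next
    case (Cons a xs)
    obtain c k \<theta> where a: "a = (c, k, \<theta>)" by (cases a)
    let ?f = "\<lambda>u. cos (2 * pi * real_of_int k * u + \<theta>)"
    have "h u * trig (a # xs) 0 u = c * (h u * ?f u) + h u * trig xs 0 u" for u
      by (simp add: a algebra_simps)
    moreover have "set_integrable lborel {0..<1} (\<lambda>u. c * (h u * ?f u))"
      by (intro set_integrable_mult_right ih continuous_on_cos_affine)
    moreover have "set_integrable lborel {0..<1} (\<lambda>u. h u * trig xs 0 u)"
      by (intro ih continuous_on_trig_space)
    ultimately show ?case using Cons cos0[of k \<theta>] by (simp only: circle_int_add set_integral_mult_right mult_zero_right add_0)
  qed
  have "AE u in lborel. u \<in> {0..<1} \<longrightarrow> h u = 0"
  proof (rule AE_zero_of_continuous_tests[OF h])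
    fix f :: "real \<Rightarrow> real" assume f: "continuous_on {0..1} f" "f 0 = f 1"
    define I where "I = circle_int (\<lambda>u. \<bar>h u\<bar>)"
    have iabs: "set_integrable lborel {0..<1} (\<lambda>u. \<bar>h u\<bar>)" by (rule set_integrable_abs[OF h])
    have I: "0 \<le> I" unfolding I_def set_lebesgue_integral_def by (rule Bochner_Integration.integral_nonneg) simp
    have "\<bar>circle_int (\<lambda>u. h u * f u)\<bar> \<le> 0 + \<epsilon>" if e: "0 < \<epsilon>" for \<epsilon>
    proof -
      \<comment> \<open>Uniform accuracy \<open>d\<close> produces an error of at most
        \<open>d * I\<close>, where \<open>I\<close> is the integral of
        \<open>\<bar>h\<bar>\<close>; adding 1 to the denominator covers
        \<open>I = 0\<close>.\<close>
      define d where "d = \<epsilon> / (I + 1)"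
      have d: "0 < d" using e I by (simp add: d_def)
      obtain xs where xs: "\<And>u. u \<in> {0..1} \<Longrightarrow> \<bar>trig xs 0 u - f u\<bar> < d"
        using trig_dense[OF f d] by blast
      let ?g = "\<lambda>u. h u * f u - h u * trig xs 0 u"
      have ig: "set_integrable lborel {0..<1} ?g"
        by (intro set_integral_diff ih f continuous_on_trig_space)
      have "circle_int (\<lambda>u. h u * f u) = circle_int ?g"
        using trig0[of xs] by (simp only: circle_int_diff ih f continuous_on_trig_space diff_zero)
      then have "\<bar>circle_int (\<lambda>u. h u * f u)\<bar> \<le> circle_int (\<lambda>u. \<bar>?g u\<bar>)"
        using set_integral_norm_bound[OF ig] by simp
      also have "\<dots> \<le> circle_int (\<lambda>u. d * \<bar>h u\<bar>)"
      proof (rule set_integral_mono)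
        show "set_integrable lborel {0..<1} (\<lambda>u. \<bar>?g u\<bar>)" by (rule set_integrable_abs[OF ig])
        show "set_integrable lborel {0..<1} (\<lambda>u. d * \<bar>h u\<bar>)" by (intro set_integrable_mult_right iabs)
        fix u :: real assume u: "u \<in> {0..<1}"
        have "\<bar>?g u\<bar> = \<bar>h u\<bar> * \<bar>trig xs 0 u - f u\<bar>"
          unfolding abs_mult[symmetric] right_diff_distrib by (rule abs_minus_commute)
        also have "\<dots> \<le> \<bar>h u\<bar> * d" using xs[of u] u by (intro mult_left_mono) auto
        finally show "\<bar>?g u\<bar> \<le> d * \<bar>h u\<bar>" by (simp add: mult.commute)
      qed
      also have "\<dots> = d * I" unfolding I_def by (rule set_integral_mult_right)
      also have "\<dots> \<le> \<epsilon>" using I e by (simp add: d_def field_simps)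
      finally show ?thesis by simp
    qed
    then have "\<bar>circle_int (\<lambda>u. h u * f u)\<bar> \<le> 0" by (rule field_le_epsilon)
    then show "circle_int (\<lambda>u. h u * f u) = 0" by simp
  qed
  then show ?thesis by eventually_elim (simp add: h_def)
qed

text \<open>Almost everywhere equality at the fixed time suffices. As the indicator is idempotent,
  the integrand splits into factors whose measurability is known one by one.\<close>

lemma weak_solution_square_integral:
  assumes \<phi>: "torus_continuous \<phi>" and \<rho>: "heat_weak_solution \<phi> \<rho>" and t: "0 \<le> t"
    and g: "continuous_on {0..1} g"
  shows "circle_int (\<lambda>u. (\<rho> t u)\<^sup>2 * g u) = circle_int (\<lambda>u. (R t u)\<^sup>2 * g u)"
proof -
  let ?i = "indicator {0..<1} :: real \<Rightarrow> real"
  have m: "(\<lambda>u. ?i u *\<^sub>R \<rho> t u) \<in> borel_measurable lborel"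
    using \<rho> t by (auto simp: heat_weak_solution_def set_integrable_def)
  have g: "(\<lambda>u. ?i u *\<^sub>R g u) \<in> borel_measurable lborel"
    using set_integrable_continuous_Ico[OF g] by (auto simp: set_integrable_def)
  have mR: "(\<lambda>u. ?i u *\<^sub>R R t u) \<in> borel_measurable lborel"
    using set_integrable_continuous_Ico[OF heat_flow_continuous[OF t]] by (auto simp: set_integrable_def)
  have eq: "(\<lambda>u. ?i u *\<^sub>R ((f u)\<^sup>2 * g u)) = (\<lambda>u. (?i u *\<^sub>R f u)\<^sup>2 * (?i u *\<^sub>R g u))" for f
    by (auto simp: indicator_def)
  show ?thesis
    unfolding set_lebesgue_integral_def eq
  proof (rule integral_cong_AE)
    show "AE u in lborel. (?i u *\<^sub>R \<rho> t u)\<^sup>2 * (?i u *\<^sub>R g u) = (?i u *\<^sub>R R t u)\<^sup>2 * (?i u *\<^sub>R g u)"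
      using weak_solution_unique[OF \<phi> \<rho> t] by eventually_elim (auto simp: indicator_def)
  qed (intro borel_measurable_times borel_measurable_power m mR g)+
qed

end

section \<open>Uniform limits over the time interval\<close>

lemma step_function_eq:
  fixes c :: "nat \<Rightarrow> real"
  assumes N: "0 < N"
  shows "indicator {0..<1} u *\<^sub>R c (nat \<lfloor>u * real N\<rfloor>) =
    (\<Sum>x<N. c x * indicator {real x / real N..<real (x + 1) / real N} u)"
proof -
  have mem: "u \<in> {real x / real N..<real (x + 1) / real N} \<longleftrightarrow> 0 \<le> u \<and> nat \<lfloor>u * real N\<rfloor> = x" for x
  proof
    assume "u \<in> {real x / real N..<real (x + 1) / real N}"
    then have "real x \<le> u * real N" "u * real N < real x + 1" using N by (simp_all add: field_simps)
    moreover from this have "0 \<le> u * real N" by linarith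
    then have "0 \<le> u" using N by (simp add: zero_le_mult_iff)
    ultimately show "0 \<le> u \<and> nat \<lfloor>u * real N\<rfloor> = x" by linarith
  next
    assume A: "0 \<le> u \<and> nat \<lfloor>u * real N\<rfloor> = x"
    then have "0 \<le> u * real N" by simp
    then have "real x \<le> u * real N" "u * real N < real x + 1" using A by linarith+
    then show "u \<in> {real x / real N..<real (x + 1) / real N}" using N by (simp add: field_simps)
  qed
  show ?thesis
  proof (cases "u \<in> {0..<1}")
    case True
    define k where "k = nat \<lfloor>u * real N\<rfloor>"
    have "u * real N < real N" "0 \<le> u * real N" using True N by auto
    then have k: "k < N" unfolding k_def by linarith
    have "(\<Sum>x<N. c x * indicator {real x / real N..<real (x + 1) / real N} u) = (\<Sum>x<N. if x = k then c k else 0)"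
      by (intro sum.cong) (use mem True k_def in \<open>auto simp: indicator_def\<close>)
    then show ?thesis using k True by (simp add: k_def)
  next
    case False
    have "u \<notin> {real x / real N..<real (x + 1) / real N}" if "x < N" for x
    proof
      assume a: "u \<in> {real x / real N..<real (x + 1) / real N}"
      have "real (x + 1) / real N \<le> 1" "0 \<le> real x / real N" using that by auto
      moreover have "real x / real N \<le> u" "u < real (x + 1) / real N" using a by (simp_all only: atLeastLessThan_iff)
      ultimately have "0 \<le> u" "u < 1" by linarith+
      then show False using False by simp
    qed
    then have "(\<Sum>x<N. c x * indicator {real x / real N..<real (x + 1) / real N} u) = 0"
      by (intro sum.neutral) (auto simp: indicator_def)
    then show ?thesis using False by simp
  qed
qed

lemma circle_int_step:
  assumes N: "0 < N"
  shows "set_integrable lborel {0..<1} (\<lambda>u. c (nat \<lfloor>u * real N\<rfloor>))"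
    and "circle_int (\<lambda>u. c (nat \<lfloor>u * real N\<rfloor>)) = (\<Sum>x<N. c x) / real N"
proof -
  have i: "integrable lborel (\<lambda>u. c x * indicator {real x / real N..<real (x + 1) / real N} u)" for x
  proof -
    have "real x / real N \<le> real (x + 1) / real N" by (intro divide_right_mono) auto
    then have "emeasure lborel {real x / real N..<real (x + 1) / real N} < \<infinity>"
      by (subst emeasure_lborel_Ico) auto
    then show ?thesis by (intro integrable_mult_right integrable_real_indicator) auto
  qed
  show "set_integrable lborel {0..<1} (\<lambda>u. c (nat \<lfloor>u * real N\<rfloor>))"
    unfolding set_integrable_def step_function_eq[OF N] by (intro Bochner_Integration.integrable_sum i)
  have len: "measure lborel {real x / real N..<real (x + 1) / real N} = 1 / real N" for x
  proof -
    have "real x / real N \<le> real (x + 1) / real N" by (intro divide_right_mono) auto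
    then show ?thesis by (simp add: diff_divide_distrib[symmetric])
  qed
  have "circle_int (\<lambda>u. c (nat \<lfloor>u * real N\<rfloor>)) =
      (\<Sum>x<N. \<integral>u. c x * indicator {real x / real N..<real (x + 1) / real N} u \<partial>lborel)"
    unfolding set_lebesgue_integral_def step_function_eq[OF N]
    by (rule Bochner_Integration.integral_sum) (rule i)
  also have "\<dots> = (\<Sum>x<N. c x * (1 / real N))"
    by (intro sum.cong refl) (simp only: integral_mult_right_zero Bochner_Integration.integral_indicator len Int_UNIV_right space_lborel space_borel)
  finally show "circle_int (\<lambda>u. c (nat \<lfloor>u * real N\<rfloor>)) = (\<Sum>x<N. c x) / real N"
    by (simp add: sum_divide_distrib)
qed

lemma unif_cont_rectangle:
  fixes S :: "real \<Rightarrow> real \<Rightarrow> real"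
  assumes S: "continuous_on ({0..T} \<times> {0..1}) (\<lambda>(t, u). S t u)" and \<epsilon>: "0 < \<epsilon>"
  shows "\<exists>\<delta>>0. \<forall>t\<in>{0..T}. \<forall>t'\<in>{0..T}. \<forall>u\<in>{0..1}. \<forall>u'\<in>{0..1}.
    \<bar>t - t'\<bar> \<le> \<delta> \<longrightarrow> \<bar>u - u'\<bar> \<le> \<delta> \<longrightarrow> \<bar>S t u - S t' u'\<bar> \<le> \<epsilon>"
proof -
  have "compact ({0..T} \<times> {0..1::real})" by (intro compact_Times) auto
  then have "uniformly_continuous_on ({0..T} \<times> {0..1}) (\<lambda>(t, u). S t u)"
    by (rule compact_uniformly_continuous[OF S])
  then obtain d where d: "0 < d"
    and D: "\<forall>p\<in>{0..T} \<times> {0..1}. \<forall>p'\<in>{0..T} \<times> {0..1}. dist p' p < d \<longrightarrow> dist (case p' of (t, u) \<Rightarrow> S t u) (case p of (t, u) \<Rightarrow> S t u) < \<epsilon>"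
    unfolding uniformly_continuous_on_def using \<epsilon> by blast
  show ?thesis
  proof (intro exI[of _ "d / 3"] conjI ballI impI)
    fix t t' u u' :: real assume A: "t \<in> {0..T}" "t' \<in> {0..T}" "u \<in> {0..1}" "u' \<in> {0..1}" "\<bar>t - t'\<bar> \<le> d / 3" "\<bar>u - u'\<bar> \<le> d / 3"
    have "dist (t, u) (t', u') \<le> \<bar>t - t'\<bar> + \<bar>u - u'\<bar>"
      unfolding dist_Pair_Pair dist_real_def by (intro sqrt_sum_squares_le_sum) auto
    also have "\<dots> < d" using A d by linarith
    finally have "dist (t, u) (t', u') < d" .
    moreover have "(t, u) \<in> {0..T} \<times> {0..1}" "(t', u') \<in> {0..T} \<times> {0..1}" using A by auto
    ultimately have "dist (case (t, u) of (t, u) \<Rightarrow> S t u) (case (t', u') of (t, u) \<Rightarrow> S t u) < \<epsilon>"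
      using D by blast
    then show "\<bar>S t u - S t' u'\<bar> \<le> \<epsilon>" by (simp add: dist_real_def)
  qed (use d in simp)
qed

lemma bounded_rectangle:
  fixes S :: "real \<Rightarrow> real \<Rightarrow> real"
  assumes S: "continuous_on ({0..T} \<times> {0..1}) (\<lambda>(t, u). S t u)"
  shows "\<exists>C\<ge>1. \<forall>t\<in>{0..T}. \<forall>u\<in>{0..1}. \<bar>S t u\<bar> \<le> C"
proof -
  have "compact ({0..T} \<times> {0..1::real})" by (intro compact_Times) auto
  then have "bounded ((\<lambda>(t, u). S t u) ` ({0..T} \<times> {0..1}))"
    by (intro compact_imp_bounded compact_continuous_image S)
  then obtain C where C: "\<forall>y\<in>(\<lambda>(t, u). S t u) ` ({0..T} \<times> {0..1}). norm y \<le> C" unfolding bounded_iff by blast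
  have "\<bar>S t u\<bar> \<le> max 1 C" if "t \<in> {0..T}" "u \<in> {0..1}" for t u
  proof -
    have "S t u \<in> (\<lambda>(t, u). S t u) ` ({0..T} \<times> {0..1})" using that by force
    then have "norm (S t u) \<le> C" using C by blast
    then show ?thesis by simp
  qed
  then show ?thesis by (intro exI[of _ "max 1 C"]) auto
qed

lemma continuous_on_slice:
  assumes "continuous_on ({0..T} \<times> A) (\<lambda>(t, u). S t u)" "t \<in> {0..T}"
  shows "continuous_on A (\<lambda>u. S t u)"
proof -
  have "continuous_on A (\<lambda>u. (t, u))" by (intro continuous_intros)
  moreover have "Pair t ` A \<subseteq> {0..T} \<times> A" using assms(2) by auto
  ultimately show ?thesis using continuous_on_compose2[OF assms(1)] by fastforce
qed

lemma riemann_sum_limit: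
  fixes S :: "real \<Rightarrow> real \<Rightarrow> real"
  assumes S: "continuous_on ({0..T} \<times> {0..1}) (\<lambda>(t, u). S t u)" and \<epsilon>: "0 < \<epsilon>"
  shows "\<exists>N0>0. \<forall>N\<ge>N0. \<forall>t\<in>{0..T}. \<bar>(\<Sum>x<N. S t (real x / real N)) / real N - circle_int (S t)\<bar> \<le> \<epsilon>"
proof -
  obtain \<delta> where \<delta>: "0 < \<delta>" and D: "\<forall>t\<in>{0..T}. \<forall>t'\<in>{0..T}. \<forall>u\<in>{0..1}. \<forall>u'\<in>{0..1}.
    \<bar>t - t'\<bar> \<le> \<delta> \<longrightarrow> \<bar>u - u'\<bar> \<le> \<delta> \<longrightarrow> \<bar>S t u - S t' u'\<bar> \<le> \<epsilon>"
    using unif_cont_rectangle[OF S \<epsilon>] by (elim exE conjE)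
  obtain N0 :: nat where N0: "1 / \<delta> < real N0" using reals_Archimedean2[of "1 / \<delta>"] by (elim exE)
  have "0 < 1 / \<delta>" using \<delta> by simp
  then have N0': "0 < N0" using N0 by (cases N0) auto
  show ?thesis
  proof (intro exI[of _ N0] conjI N0' allI impI ballI)
    fix N t assume N: "N0 \<le> N" and t: "t \<in> {0..T}"
    have Npos: "0 < N" using N N0' by simp
    have "1 / \<delta> < real N" using N N0 by linarith
    then have n: "1 / real N \<le> \<delta>" using \<delta> Npos by (simp add: field_simps)
    let ?c = "\<lambda>x. S t (real x / real N)"
    have i1: "set_integrable lborel {0..<1} (\<lambda>u. ?c (nat \<lfloor>u * real N\<rfloor>))" by (rule circle_int_step(1)[OF Npos])
    have i2: "set_integrable lborel {0..<1} (S t)"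
      by (intro set_integrable_continuous_Ico continuous_on_slice[OF S t])
    have "\<bar>circle_int (\<lambda>u. ?c (nat \<lfloor>u * real N\<rfloor>) - S t u)\<bar> \<le> \<epsilon>"
    proof (rule circle_int_abs_le[OF set_integral_diff(1)[OF i1 i2]])
      fix u :: real assume u: "u \<in> {0..<1}"
      let ?v = "real (nat \<lfloor>u * real N\<rfloor>) / real N"
      have "0 \<le> u * real N" using u by simp
      then have "real (nat \<lfloor>u * real N\<rfloor>) \<le> u * real N" "u * real N < real (nat \<lfloor>u * real N\<rfloor>) + 1" by linarith+
      then have v: "?v \<le> u" "u < ?v + 1 / real N" using Npos by (simp_all add: field_simps)
      have "0 \<le> ?v" by simp
      then have "?v \<in> {0..1}" "u \<in> {0..1}" "\<bar>?v - u\<bar> \<le> \<delta>" using v u n by auto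
      then show "\<bar>?c (nat \<lfloor>u * real N\<rfloor>) - S t u\<bar> \<le> \<epsilon>" using D t \<delta> by simp
    qed
    then show "\<bar>(\<Sum>x<N. S t (real x / real N)) / real N - circle_int (S t)\<bar> \<le> \<epsilon>"
      unfolding set_integral_diff(2)[OF i1 i2] circle_int_step(2)[OF Npos, of ?c] .
  qed
qed

section \<open>Fixed-time exponential bounds for initial profiles with values between 0 and
  1\<close>

context
  fixes \<phi> :: "real \<Rightarrow> real" and R :: "real \<Rightarrow> real \<Rightarrow> real" and T :: real
  assumes R: "is_heat_flow \<phi> R" and \<phi>: "\<And>u. 0 \<le> \<phi> u \<and> \<phi> u \<le> 1"
begin

abbreviation (input) "prof N \<equiv> (\<lambda>x::nat. \<phi> (real x / real N))"

lemma unit_density_prof: "unit_density N (prof N)"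
  using \<phi> by (simp add: unit_density_def)

lemma heat_flow_continuous_rectangle: "continuous_on ({0..T} \<times> {0..1}) (\<lambda>(t, u). R t u)"
proof -
  have "continuous_on ({0..} \<times> UNIV) (\<lambda>(t, u). R t u)" using R by (simp add: is_heat_flow_def)
  then show ?thesis by (rule continuous_on_subset) auto
qed

lemma pair_mean_limit:
  assumes G: "continuous_on ({0..T} \<times> {0..1}) (\<lambda>(t, u). G t u)" and \<epsilon>: "0 < \<epsilon>"
  shows "\<exists>N0. \<forall>N\<ge>N0. \<forall>K. ssep_kernel N K \<longrightarrow> (\<forall>t\<in>{0<..T}.
    \<bar>(\<Sum>x<N. G t (real x / real N) * (ssep_kernel.mean_density N K t (prof N) x * ssep_kernel.mean_density N K t (prof N) ((x + 1) mod N))) / real N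
     - circle_int (\<lambda>u. (R t u)\<^sup>2 * G t u)\<bar> \<le> \<epsilon>)"
proof -
  obtain B where B: "1 \<le> B" "\<forall>t\<in>{0..T}. \<forall>u\<in>{0..1}. \<bar>G t u\<bar> \<le> B"
    using bounded_rectangle[OF G] by (elim exE conjE)
  obtain C where C: "1 \<le> C" "\<forall>t\<in>{0..T}. \<forall>u\<in>{0..1}. \<bar>R t u\<bar> \<le> C"
    using bounded_rectangle[OF heat_flow_continuous_rectangle] by (elim exE conjE)
  \<comment> \<open>The density at the neighbouring site is off by \<open>2 * \<epsilon>1\<close>
    (hydrodynamic limit and displacement by \<open>1 / N\<close>), the other by
    \<open>\<epsilon>1\<close>. So a product is off by at most \<open>3 * C * \<epsilon>1\<close>,
    and \<open>B\<close> times this is half of \<open>\<epsilon>\<close>; the other half goes to the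
    Riemann sum.\<close>
  define \<epsilon>1 where "\<epsilon>1 = \<epsilon> / (6 * B * C)"
  have \<epsilon>1: "0 < \<epsilon>1" using \<epsilon> B C by (simp add: \<epsilon>1_def)
  obtain \<delta> where \<delta>: "0 < \<delta>" and D: "\<forall>t\<in>{0..T}. \<forall>t'\<in>{0..T}. \<forall>u\<in>{0..1}. \<forall>u'\<in>{0..1}.
    \<bar>t - t'\<bar> \<le> \<delta> \<longrightarrow> \<bar>u - u'\<bar> \<le> \<delta> \<longrightarrow> \<bar>R t u - R t' u'\<bar> \<le> \<epsilon>1"
    using unif_cont_rectangle[OF heat_flow_continuous_rectangle \<epsilon>1] by (elim exE conjE)
  have "continuous_on ({0..T} \<times> {0..1}) (\<lambda>p. ((\<lambda>(t, u). R t u) p)\<^sup>2 * (\<lambda>(t, u). G t u) p)"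
    by (intro continuous_on_mult continuous_on_power heat_flow_continuous_rectangle G)
  then have cont: "continuous_on ({0..T} \<times> {0..1}) (\<lambda>(t, u). (R t u)\<^sup>2 * G t u)"
    by (simp add: case_prod_unfold)
  obtain N1 where N1: "\<forall>N\<ge>N1. \<forall>t\<in>{0..T}.
      \<bar>(\<Sum>x<N. (R t (real x / real N))\<^sup>2 * G t (real x / real N)) / real N - circle_int (\<lambda>u. (R t u)\<^sup>2 * G t u)\<bar> \<le> \<epsilon> / 2"
    using riemann_sum_limit[OF cont half_gt_zero[OF \<epsilon>]] by (elim exE conjE)
  obtain N2 where N2: "\<forall>N\<ge>N2. \<forall>K. ssep_kernel N K \<longrightarrow> (\<forall>t\<in>{0<..T}. \<forall>x<N.
     \<bar>ssep_kernel.mean_density N K t (prof N) x - R t (real x / real N)\<bar> \<le> \<epsilon>1)"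
    using hydrodynamic_limit[OF R \<epsilon>1, of T] by (elim exE)
  obtain N3 :: nat where N3: "1 / \<delta> < real N3" using reals_Archimedean2[of "1 / \<delta>"] by (elim exE)
  show ?thesis
  proof (intro exI[of _ "max N1 (max N2 N3)"] allI impI ballI)
    fix N K t assume A: "max N1 (max N2 N3) \<le> N" "ssep_kernel N K" "t \<in> {0<..T}"
    interpret ssep_kernel N K by (rule A)
    let ?d = "mean_density t (prof N)"
    have t: "t \<in> {0..T}" "0 < t" "0 \<le> t" using A(3) by auto
    have Npos: "0 < real N" using N by simp
    have "1 / \<delta> < real N" using A(1) N3 by (meson less_le_trans max.boundedE of_nat_le_iff)
    then have n: "1 / real N \<le> \<delta>" using \<delta> Npos by (simp add: field_simps)
    have dR: "\<bar>?d x - R t (real x / real N)\<bar> \<le> \<epsilon>1" if "x < N" for x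
      using N2 A that by simp
    have d01: "0 \<le> ?d x \<and> ?d x \<le> 1" if "x < N" for x
      using unit_density_mean_density[OF t(2) unit_density_prof] that by (simp add: unit_density_def)
    have per: "R t (real ((x + 1) mod N) / real N) = R t (real (x + 1) / real N)" if "x < N" for x
    proof (cases "x = N - 1")
      case True
      then have "real (x + 1) = real N" using that by simp
      then have "real (x + 1) / real N = 0 + 1" using Npos by simp
      moreover have "(x + 1) mod N = 0" using True that by (simp add: succ_mod)
      ultimately show ?thesis using heat_flow_periodic[OF R t(3), of 0] by (simp only: of_nat_0 div_0)
    next
      case False
      then show ?thesis using that by (simp add: succ_mod)
    qed
    have one: "\<bar>G t (real x / real N) * (?d x * ?d ((x + 1) mod N)) - (R t (real x / real N))\<^sup>2 * G t (real x / real N)\<bar> \<le> \<epsilon> / 2"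
      if x: "x < N" for x
    proof -
      let ?y = "(x + 1) mod N" and ?r = "R t (real x / real N)"
      have y: "?y < N" using x by simp
      have in01: "real x / real N \<in> {0..1}" "real (x + 1) / real N \<in> {0..1}" using x Npos by auto
      have "real (x + 1) / real N - real x / real N = 1 / real N" by (simp add: add_divide_distrib)
      then have "\<bar>real (x + 1) / real N - real x / real N\<bar> \<le> \<delta>" using n by simp
      then have "\<bar>R t (real (x + 1) / real N) - ?r\<bar> \<le> \<epsilon>1" using D t(1) in01 \<delta> by simp
      then have dy: "\<bar>?d ?y - ?r\<bar> \<le> 2 * \<epsilon>1" using dR[OF y] unfolding per[OF x] by linarith
      have "?d x * ?d ?y - ?r\<^sup>2 = ?d x * (?d ?y - ?r) + ?r * (?d x - ?r)"
        by (simp add: power2_eq_square algebra_simps)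
      then have "\<bar>?d x * ?d ?y - ?r\<^sup>2\<bar> \<le> \<bar>?d x\<bar> * \<bar>?d ?y - ?r\<bar> + \<bar>?r\<bar> * \<bar>?d x - ?r\<bar>"
        using abs_triangle_ineq[of "?d x * (?d ?y - ?r)" "?r * (?d x - ?r)"] by (simp only: abs_mult)
      also have "\<dots> \<le> 1 * (2 * \<epsilon>1) + C * \<epsilon>1"
        using d01[OF x] dy dR[OF x] C t(1) in01 \<epsilon>1 by (intro add_mono mult_mono) auto
      also have "\<dots> \<le> 3 * C * \<epsilon>1" using C(1) \<epsilon>1 by (simp add: algebra_simps)
      finally have "\<bar>G t (real x / real N)\<bar> * \<bar>?d x * ?d ?y - ?r\<^sup>2\<bar> \<le> B * (3 * C * \<epsilon>1)"
        using B t(1) in01 by (intro mult_mono) auto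
      also have "\<dots> = \<epsilon> / 2" using B C by (simp add: \<epsilon>1_def)
      finally show ?thesis by (simp add: abs_mult[symmetric] algebra_simps)
    qed
    have "\<bar>(\<Sum>x<N. G t (real x / real N) * (?d x * ?d ((x + 1) mod N))) - (\<Sum>x<N. (R t (real x / real N))\<^sup>2 * G t (real x / real N))\<bar>
        \<le> (\<Sum>x<N. \<epsilon> / 2)"
      unfolding sum_subtractf[symmetric] by (rule order_trans[OF sum_abs sum_mono]) (use one in simp)
    then have "\<bar>(\<Sum>x<N. G t (real x / real N) * (?d x * ?d ((x + 1) mod N))) - (\<Sum>x<N. (R t (real x / real N))\<^sup>2 * G t (real x / real N))\<bar> / real N
        \<le> \<epsilon> / 2" using Npos by (simp add: divide_le_eq mult.commute)
    then have "\<bar>(\<Sum>x<N. G t (real x / real N) * (?d x * ?d ((x + 1) mod N))) / real N - (\<Sum>x<N. (R t (real x / real N))\<^sup>2 * G t (real x / real N)) / real N\<bar>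
        \<le> \<epsilon> / 2" by (simp add: diff_divide_distrib[symmetric])
    moreover have "\<bar>(\<Sum>x<N. (R t (real x / real N))\<^sup>2 * G t (real x / real N)) / real N - circle_int (\<lambda>u. (R t u)\<^sup>2 * G t u)\<bar> \<le> \<epsilon> / 2"
      using N1 A t by simp
    ultimately show "\<bar>(\<Sum>x<N. G t (real x / real N) * (?d x * ?d ((x + 1) mod N))) / real N
     - circle_int (\<lambda>u. (R t u)\<^sup>2 * G t u)\<bar> \<le> \<epsilon>" by linarith
  qed
qed

text \<open>Regularity in time is taken from the limit: both densities are compared with the heat
  flow, which is uniformly continuous on the compact rectangle, so no regularity estimate on the
  lattice has to be made.\<close>

lemma time_shift_limit:
  assumes \<kappa>: "0 < \<kappa>" and t0: "0 < t0" and D: "0 < D"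
  shows "\<exists>N0. \<forall>N\<ge>N0. \<forall>K. ssep_kernel N K \<longrightarrow> (\<forall>t\<in>{t0..T}. \<kappa> / (real N)\<^sup>2 < t \<and>
    (\<forall>x<N. \<bar>ssep_kernel.mean_density N K (t - \<kappa> / (real N)\<^sup>2) (prof N) x - ssep_kernel.mean_density N K t (prof N) x\<bar> \<le> D))"
proof -
  have D3: "0 < D / 3" using D by simp
  obtain \<delta> where \<delta>: "0 < \<delta>" and U: "\<forall>t\<in>{0..T}. \<forall>t'\<in>{0..T}. \<forall>u\<in>{0..1}. \<forall>u'\<in>{0..1}.
    \<bar>t - t'\<bar> \<le> \<delta> \<longrightarrow> \<bar>u - u'\<bar> \<le> \<delta> \<longrightarrow> \<bar>R t u - R t' u'\<bar> \<le> D / 3"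
    using unif_cont_rectangle[OF heat_flow_continuous_rectangle D3] by (elim exE conjE)
  obtain N2 where N2: "\<forall>N\<ge>N2. \<forall>K. ssep_kernel N K \<longrightarrow> (\<forall>t\<in>{0<..T}. \<forall>x<N.
     \<bar>ssep_kernel.mean_density N K t (prof N) x - R t (real x / real N)\<bar> \<le> D / 3)"
    using hydrodynamic_limit[OF R D3, of T] by (elim exE)
  \<comment> \<open>A shift below \<open>s\<close> is within the modulus of continuity and keeps the
    shifted time positive for every \<open>t \<ge> t0\<close>.\<close>
  define s where "s = min \<delta> (t0 / 2)"
  have s: "0 < s" using \<delta> t0 by (simp add: s_def)
  obtain N3 :: nat where N3: "\<kappa> / s < real N3" using reals_Archimedean2[of "\<kappa> / s"] by (elim exE)
  show ?thesis
  proof (intro exI[of _ "max N2 N3"] allI impI ballI)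
    fix N K t assume A: "max N2 N3 \<le> N" "ssep_kernel N K" "t \<in> {t0..T}"
    interpret ssep_kernel N K by (rule A)
    define \<tau> where "\<tau> = \<kappa> / (real N)\<^sup>2"
    have N1: "1 \<le> real N" using N by simp
    have "\<kappa> < real N * s" using A(1) N3 s by (simp add: divide_less_eq) (meson less_le_trans mult_right_mono of_nat_le_iff order_less_imp_le)
    also have "\<dots> \<le> (real N)\<^sup>2 * s" using N1 s by (simp add: power2_eq_square)
    finally have "\<tau> < s" using N1 by (simp add: \<tau>_def divide_less_eq mult.commute)
    moreover have "0 < \<tau>" using \<kappa> N1 by (simp add: \<tau>_def)
    ultimately have \<tau>: "\<tau> < t" "0 < t - \<tau>" "t - \<tau> \<in> {0<..T}" "t - \<tau> \<in> {0..T}" "t \<in> {0<..T}" "t \<in> {0..T}" "\<bar>t - \<tau> - t\<bar> \<le> \<delta>"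
      using A(3) t0 by (auto simp: s_def)
    have "\<bar>mean_density (t - \<tau>) (prof N) x - mean_density t (prof N) x\<bar> \<le> D" if x: "x < N" for x
    proof -
      have "real x / real N \<in> {0..1}" using x N1 by auto
      then have "\<bar>R (t - \<tau>) (real x / real N) - R t (real x / real N)\<bar> \<le> D / 3"
        using U \<tau> \<delta> by simp
      moreover have "\<bar>mean_density (t - \<tau>) (prof N) x - R (t - \<tau>) (real x / real N)\<bar> \<le> D / 3"
        "\<bar>mean_density t (prof N) x - R t (real x / real N)\<bar> \<le> D / 3"
        using N2 A \<tau> x by simp_all
      ultimately show ?thesis by linarith
    qed
    then show "\<kappa> / (real N)\<^sup>2 < t \<and> (\<forall>x<N. \<bar>mean_density (t - \<kappa> / (real N)\<^sup>2) (prof N) x - mean_density t (prof N) x\<bar> \<le> D)"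
      using \<tau> unfolding \<tau>_def by blast
  qed
qed

text \<open>The budget \<open>\<delta>\<close> is split into four quarters: limit of the mean,
  smearing error, time shift, and terms quadratic in \<open>l\<close>. The order of choice matters:
  \<open>\<epsilon>\<close> comes first, \<open>\<kappa>\<close> depends on it, and \<open>l\<close>
  on both.\<close>

lemma one_time_exp_moment:
  assumes G: "continuous_on ({0..T} \<times> {0..1}) (\<lambda>(t, u). G t u)" and t0: "0 < t0" and \<delta>: "0 < \<delta>"
  shows "\<exists>l>0. \<exists>N0. \<forall>N\<ge>N0. \<forall>K. ssep_kernel N K \<longrightarrow> (\<forall>t\<in>{t0..T}.
    prodE N (prof N) (kernel_op K t (\<lambda>\<eta>. exp (l * real N *
      \<bar>1 / real N * (\<Sum>x<N. real (\<eta> x) * real (\<eta> ((x + 1) mod N)) * G t (real x / real N))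
        - circle_int (\<lambda>u. (R t u)\<^sup>2 * G t u)\<bar>))) \<le> 2 * exp (l * real N * \<delta>))"
proof -
  obtain B where B: "1 \<le> B" "\<forall>t\<in>{0..T}. \<forall>u\<in>{0..1}. \<bar>G t u\<bar> \<le> B"
    using bounded_rectangle[OF G] by (elim exE conjE)
  define \<epsilon> where "\<epsilon> = min 1 (\<delta> / (36 * B))"
  have \<epsilon>: "0 < \<epsilon>" "\<epsilon> \<le> 1" "9 * B * \<epsilon> \<le> \<delta> / 4"
    using \<delta> B by (auto simp: \<epsilon>_def min_def field_simps)
  obtain \<kappa> N1 where \<kappa>: "0 < \<kappa>" and N1: "\<forall>N\<ge>N1. \<forall>K b \<gamma>. ssep_kernel N K \<longrightarrow> 0 \<le> b \<longrightarrow> (\<forall>x<N. \<bar>\<gamma> x\<bar> \<le> b) \<longrightarrow>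
     mixed_diff_le N (b * \<epsilon>) (kernel_op K (\<kappa> / (real N)\<^sup>2) (pair_sum N \<gamma>))"
    using pair_smearing[OF \<epsilon>(1)] by (elim exE conjE)
  define D where "D = \<delta> / (4 * B)"
  have D: "0 < D" "B * D \<le> \<delta> / 4" using \<delta> B by (auto simp: D_def)
  \<comment> \<open>The first bound keeps the weights \<open>l * B\<close> below
    \<open>1 / 4\<close>. The second puts the quadratic terms,
    \<open>l^2 * B^2 * (16 * \<kappa> + 28)\<close> per site, below
    \<open>l * \<delta> / 4\<close>.\<close>
  define l where "l = min (1 / (4 * B)) (\<delta> / (4 * B\<^sup>2 * (16 * \<kappa> + 28)))"
  have l: "0 < l" using B \<delta> \<kappa> by (simp add: l_def)
  have lB: "l * B \<le> 1 / 4"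
  proof -
    have "l * B \<le> 1 / (4 * B) * B" using B by (intro mult_right_mono) (auto simp: l_def)
    then show ?thesis using B by simp
  qed
  have lq: "l * (B\<^sup>2 * (16 * \<kappa> + 28)) \<le> \<delta> / 4"
  proof -
    have "0 < B\<^sup>2 * (16 * \<kappa> + 28)" using B \<kappa> by simp
    moreover have "l \<le> \<delta> / (4 * (B\<^sup>2 * (16 * \<kappa> + 28)))" by (simp add: l_def mult.assoc)
    ultimately show ?thesis by (simp add: pos_le_divide_eq algebra_simps)
  qed
  have \<delta>4: "0 < \<delta> / 4" using \<delta> by simp
  obtain N2 where N2: "\<forall>N\<ge>N2. \<forall>K. ssep_kernel N K \<longrightarrow> (\<forall>t\<in>{0<..T}.
    \<bar>(\<Sum>x<N. G t (real x / real N) * (ssep_kernel.mean_density N K t (prof N) x * ssep_kernel.mean_density N K t (prof N) ((x + 1) mod N))) / real N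
     - circle_int (\<lambda>u. (R t u)\<^sup>2 * G t u)\<bar> \<le> \<delta> / 4)"
    using pair_mean_limit[OF G \<delta>4] by (elim exE)
  obtain N3 where N3: "\<forall>N\<ge>N3. \<forall>K. ssep_kernel N K \<longrightarrow> (\<forall>t\<in>{t0..T}. \<kappa> / (real N)\<^sup>2 < t \<and>
    (\<forall>x<N. \<bar>ssep_kernel.mean_density N K (t - \<kappa> / (real N)\<^sup>2) (prof N) x - ssep_kernel.mean_density N K t (prof N) x\<bar> \<le> D))"
    using time_shift_limit[OF \<kappa> t0 D(1)] by (elim exE)
  show ?thesis
  proof (intro exI[of _ l] conjI l exI[of _ "max N1 (max N2 N3)"] allI impI ballI)
    fix N K t assume A: "max N1 (max N2 N3) \<le> N" "ssep_kernel N K" "t \<in> {t0..T}"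
    interpret ssep_kernel N K by (rule A)
    define \<tau> where "\<tau> = \<kappa> / (real N)\<^sup>2"
    define \<gamma> where "\<gamma> x = l * G t (real x / real N)" for x
    define m where "m = circle_int (\<lambda>u. (R t u)\<^sup>2 * G t u)"
    define b where "b = l * B"
    have Npos: "0 < real N" using N by simp
    have t: "t \<in> {0..T}" "t \<in> {0<..T}" using A(3) t0 by auto
    have \<tau>: "0 < \<tau>" "\<tau> < t" using \<kappa> Npos N3 A by (auto simp: \<tau>_def)
    have \<tau>N: "\<tau> * real N ^ 3 = \<kappa> * real N" using Npos by (simp add: \<tau>_def power2_eq_square power3_eq_cube)
    have b: "0 \<le> b" "b \<le> 1 / 4" using l B lB by (auto simp: b_def)
    have \<gamma>: "\<bar>\<gamma> x\<bar> \<le> b" if "x < N" for x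
    proof -
      have "real x / real N \<in> {0..1}" using that Npos by auto
      then have "\<bar>G t (real x / real N)\<bar> \<le> B" using B t by simp
      then show ?thesis using l by (simp add: \<gamma>_def b_def abs_mult)
    qed
    have sm: "mixed_diff_le N (b * \<epsilon>) (P \<tau> (pair_sum N \<gamma>))" if "\<And>x. x < N \<Longrightarrow> \<bar>\<gamma> x\<bar> \<le> b" for \<gamma>
      using N1 A that b unfolding \<tau>_def by simp
    have sh: "\<bar>mean_density (t - \<tau>) (prof N) x - mean_density t (prof N) x\<bar> \<le> D" if "x < N" for x
      using N3 A that unfolding \<tau>_def by simp
    have mean: "\<bar>(\<Sum>x<N. \<gamma> x * (mean_density t (prof N) x * mean_density t (prof N) ((x + 1) mod N))) - l * real N * m\<bar> \<le> l * real N * (\<delta> / 4)"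
    proof -
      let ?s = "\<Sum>x<N. G t (real x / real N) * (mean_density t (prof N) x * mean_density t (prof N) ((x + 1) mod N))"
      have "(\<Sum>x<N. \<gamma> x * (mean_density t (prof N) x * mean_density t (prof N) ((x + 1) mod N))) = l * ?s"
        by (simp only: \<gamma>_def mult.assoc sum_distrib_left)
      moreover have "l * ?s - l * real N * m = l * real N * (?s / real N - m)"
        using Npos by (simp add: right_diff_distrib)
      moreover have "\<bar>?s / real N - m\<bar> \<le> \<delta> / 4" using N2 A t unfolding m_def by simp
      then have "l * real N * \<bar>?s / real N - m\<bar> \<le> l * real N * (\<delta> / 4)"
        using l by (intro mult_left_mono) auto
      moreover have "\<bar>l * real N * (?s / real N - m)\<bar> = l * real N * \<bar>?s / real N - m\<bar>"
        using l by (simp add: abs_mult)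
      ultimately show ?thesis by (simp only:)
    qed
    have fun_eq: "l * real N * \<bar>1 / real N * (\<Sum>x<N. real (\<eta> x) * real (\<eta> ((x + 1) mod N)) * G t (real x / real N)) - m\<bar>
        = \<bar>pair_sum N \<gamma> \<eta> - l * real N * m\<bar>" for \<eta>
    proof -
      let ?s = "\<Sum>x<N. real (\<eta> x) * real (\<eta> ((x + 1) mod N)) * G t (real x / real N)"
      have "pair_sum N \<gamma> \<eta> = l * ?s"
        unfolding pair_sum_def \<gamma>_def sum_distrib_left by (intro sum.cong) auto
      then have "pair_sum N \<gamma> \<eta> - l * real N * m = l * real N * (1 / real N * ?s - m)"
        using Npos by (simp add: right_diff_distrib)
      then show ?thesis using l by (simp add: abs_mult)
    qed
    have "prodE N (prof N) (P t (\<lambda>\<eta>. exp \<bar>pair_sum N \<gamma> \<eta> - l * real N * m\<bar>)) \<le>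
      2 * exp (l * real N * (\<delta> / 4) + (16 * b\<^sup>2 * (\<tau> * real N ^ 3) + real N * (28 * b\<^sup>2 + 9 * b * \<epsilon> + b * D)))"
      by (rule exp_abs_moment[OF unit_density_prof \<tau> b \<gamma> sm less_imp_le[OF \<epsilon>(1)] \<epsilon>(2) sh mean])
    also have "\<dots> \<le> 2 * exp (l * real N * \<delta>)"
    proof -
      have "16 * b\<^sup>2 * (\<tau> * real N ^ 3) + real N * (28 * b\<^sup>2 + 9 * b * \<epsilon> + b * D)
          = l * real N * (l * (B\<^sup>2 * (16 * \<kappa> + 28)) + 9 * B * \<epsilon> + B * D)"
        unfolding \<tau>N b_def by (simp add: power2_eq_square algebra_simps)
      also have "\<dots> \<le> l * real N * (\<delta> / 4 + \<delta> / 4 + \<delta> / 4)"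
        using l by (intro mult_left_mono add_mono lq \<epsilon> D) auto
      finally have "l * real N * (\<delta> / 4) + (16 * b\<^sup>2 * (\<tau> * real N ^ 3) + real N * (28 * b\<^sup>2 + 9 * b * \<epsilon> + b * D))
          \<le> l * real N * (\<delta> / 4) + l * real N * (\<delta> / 4 + \<delta> / 4 + \<delta> / 4)" by (rule add_left_mono)
      also have "\<dots> = l * real N * \<delta>" by (simp add: algebra_simps)
      finally have fin: "l * real N * (\<delta> / 4) + (16 * b\<^sup>2 * (\<tau> * real N ^ 3) + real N * (28 * b\<^sup>2 + 9 * b * \<epsilon> + b * D))
          \<le> l * real N * \<delta>" .
      show ?thesis by (rule mult_left_mono[OF iffD2[OF exp_le_cancel_iff fin]]) simp
    qed
    finally show "prodE N (prof N) (P t (\<lambda>\<eta>. exp (l * real N *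
      \<bar>1 / real N * (\<Sum>x<N. real (\<eta> x) * real (\<eta> ((x + 1) mod N)) * G t (real x / real N))
        - circle_int (\<lambda>u. (R t u)\<^sup>2 * G t u)\<bar>))) \<le> 2 * exp (l * real N * \<delta>)"
      unfolding fun_eq[unfolded m_def] m_def .
  qed
qed

end

section \<open>The superexponential estimate\<close>

definition pair_field :: "nat \<Rightarrow> (real \<Rightarrow> real \<Rightarrow> real) \<Rightarrow> real \<Rightarrow> config \<Rightarrow> real" where
  "pair_field N G s \<eta> =
     1 / real N * (\<Sum>x<N. real (\<eta> x) * real (\<eta> ((x + 1) mod N)) * G s (real x / real N))"

lemma pair_field_abs_le:
  assumes "0 < N" "\<eta> \<in> configs N" "\<And>u. u \<in> {0..1} \<Longrightarrow> \<bar>G s u\<bar> \<le> B"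
  shows "\<bar>pair_field N G s \<eta>\<bar> \<le> B"
proof -
  have "\<bar>\<Sum>x<N. real (\<eta> x) * real (\<eta> ((x + 1) mod N)) * G s (real x / real N)\<bar>
      \<le> (\<Sum>x<N. \<bar>real (\<eta> x) * real (\<eta> ((x + 1) mod N)) * G s (real x / real N)\<bar>)" by (rule sum_abs)
  also have "\<dots> \<le> (\<Sum>x<N. B)"
  proof (rule sum_mono)
    fix x assume "x \<in> {..<N}"
    then have x: "x < N" "(x + 1) mod N < N" by auto
    have "real x / real N \<in> {0..1}" using x by auto
    from assms(3)[OF this] have g: "\<bar>G s (real x / real N)\<bar> \<le> B" .
    have "real (\<eta> x) * real (\<eta> ((x + 1) mod N)) \<le> 1"
      using configs_cases[OF assms(2) x(1)] configs_cases[OF assms(2) x(2)] by auto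
    then have "real (\<eta> x) * real (\<eta> ((x + 1) mod N)) * \<bar>G s (real x / real N)\<bar> \<le> 1 * B"
      by (rule mult_mono[OF _ g]) auto
    then show "\<bar>real (\<eta> x) * real (\<eta> ((x + 1) mod N)) * G s (real x / real N)\<bar> \<le> B"
      by (simp add: abs_mult)
  qed
  finally have "\<bar>\<Sum>x<N. real (\<eta> x) * real (\<eta> ((x + 1) mod N)) * G s (real x / real N)\<bar> \<le> real N * B" by simp
  then show ?thesis using assms(1) by (simp add: pair_field_def abs_mult divide_le_eq mult.commute)
qed

text \<open>By right-continuity in the discrete topology, the value at \<open>s\<close> equals the
  value at all sufficiently fine grid times to the right of \<open>s\<close>. The indicator is thus
  a pointwise limit of functions piecewise constant in time. The factor
  \<open>indicator {0..}\<close> removes negative times, where the process is unconstrained.\<close>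

lemma cadlag_joint_measurable:
  assumes meas: "\<And>t. 0 \<le> t \<Longrightarrow> X t \<in> measurable M (count_space S)"
    and cad: "\<And>\<omega>. \<omega> \<in> space M \<Longrightarrow> cadlag_discrete (\<lambda>t. X t \<omega>)" and \<xi>: "\<xi> \<in> S"
  shows "(\<lambda>p. indicator {0..} (fst p) * of_bool (X (fst p) (snd p) = \<xi>) :: real)
    \<in> borel_measurable (lborel \<Otimes>\<^sub>M M)"
proof -
  \<comment> \<open>The added 1 places the grid point strictly to the right of \<open>s\<close>,
    even when \<open>s\<close> lies on the grid, as convergence within \<open>at_right s\<close>
    requires.\<close>
  define g where "g n s = real (nat \<lfloor>real (Suc n) * s\<rfloor> + 1) / real (Suc n)" for n s
  define h where "h n k \<omega> = (of_bool (X (real (k + 1) / real (Suc n)) \<omega> = \<xi>) :: real)" for n k \<omega>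
  have hm: "h n k \<in> borel_measurable M" for n k
  proof -
    have "X (real (k + 1) / real (Suc n)) \<in> measurable M (count_space S)" by (rule meas) simp
    moreover have "(\<lambda>\<zeta>. of_bool (\<zeta> = \<xi>) :: real) \<in> borel_measurable (count_space S)" by simp
    ultimately show ?thesis unfolding h_def[abs_def] by (rule measurable_compose)
  qed
  have fl: "(\<lambda>p. nat \<lfloor>real (Suc n) * fst p\<rfloor>) \<in> measurable (lborel \<Otimes>\<^sub>M M) (count_space UNIV)" for n
  proof -
    have "(\<lambda>s::real. nat \<lfloor>real (Suc n) * s\<rfloor>) \<in> measurable lborel (count_space UNIV)" by measurable
    from measurable_compose[OF measurable_fst this] show ?thesis .
  qed
  have gm: "(\<lambda>p. h n (nat \<lfloor>real (Suc n) * fst p\<rfloor>) (snd p)) \<in> borel_measurable (lborel \<Otimes>\<^sub>M M)" for n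
    by (rule measurable_compose_countable[where f = "\<lambda>k p. h n k (snd p)", OF _ fl])
      (rule measurable_compose[OF measurable_snd hm])
  have im: "(\<lambda>p. indicator {0..} (fst p :: real) :: real) \<in> borel_measurable (lborel \<Otimes>\<^sub>M M)"
    by (rule measurable_compose[OF measurable_fst borel_measurable_indicator]) simp
  show ?thesis
  proof (rule borel_measurable_LIMSEQ_real)
    fix n
    show "(\<lambda>p. indicator {0..} (fst p) * h n (nat \<lfloor>real (Suc n) * fst p\<rfloor>) (snd p)) \<in> borel_measurable (lborel \<Otimes>\<^sub>M M)"
      by (rule borel_measurable_times[OF im gm])
  next
    fix p :: "real \<times> _" assume p: "p \<in> space (lborel \<Otimes>\<^sub>M M)"
    obtain s \<omega> where so: "p = (s, \<omega>)" by (cases p)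
    have \<omega>: "\<omega> \<in> space M" using p by (simp add: so space_pair_measure)
    show "(\<lambda>n. indicator {0..} (fst p) * h n (nat \<lfloor>real (Suc n) * fst p\<rfloor>) (snd p))
      \<longlonglongrightarrow> indicator {0..} (fst p) * of_bool (X (fst p) (snd p) = \<xi>)"
    proof (cases "0 \<le> s")
      case False then show ?thesis by (simp add: so)
    next
      case True
      have b: "s < g n s \<and> g n s \<le> s + 1 / real (Suc n)" for n
      proof -
        have "0 \<le> real (Suc n) * s" using True by simp
        then have "real (Suc n) * s < real (nat \<lfloor>real (Suc n) * s\<rfloor> + 1)"
          "real (nat \<lfloor>real (Suc n) * s\<rfloor> + 1) \<le> real (Suc n) * s + 1" by linarith+
        then have "s < g n s" "g n s \<le> (real (Suc n) * s + 1) / real (Suc n)"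
          unfolding g_def by (auto simp: pos_less_divide_eq mult.commute intro!: divide_right_mono)
        then show ?thesis by (simp add: add_divide_distrib)
      qed
      have gl: "filterlim (\<lambda>n. g n s) (at_right s) sequentially"
        unfolding filterlim_at
      proof
        show "\<forall>\<^sub>F n in sequentially. g n s \<in> {s<..} \<and> g n s \<noteq> s" using b by (simp add: less_imp_neq[symmetric])
        show "(\<lambda>n. g n s) \<longlonglongrightarrow> s"
        proof (rule tendsto_sandwich[of "\<lambda>_. s" _ _ "\<lambda>n. s + 1 / real (Suc n)"])
          have "(\<lambda>n. s + 1 / real (Suc n)) \<longlonglongrightarrow> s + 0"
            by (intro tendsto_add tendsto_const LIMSEQ_Suc[OF lim_const_over_n])
          then show "(\<lambda>n. s + 1 / real (Suc n)) \<longlonglongrightarrow> s" by simp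
          show "\<forall>\<^sub>F n in sequentially. s \<le> g n s"
            by (intro always_eventually allI) (use b less_imp_le in blast)
          show "\<forall>\<^sub>F n in sequentially. g n s \<le> s + 1 / real (Suc n)"
            by (intro always_eventually allI) (use b in blast)
        qed simp
      qed
      have "\<forall>\<^sub>F r in at_right s. X r \<omega> = X s \<omega>"
        using cad[OF \<omega>] True by (simp add: cadlag_discrete_def)
      then have "\<forall>\<^sub>F n in sequentially. X (g n s) \<omega> = X s \<omega>"
        by (rule eventually_compose_filterlim[OF _ gl])
      then have "\<forall>\<^sub>F n in sequentially. indicator {0..} (fst p) * of_bool (X (fst p) (snd p) = \<xi>) =
          indicator {0..} (fst p) * h n (nat \<lfloor>real (Suc n) * fst p\<rfloor>) (snd p)"
        by eventually_elim (simp add: so h_def g_def)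
      then show ?thesis by (rule Lim_transform_eventually[OF tendsto_const])
    qed
  qed
qed

text \<open>On the bad event the time average of the deviation over \<open>{t0..T}\<close> is at
  least \<open>a\<close>, and convexity of the exponential makes the time integral of the
  exponential moment large. Fubini reduces its expectation to one-time laws, and Markov's inequality
  concludes.\<close>

lemma exponential_estimate:
  assumes T: "0 < T" and \<epsilon>: "0 < \<epsilon>"
    and R: "is_heat_flow \<phi> R" and \<phi>: "\<And>u. 0 \<le> \<phi> u \<and> \<phi> u \<le> 1"
    and G: "continuous_on ({0..T} \<times> {0..1}) (\<lambda>(t, u). G t u)"
  shows "\<exists>c>0. \<exists>N0. \<forall>N\<ge>N0. \<forall>M X. ssep_from_product N \<phi> M X \<longrightarrow>
    \<P>(\<omega> in M. \<bar>(LBINT s:{0..T}. pair_field N G s (X s \<omega>))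
      - (LBINT s:{0..T}. circle_int (\<lambda>u. (R s u)\<^sup>2 * G s u))\<bar> > \<epsilon>) \<le> 2 * exp (- c * real N)"
proof -
  define m where "m s = circle_int (\<lambda>u. (R s u)\<^sup>2 * G s u)" for s
  have "continuous_on ({0..T} \<times> {0..1}) (\<lambda>p. ((\<lambda>(t, u). R t u) p)\<^sup>2 * (\<lambda>(t, u). G t u) p)"
    by (intro continuous_on_mult continuous_on_power heat_flow_continuous_rectangle[OF R \<phi>] G)
  then have S: "continuous_on ({0..T} \<times> {0..1}) (\<lambda>(t, u). (R t u)\<^sup>2 * G t u)"
    by (simp add: case_prod_unfold)
  obtain B where B: "1 \<le> B" "\<forall>t\<in>{0..T}. \<forall>u\<in>{0..1}. \<bar>G t u\<bar> \<le> B"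
    using bounded_rectangle[OF G] by (elim exE conjE)
  obtain C where C: "1 \<le> C" "\<forall>t\<in>{0..T}. \<forall>u\<in>{0..1}. \<bar>(R t u)\<^sup>2 * G t u\<bar> \<le> C"
    using bounded_rectangle[OF S] by (elim exE conjE)
  have iS: "set_integrable lborel {0..<1} (\<lambda>u. (R t u)\<^sup>2 * G t u)" if "t \<in> {0..T}" for t
    by (rule set_integrable_continuous_Ico[OF continuous_on_slice[OF S that]])
  have mC: "\<bar>m t\<bar> \<le> C" if "t \<in> {0..T}" for t
    unfolding m_def by (rule circle_int_abs_le[OF iS[OF that]]) (use C that in simp)
  have mcont: "continuous_on {0..T} m"
    unfolding continuous_on_iff
  proof (intro ballI allI impI)
    fix t e :: real assume t: "t \<in> {0..T}" and e: "0 < e"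
    obtain \<delta> where \<delta>: "0 < \<delta>" and U: "\<forall>t\<in>{0..T}. \<forall>t'\<in>{0..T}. \<forall>u\<in>{0..1}. \<forall>u'\<in>{0..1}.
      \<bar>t - t'\<bar> \<le> \<delta> \<longrightarrow> \<bar>u - u'\<bar> \<le> \<delta> \<longrightarrow> \<bar>(R t u)\<^sup>2 * G t u - (R t' u')\<^sup>2 * G t' u'\<bar> \<le> e / 2"
      using unif_cont_rectangle[OF S half_gt_zero[OF e]] by (elim exE conjE)
    show "\<exists>d>0. \<forall>t'\<in>{0..T}. dist t' t < d \<longrightarrow> dist (m t') (m t) < e"
    proof (intro exI[of _ \<delta>] conjI \<delta> ballI impI)
      fix t' assume t': "t' \<in> {0..T}" "dist t' t < \<delta>"
      have "\<bar>circle_int (\<lambda>u. (R t' u)\<^sup>2 * G t' u - (R t u)\<^sup>2 * G t u)\<bar> \<le> e / 2"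
      proof (rule circle_int_abs_le[OF set_integral_diff(1)[OF iS[OF t'(1)] iS[OF t]]])
        fix u :: real assume "u \<in> {0..<1}"
        then show "\<bar>(R t' u)\<^sup>2 * G t' u - (R t u)\<^sup>2 * G t u\<bar> \<le> e / 2"
          using U t t' \<delta> by (simp add: dist_real_def)
      qed
      then have "\<bar>m t' - m t\<bar> \<le> e / 2" unfolding m_def set_integral_diff(2)[OF iS[OF t'(1)] iS[OF t]] .
      then show "dist (m t') (m t) < e" using e by (simp add: dist_real_def)
    qed
  qed
  \<comment> \<open>The deviation is at most \<open>B + C\<close>, so the initial interval
    contributes at most half of \<open>\<epsilon>\<close>; the other bound keeps \<open>t0\<close>
    below \<open>T\<close>.\<close>
  define t0 where "t0 = min (T / 2) (\<epsilon> / (2 * (B + C)))"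
  have t0: "0 < t0" "t0 < T" "t0 * (B + C) \<le> \<epsilon> / 2"
  proof -
    have "t0 * (B + C) \<le> \<epsilon> / (2 * (B + C)) * (B + C)" using B C by (intro mult_right_mono) (auto simp: t0_def)
    also have "\<dots> = \<epsilon> / 2"
    proof -
      have "y \<noteq> 0 \<Longrightarrow> \<epsilon> / (2 * y) * y = \<epsilon> / 2" for y by simp
      from this[of "B + C"] B C show ?thesis by linarith
    qed
    finally show "t0 * (B + C) \<le> \<epsilon> / 2" .
  qed (use T \<epsilon> B C in \<open>auto simp: t0_def\<close>)
  define L where "L = T - t0"
  have L: "0 < L" using t0 by (simp add: L_def)
  define a where "a = \<epsilon> / (2 * L)"
  have a: "0 < a" "L * a = \<epsilon> / 2" using \<epsilon> L by (simp_all add: a_def)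
  \<comment> \<open>The fixed-time bound is requested with half the threshold \<open>a\<close>. The
    other half survives Markov's inequality and gives the decay rate
    \<open>l * a / 2\<close>.\<close>
  obtain l N0 where l: "0 < l" and N0: "\<forall>N\<ge>N0. \<forall>K. ssep_kernel N K \<longrightarrow> (\<forall>t\<in>{t0..T}.
    prodE N (\<lambda>x. \<phi> (real x / real N)) (kernel_op K t (\<lambda>\<eta>. exp (l * real N * \<bar>pair_field N G t \<eta> - m t\<bar>))) \<le> 2 * exp (l * real N * (a / 2)))"
    using one_time_exp_moment[OF R \<phi> G t0(1) half_gt_zero[OF a(1)]]
    unfolding pair_field_def[symmetric] m_def[symmetric] by (elim exE conjE)
  have "\<P>(\<omega> in M. \<bar>(LBINT s:{0..T}. pair_field N G s (X s \<omega>)) - (LBINT s:{0..T}. m s)\<bar> > \<epsilon>)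
      \<le> 2 * exp (- (l * a / 2) * real N)"
    if N: "max 3 N0 \<le> N" and X: "ssep_from_product N \<phi> M X" for N M X
  proof -
    have N3: "3 \<le> N" and Npos: "0 < N" using N by auto
    let ?S = "configs N"
    have M: "prob_space M" and meas: "\<And>t. 0 \<le> t \<Longrightarrow> X t \<in> measurable M (count_space ?S)"
      and cad: "\<And>\<omega>. \<omega> \<in> space M \<Longrightarrow> cadlag_discrete (\<lambda>t. X t \<omega>)"
      using X by (auto simp: ssep_from_product_def markov_process_with_generator_def)
    interpret prob_space M by (rule M)
    interpret LM: pair_sigma_finite lborel M by unfold_locales
    have XS: "X t \<omega> \<in> ?S" if "0 \<le> t" "\<omega> \<in> space M" for t \<omega>
      using measurable_space[OF meas[OF that(1)] that(2)] by simp
    obtain K where K: "ssep_kernel N K" and law: "\<And>t f. 0 \<le> t \<Longrightarrow>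
        (\<integral>\<omega>. f (X t \<omega>) \<partial>M) = prodE N (\<lambda>x. \<phi> (real x / real N)) (kernel_op K t f)"
      using ssep_one_time_law[OF N3 X] by blast
    define F where "F s \<omega> = pair_field N G s (X s \<omega>)" for s \<omega>
    define D where "D s \<omega> = F s \<omega> - m s" for s \<omega>
    define I where "I p = (indicator {0..T} (fst p) :: real)" for p :: "real \<times> 'b"
    have Im: "I \<in> borel_measurable (lborel \<Otimes>\<^sub>M M)"
      unfolding I_def[abs_def] by (rule measurable_compose[OF measurable_fst borel_measurable_indicator]) simp
    have mm: "(\<lambda>s. indicator {0..T} s * m s) \<in> borel_measurable lborel"
      using borel_integrable_atLeastAtMost'[OF mcont] by (auto simp: set_integrable_def)
    have Fm: "(\<lambda>p. I p * F (fst p) (snd p)) \<in> borel_measurable (lborel \<Otimes>\<^sub>M M)"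
    proof -
      have gm: "(\<lambda>s. indicator {0..T} s * pair_field N G s \<xi>) \<in> borel_measurable lborel" for \<xi>
      proof -
        have "continuous_on {0..T} (\<lambda>s. pair_field N G s \<xi>)"
          unfolding pair_field_def
        proof (intro continuous_on_mult continuous_on_const continuous_on_sum)
          fix x assume "x \<in> {..<N}"
          then have x: "real x / real N \<in> {0..1}" by auto
          have "continuous_on {0..T} (\<lambda>s. (s, real x / real N))" by (intro continuous_intros)
          moreover have "(\<lambda>s. (s, real x / real N)) ` {0..T} \<subseteq> {0..T} \<times> {0..1}" using x by auto
          ultimately show "continuous_on {0..T} (\<lambda>s. G s (real x / real N))"
            using continuous_on_compose2[OF G] by fastforce
        qed
        from borel_integrable_atLeastAtMost'[OF this] show ?thesis by (auto simp: set_integrable_def)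
      qed
      \<comment> \<open>Expanding over the finitely many states separates a function continuous in
        time from indicators of the events that the process is in a given state.\<close>
      have "(\<lambda>p. \<Sum>\<xi>\<in>?S. (indicator {0..T} (fst p) * pair_field N G (fst p) \<xi>)
          * (indicator {0..} (fst p) * of_bool (X (fst p) (snd p) = \<xi>))) \<in> borel_measurable (lborel \<Otimes>\<^sub>M M)"
        by (intro borel_measurable_sum borel_measurable_times measurable_compose[OF measurable_fst gm]
            cadlag_joint_measurable[OF meas cad])
      moreover have "(\<Sum>\<xi>\<in>?S. (indicator {0..T} (fst p) * pair_field N G (fst p) \<xi>)
          * (indicator {0..} (fst p) * of_bool (X (fst p) (snd p) = \<xi>))) = I p * F (fst p) (snd p)"
        if p: "p \<in> space (lborel \<Otimes>\<^sub>M M)" for p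
      proof (cases "fst p \<in> {0..T}")
        case True
        have "X (fst p) (snd p) \<in> ?S" using XS True p by (auto simp: space_pair_measure)
        moreover have "(\<Sum>\<xi>\<in>?S. (indicator {0..T} (fst p) * pair_field N G (fst p) \<xi>)
          * (indicator {0..} (fst p) * of_bool (X (fst p) (snd p) = \<xi>)))
          = (\<Sum>\<xi>\<in>?S. if \<xi> = X (fst p) (snd p) then pair_field N G (fst p) \<xi> else 0)"
          using True by (intro sum.cong) auto
        ultimately show ?thesis using True by (simp add: I_def F_def)
      qed (simp add: I_def)
      ultimately show ?thesis by (simp cong: measurable_cong)
    qed
    have Dm: "(\<lambda>p. I p * D (fst p) (snd p)) \<in> borel_measurable (lborel \<Otimes>\<^sub>M M)"
    proof -
      have "(\<lambda>p. I p * F (fst p) (snd p) - (indicator {0..T} (fst p) * m (fst p))) \<in> borel_measurable (lborel \<Otimes>\<^sub>M M)"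
        by (intro borel_measurable_diff Fm measurable_compose[OF measurable_fst mm])
      then show ?thesis by (simp add: D_def I_def right_diff_distrib)
    qed
    have FB: "\<bar>F s \<omega>\<bar> \<le> B" if "s \<in> {0..T}" "\<omega> \<in> space M" for s \<omega>
      unfolding F_def using that B XS by (intro pair_field_abs_le Npos) auto
    have DB: "\<bar>D s \<omega>\<bar> \<le> B + C" if "s \<in> {0..T}" "\<omega> \<in> space M" for s \<omega>
      using FB[OF that] mC[OF that(1)] unfolding D_def by linarith
    define E where "E s \<omega> = indicator {t0..T} s * exp (l * real N * \<bar>D s \<omega>\<bar>)" for s \<omega>
    have Em: "case_prod E \<in> borel_measurable (lborel \<Otimes>\<^sub>M M)"
    proof -
      have "(\<lambda>p. indicator {t0..T} (fst p) * exp (l * real N * \<bar>I p * D (fst p) (snd p)\<bar>)) \<in> borel_measurable (lborel \<Otimes>\<^sub>M M)"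
        by (intro borel_measurable_times measurable_compose[OF measurable_fst] measurable_compose[OF _ borel_measurable_exp]
            borel_measurable_abs Dm) auto
      moreover have "(\<lambda>p. indicator {t0..T} (fst p) * exp (l * real N * \<bar>I p * D (fst p) (snd p)\<bar>)) = case_prod E"
        using t0 by (auto simp: fun_eq_iff E_def I_def indicator_def)
      ultimately show ?thesis by simp
    qed
    define W where "W = exp (l * real N * (B + C))"
    have EW: "0 \<le> E s \<omega> \<and> E s \<omega> \<le> indicator {t0..T} s * W" if "\<omega> \<in> space M" for s \<omega>
    proof (cases "s \<in> {t0..T}")
      case True
      then have "\<bar>D s \<omega>\<bar> \<le> B + C" using t0 that by (intro DB) auto
      then have "l * real N * \<bar>D s \<omega>\<bar> \<le> l * real N * (B + C)" using l by (intro mult_left_mono) auto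
      then show ?thesis using True by (simp add: E_def W_def)
    qed (simp add: E_def)
    have Eint: "integrable (lborel \<Otimes>\<^sub>M M) (case_prod E)"
    proof (rule Bochner_Integration.integrable_bound[OF _ Em])
      have "emeasure (lborel \<Otimes>\<^sub>M M) ({t0..T} \<times> space M) < \<infinity>"
        using t0 by (subst emeasure_pair_measure_Times) (auto simp: emeasure_space_1)
      then show "integrable (lborel \<Otimes>\<^sub>M M) (\<lambda>p. W * indicator ({t0..T} \<times> space M) p)"
        by (intro integrable_mult_right integrable_real_indicator) auto
      have "norm (case_prod E p) \<le> norm (W * indicator ({t0..T} \<times> space M) p)" if "p \<in> space (lborel \<Otimes>\<^sub>M M)" for p
        using that EW[of "snd p" "fst p"] by (cases p) (auto simp: space_pair_measure indicator_def W_def)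
      then show "AE p in lborel \<Otimes>\<^sub>M M. norm (case_prod E p) \<le> norm (W * indicator ({t0..T} \<times> space M) p)"
        by (rule AE_I2)
    qed
    define Z where "Z \<omega> = (\<integral>s. E s \<omega> \<partial>lborel)" for \<omega>
    have Zint: "integrable M Z" unfolding Z_def by (rule LM.integrable_snd[OF Eint])
    have EZ: "(\<integral>\<omega>. Z \<omega> \<partial>M) \<le> L * (2 * exp (l * real N * (a / 2)))"
    proof -
      have "(\<integral>\<omega>. Z \<omega> \<partial>M) = (\<integral>s. (\<integral>\<omega>. E s \<omega> \<partial>M) \<partial>lborel)"
        unfolding Z_def by (rule LM.Fubini_integral[OF Eint])
      also have "\<dots> \<le> (\<integral>s. indicator {t0..T} s * (2 * exp (l * real N * (a / 2))) \<partial>lborel)"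
      proof (rule integral_mono)
        show "integrable lborel (\<lambda>s. \<integral>\<omega>. E s \<omega> \<partial>M)" by (rule LM.integrable_fst[OF Eint])
        show "integrable lborel (\<lambda>s. indicator {t0..T} s * (2 * exp (l * real N * (a / 2))))"
          using t0 by (intro integrable_mult_left integrable_real_indicator) auto
        fix s
        show "(\<integral>\<omega>. E s \<omega> \<partial>M) \<le> indicator {t0..T} s * (2 * exp (l * real N * (a / 2)))"
        proof (cases "s \<in> {t0..T}")
          case True
          have "(\<integral>\<omega>. E s \<omega> \<partial>M) = (\<integral>\<omega>. (\<lambda>\<eta>. exp (l * real N * \<bar>pair_field N G s \<eta> - m s\<bar>)) (X s \<omega>) \<partial>M)"
            using True by (simp add: E_def D_def F_def)
          also have "\<dots> = prodE N (\<lambda>x. \<phi> (real x / real N)) (kernel_op K s (\<lambda>\<eta>. exp (l * real N * \<bar>pair_field N G s \<eta> - m s\<bar>)))"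
            using True t0 by (intro law) auto
          also have "\<dots> \<le> 2 * exp (l * real N * (a / 2))" using N0 N K True by simp
          finally show ?thesis using True by simp
        qed (simp add: E_def)
      qed
      also have "\<dots> = L * (2 * exp (l * real N * (a / 2)))"
        using t0 by (simp add: L_def)
      finally show ?thesis .
    qed
    have big: "L * exp (l * real N * a) \<le> Z \<omega>"
      if \<omega>: "\<omega> \<in> space M" and far: "\<bar>(LBINT s:{0..T}. F s \<omega>) - (LBINT s:{0..T}. m s)\<bar> > \<epsilon>" for \<omega>
    proof -
      have sec: "(\<lambda>s. (s, \<omega>)) \<in> measurable lborel (lborel \<Otimes>\<^sub>M M)" using \<omega> by simp
      have Fs: "(\<lambda>s. indicator {0..T} s *\<^sub>R F s \<omega>) \<in> borel_measurable lborel"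
        using measurable_compose[OF sec Fm] by (simp add: I_def)
      have Ds: "(\<lambda>s. indicator {0..T} s *\<^sub>R D s \<omega>) \<in> borel_measurable lborel"
        using measurable_compose[OF sec Dm] by (simp add: I_def)
      have const: "set_integrable lborel {0..T} (\<lambda>_. c)" for c :: real
        by (rule borel_integrable_atLeastAtMost') simp
      have iF: "set_integrable lborel {0..T} (\<lambda>s. F s \<omega>)"
        unfolding set_integrable_def
        by (rule Bochner_Integration.integrable_bound[OF const[of B, unfolded set_integrable_def] Fs])
          (use FB \<omega> B in \<open>auto simp: indicator_def intro!: AE_I2\<close>)
      have im: "set_integrable lborel {0..T} m" by (rule borel_integrable_atLeastAtMost'[OF mcont])
      have iD: "set_integrable lborel {0..T} (\<lambda>s. D s \<omega>)"
        unfolding D_def by (rule set_integral_diff(1)[OF iF im])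
      have iA: "set_integrable lborel {0..T} (\<lambda>s. \<bar>D s \<omega>\<bar>)" by (rule set_integrable_abs[OF iD])
      have iA1: "set_integrable lborel {0..<t0} (\<lambda>s. \<bar>D s \<omega>\<bar>)" and iA2: "set_integrable lborel {t0..T} (\<lambda>s. \<bar>D s \<omega>\<bar>)"
        using t0 by (intro set_integrable_subset[OF iA]; auto)+
      have "\<epsilon> < \<bar>LBINT s:{0..T}. D s \<omega>\<bar>"
        using far unfolding D_def set_integral_diff(2)[OF iF im] .
      also have "\<bar>LBINT s:{0..T}. D s \<omega>\<bar> \<le> (LBINT s:{0..T}. \<bar>D s \<omega>\<bar>)"
        using set_integral_norm_bound[OF iD] by simp
      also have "{0..T} = {0..<t0} \<union> {t0..T}" using t0 by auto
      also have "(LBINT s:{0..<t0} \<union> {t0..T}. \<bar>D s \<omega>\<bar>) = (LBINT s:{0..<t0}. \<bar>D s \<omega>\<bar>) + (LBINT s:{t0..T}. \<bar>D s \<omega>\<bar>)"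
        by (rule set_integral_Un[OF _ iA1 iA2]) auto
      also have "(LBINT s:{0..<t0}. \<bar>D s \<omega>\<bar>) \<le> (LBINT s:{0..<t0}. B + C)"
        using DB \<omega> t0 by (intro set_integral_mono iA1 set_integrable_subset[OF const]) auto
      also have "(LBINT s:{0..<t0}. B + C) = t0 * (B + C)"
        using t0 by (simp add: set_lebesgue_integral_def)
      finally have large: "L * a \<le> (LBINT s:{t0..T}. \<bar>D s \<omega>\<bar>)" using t0(3) a(2) by linarith
      \<comment> \<open>\<open>q\<close> is the value of the exponential at the point
        \<open>l * N * a\<close>. Jensen's inequality is carried out by integrating the tangent at
        this point; the average of the deviation is at least \<open>a\<close>, so the integrated
        tangent is at least \<open>L * q\<close>.\<close>
      define q where "q = exp (l * real N * a)"
      have "L * q \<le> q * (L + l * real N * ((LBINT s:{t0..T}. \<bar>D s \<omega>\<bar>) - L * a))"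
      proof -
        have "0 \<le> l * real N * ((LBINT s:{t0..T}. \<bar>D s \<omega>\<bar>) - L * a)" using large l by simp
        then have "q * L \<le> q * (L + l * real N * ((LBINT s:{t0..T}. \<bar>D s \<omega>\<bar>) - L * a))"
          by (intro mult_left_mono) (auto simp: q_def)
        then show ?thesis by (simp only: mult.commute)
      qed
      also have "\<dots> = (LBINT s:{t0..T}. q * (1 - l * real N * a) + q * (l * real N) * \<bar>D s \<omega>\<bar>)"
      proof -
        have c2: "set_integrable lborel {t0..T} (\<lambda>_. c)" for c :: real
          by (rule borel_integrable_atLeastAtMost') simp
        have "(LBINT s:{t0..T}. q * (1 - l * real N * a) + q * (l * real N) * \<bar>D s \<omega>\<bar>)
          = (LBINT s:{t0..T}. q * (1 - l * real N * a)) + (LBINT s:{t0..T}. q * (l * real N) * \<bar>D s \<omega>\<bar>)"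
          by (rule set_integral_add(2)[OF c2 set_integrable_mult_right[OF iA2]])
        also have "(LBINT s:{t0..T}. q * (1 - l * real N * a)) = L * (q * (1 - l * real N * a))"
          using t0 by (simp add: set_lebesgue_integral_def L_def)
        finally show ?thesis by (simp add: algebra_simps)
      qed
      also have "\<dots> \<le> (LBINT s:{t0..T}. exp (l * real N * \<bar>D s \<omega>\<bar>))"
      proof (rule set_integral_mono)
        show "set_integrable lborel {t0..T} (\<lambda>s. q * (1 - l * real N * a) + q * (l * real N) * \<bar>D s \<omega>\<bar>)"
          by (intro set_integral_add(1) set_integrable_mult_right iA2 borel_integrable_atLeastAtMost' continuous_on_const)
        have "integrable lborel (\<lambda>s. E s \<omega>)"
        proof (rule Bochner_Integration.integrable_bound)
          show "integrable lborel (\<lambda>s. indicator {t0..T} s * W)"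
            using t0 by (intro integrable_mult_left integrable_real_indicator) auto
          show "(\<lambda>s. E s \<omega>) \<in> borel_measurable lborel" using measurable_compose[OF sec Em] by simp
          show "AE s in lborel. norm (E s \<omega>) \<le> norm (indicator {t0..T} s * W)"
            using EW[OF \<omega>] by (intro AE_I2) (auto simp: W_def)
        qed
        then show "set_integrable lborel {t0..T} (\<lambda>s. exp (l * real N * \<bar>D s \<omega>\<bar>))"
          by (simp add: set_integrable_def E_def)
        fix s
        define y where "y = l * real N * \<bar>D s \<omega>\<bar> - l * real N * a"
        have "q * (1 + y) \<le> q * exp y" using exp_ge_add_one_self[of y] by (intro mult_left_mono) (auto simp: q_def)
        also have "q * exp y = exp (l * real N * \<bar>D s \<omega>\<bar>)" by (simp add: q_def y_def flip: exp_add)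
        finally show "q * (1 - l * real N * a) + q * (l * real N) * \<bar>D s \<omega>\<bar> \<le> exp (l * real N * \<bar>D s \<omega>\<bar>)"
          by (simp add: y_def algebra_simps)
      qed
      also have "\<dots> = Z \<omega>" by (simp add: Z_def E_def set_lebesgue_integral_def)
      finally show ?thesis by (simp add: q_def)
    qed
    let ?c = "L * exp (l * real N * a)"
    have c: "0 < ?c" using L by simp
    have "\<P>(\<omega> in M. \<bar>(LBINT s:{0..T}. F s \<omega>) - (LBINT s:{0..T}. m s)\<bar> > \<epsilon>) \<le> measure M {\<omega> \<in> space M. ?c \<le> Z \<omega>}"
      using Zint big by (intro finite_measure_mono) auto
    also have "\<dots> \<le> (\<integral>\<omega>. Z \<omega> \<partial>M) / ?c"
      using EW by (intro integral_Markov_inequality_measure[OF Zint _ _ c, where A = "space M"] AE_I2)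
        (auto simp: Z_def intro!: Bochner_Integration.integral_nonneg)
    also have "\<dots> \<le> L * (2 * exp (l * real N * (a / 2))) / ?c"
      using EZ c by (intro divide_right_mono) auto
    also have "\<dots> = 2 * (exp (l * real N * (a / 2)) / exp (l * real N * a))" using L by simp
    also have "\<dots> = 2 * exp (- (l * a / 2) * real N)"
      by (simp add: algebra_simps flip: exp_diff)
    finally show ?thesis unfolding F_def .
  qed
  then show ?thesis
    using l a(1) unfolding m_def
    by (intro exI[of _ "l * a / 2"] conjI exI[of _ "max 3 N0"]) auto
qed

text \<open>After the prefactor 2 has been absorbed into half of the rate, the expression is at most
  \<open>- c / 2\<close> divided by \<open>(a N / N)^2\<close>, whose denominator tends to 0. If the
  probability is 0, the value is already minus infinity.\<close>

lemma log_prob_superexponential: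
  fixes a p :: "nat \<Rightarrow> real"
  assumes a: "\<And>N. N \<ge> 1 \<Longrightarrow> a N > 0" "(\<lambda>N. a N / real N) \<longlonglongrightarrow> 0"
    and c: "0 < c" and p: "\<And>N. N0 \<le> N \<Longrightarrow> 0 \<le> p N \<and> p N \<le> 2 * exp (- c * real N)"
  shows "limsup (\<lambda>N. ereal (real N / (a N)\<^sup>2) * log_prob (p N)) = -\<infinity>"
proof -
  have "limsup (\<lambda>N. ereal (real N / (a N)\<^sup>2) * log_prob (p N)) \<le> ereal r" for r
  proof (rule Limsup_bounded)
    \<comment> \<open>Chosen so that \<open>c / 2 / d^2 = \<bar>r\<bar> + 1\<close>; once
      \<open>a N / N\<close> is below \<open>d\<close>, the expression lies below
      \<open>r\<close>.\<close>
    define d where "d = sqrt (c / (2 * (\<bar>r\<bar> + 1)))"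
    have d: "0 < d" "c / 2 / d\<^sup>2 = \<bar>r\<bar> + 1" using c by (auto simp: d_def field_simps)
    have small: "\<forall>\<^sub>F N in sequentially. a N / real N < d" using a(2) d(1) by (rule order_tendstoD)
    obtain n1 :: nat where n1: "2 * ln 2 / c < real n1" using reals_Archimedean2[of "2 * ln 2 / c"] by (elim exE)
    show "\<forall>\<^sub>F N in sequentially. ereal (real N / (a N)\<^sup>2) * log_prob (p N) \<le> ereal r"
      using small eventually_ge_at_top[of "max 1 (max n1 N0)"]
    proof eventually_elim
      case (elim N)
      have N: "1 \<le> N" "n1 \<le> N" "N0 \<le> N" "0 < real N" using elim by auto
      have aN: "0 < a N" by (rule a(1)[OF N(1)])
      have w: "0 < real N / (a N)\<^sup>2" using aN N by simp
      show ?case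
      proof (cases "p N = 0")
        case True
        then show ?thesis using aN N by (simp add: log_prob_def)
      next
        case False
        then have p0: "0 < p N" using p[OF N(3)] by simp
        have "ln (p N) \<le> ln (2 * exp (- c * real N))" using p[OF N(3)] p0 by simp
        also have "\<dots> = ln 2 - c * real N" by (simp add: ln_mult)
        also have "\<dots> \<le> - (c / 2 * real N)"
        proof -
          have "2 * ln 2 / c < real N" using n1 N(2) by linarith
          then have "2 * ln 2 < c * real N" using c by (simp add: divide_less_eq mult.commute)
          then show ?thesis by simp
        qed
        finally have "real N / (a N)\<^sup>2 * ln (p N) \<le> real N / (a N)\<^sup>2 * - (c / 2 * real N)"
          using w by (intro mult_left_mono) auto
        also have "\<dots> = - (c / 2 / (a N / real N)\<^sup>2)"
          using aN N by (simp add: power2_eq_square field_simps)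
        also have "\<dots> \<le> - (c / 2 / d\<^sup>2)"
        proof -
          have "0 < a N / real N" using aN N by simp
          then have "0 < (a N / real N)\<^sup>2" by (rule zero_less_power)
          moreover have "(a N / real N)\<^sup>2 \<le> d\<^sup>2"
            using elim(1) \<open>0 < a N / real N\<close> by (intro power_mono less_imp_le)
          ultimately show ?thesis using c d by (intro le_imp_neg_le divide_left_mono) auto
        qed
        also have "\<dots> \<le> r" unfolding d(2) by simp
        finally show ?thesis using False by (simp add: log_prob_def)
      qed
    qed
  qed
  then show ?thesis by (simp add: ereal_bot)
qed

theorem lemma3p2:
  fixes T \<epsilon> :: real
    and a :: "nat \<Rightarrow> real"
    and \<phi> :: "real \<Rightarrow> real"
    and M :: "nat \<Rightarrow> 'w measure"
    and \<eta> :: "nat \<Rightarrow> real \<Rightarrow> 'w \<Rightarrow> config"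
    and \<rho> G :: "real \<Rightarrow> real \<Rightarrow> real"
  assumes "T > 0"
    and "\<And>N. N \<ge> 1 \<Longrightarrow> a N > 0"
    and "(\<lambda>N. a N / real N) \<longlonglongrightarrow> 0"
    and "(\<lambda>N. sqrt (real N) / a N) \<longlonglongrightarrow> 0"
    and "torus_continuous \<phi>"
    and "\<And>u. 0 < \<phi> u \<and> \<phi> u < 1"
    and "\<And>N. N \<ge> 1 \<Longrightarrow> ssep_from_product N \<phi> (M N) (\<eta> N)"
    and "heat_weak_solution \<phi> \<rho>"
    and "\<epsilon> > 0"
    and "C10_torus T G"
  shows "limsup (\<lambda>N. ereal (real N / (a N)\<^sup>2) *
           log_prob (\<P>(\<omega> in M N.
             \<bar>(LBINT s:{0..T}. 1 / real N *
                 (\<Sum>x<N. real (\<eta> N s \<omega> x) * real (\<eta> N s \<omega> ((x + 1) mod N)) * G s (real x / real N)))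
              - (LBINT s:{0..T}. (LBINT u:{0..<1}. (\<rho> s u)\<^sup>2 * G s u))\<bar> > \<epsilon>))) = -\<infinity>"
proof -
  obtain R where R: "is_heat_flow \<phi> R" using heat_flow_exists[OF assms(5)] by (elim exE)
  have "continuous_on ({0..T} \<times> UNIV) (\<lambda>(t, u). G t u)" using assms(10) by (simp add: C10_torus_def)
  then have G: "continuous_on ({0..T} \<times> {0..1}) (\<lambda>(t, u). G t u)" by (rule continuous_on_subset) auto
  have \<phi>: "0 \<le> \<phi> u \<and> \<phi> u \<le> 1" for u using assms(6)[of u] by simp
  \<comment> \<open>The inner integrals agree at every single time, so no measurability in time of
    the squared weak solution is involved.\<close>
  have limit_eq: "(LBINT s:{0..T}. circle_int (\<lambda>u. (\<rho> s u)\<^sup>2 * G s u)) = (LBINT s:{0..T}. circle_int (\<lambda>u. (R s u)\<^sup>2 * G s u))"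
  proof (rule set_lebesgue_integral_cong)
    show "\<forall>s. s \<in> {0..T} \<longrightarrow> circle_int (\<lambda>u. (\<rho> s u)\<^sup>2 * G s u) = circle_int (\<lambda>u. (R s u)\<^sup>2 * G s u)"
      using weak_solution_square_integral[OF R assms(5,8)] continuous_on_slice[OF G] by simp
  qed simp
  obtain c N0 where c: "0 < c" and N0: "\<forall>N\<ge>N0. \<forall>M X. ssep_from_product N \<phi> (M :: 'w measure) X \<longrightarrow>
    \<P>(\<omega> in M. \<bar>(LBINT s:{0..T}. pair_field N G s (X s \<omega>))
      - (LBINT s:{0..T}. circle_int (\<lambda>u. (R s u)\<^sup>2 * G s u))\<bar> > \<epsilon>) \<le> 2 * exp (- c * real N)"
    using exponential_estimate[OF assms(1) assms(9) R \<phi> G] by (elim exE conjE)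
  show ?thesis
    unfolding limit_eq
  proof (rule log_prob_superexponential[OF assms(2,3) c])
    fix N assume N: "max 1 N0 \<le> N"
    then have "ssep_from_product N \<phi> (M N) (\<eta> N)" by (intro assms(7)) simp
    with N0 N show "0 \<le> \<P>(\<omega> in M N. \<bar>(LBINT s:{0..T}. 1 / real N *
                 (\<Sum>x<N. real (\<eta> N s \<omega> x) * real (\<eta> N s \<omega> ((x + 1) mod N)) * G s (real x / real N)))
              - (LBINT s:{0..T}. circle_int (\<lambda>u. (R s u)\<^sup>2 * G s u))\<bar> > \<epsilon>) \<and>
       \<P>(\<omega> in M N. \<bar>(LBINT s:{0..T}. 1 / real N *
                 (\<Sum>x<N. real (\<eta> N s \<omega> x) * real (\<eta> N s \<omega> ((x + 1) mod N)) * G s (real x / real N)))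
              - (LBINT s:{0..T}. circle_int (\<lambda>u. (R s u)\<^sup>2 * G s u))\<bar> > \<epsilon>) \<le> 2 * exp (- c * real N)"
      unfolding pair_field_def by simp
  qed
qed

end
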